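(* Let $\mathfrak g$ be the maximal Lie invariance algebra and $G$ the point symmetry pseudogroup of the heat equation $u_t=u_{xx}$. A complete list of $G$-inequivalent one-dimensional subalgebras of $\mathfrak g$ consists of the subalgebras $$\langle\mathcal P^t+\mathcal G^x\rangle,\quad \langle\mathcal P^t+\delta\mathcal I\rangle\ (\delta\in\{-1,0,1\}),\quad \langle\mathcal D+\mu\mathcal I\rangle\ (\mu\in\mathbb R_{\geqslant0}),\quad \langle\mathcal P^t+\mathcal K+\nu\mathcal I\rangle\ (\nu\in\mathbb R),\quad \langle\mathcal P^x\rangle,\quad \langle\mathcal I\rangle$$ and the subalgebras of the form $\langle\mathcal Z(f)\rangle$, where the function $f$ belongs to a fixed complete set of $G^{\rm ess}$-inequivalent nonzero solutions of the heat equation.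
   Context: $\mathfrak g=\mathfrak g^{\rm ess}\dotplus\mathfrak g^{\rm lin}$ is spanned by the vector fields $\mathcal P^t=\partial_t$, $\mathcal D=2t\partial_t+x\partial_x-\tfrac12u\partial_u$, $\mathcal K=t^2\partial_t+tx\partial_x-\tfrac14(x^2+2t)u\partial_u$, $\mathcal G^x=t\partial_x-\tfrac12xu\partial_u$, $\mathcal P^x=\partial_x$, $\mathcal I=u\partial_u$ (spanning $\mathfrak g^{\rm ess}$), and $\mathcal Z(f)=f(t,x)\partial_u$ (constituting the abelian ideal $\mathfrak g^{\rm lin}$), where $f$ runs through the solution set of $f_t=f_{xx}$. $G$ consists of the transformations $$\tilde t=\frac{\alpha t+\beta}{\gamma t+\delta},\quad \tilde x=\frac{x+\lambda_1t+\lambda_0}{\gamma t+\delta},\quad \tilde u=\sigma\sqrt{|\gamma t+\delta|}\,\exp\!\left(\frac{\gamma (x+\lambda_1t+\lambda_0)^2}{4(\gamma t+\delta)}-\frac{\lambda_1}2x-\frac{\lambda_1^2}4t\right)\big(u+h(t,x)\big)$$ with real parameters, $\alpha\delta-\beta\gamma=1$, $\sigma\ne0$, and with $h$ an arbitrary solution of the heat equation. $G^{\rm ess}$ is the subgroup of $G$ singled out by $h=0$. The multiplication is composition extended by continuity to the natural domain $\{\gamma t+\delta\ne0\}$ (intersected with the domain coming from $h$). $G$ acts on $\mathfrak g$ by pushforward of vector fields, and two subalgebras are $G$-equivalent if some element of $G$ pushes one forward onto the other. Two solutions are $G^{\rm ess}$-equivalent if an element of $G^{\rm ess}$ maps the graph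 of one to the graph of the other. All considerations are local: solutions $f$ and $h$ are smooth functions defined on open subsets of $\mathbb R^2_{t,x}$, which may be shrunk when needed. *)

theory Defs
  imports "HOL-Analysis.Analysis"
begin

fun C_k_on :: "nat \<Rightarrow> 'a::real_normed_vector set \<Rightarrow> ('a \<Rightarrow> 'b::real_normed_vector) \<Rightarrow> bool" where
  "C_k_on 0 S f \<longleftrightarrow> continuous_on S f"
| "C_k_on (Suc k) S f \<longleftrightarrow>
     (\<forall>p\<in>S. f differentiable (at p)) \<and> (\<forall>v. C_k_on k S (\<lambda>p. frechet_derivative f (at p) v))"

definition smooth_on :: "'a::real_normed_vector set \<Rightarrow> ('a \<Rightarrow> 'b::real_normed_vector) \<Rightarrow> bool" where
  "smooth_on S f \<longleftrightarrow> (\<forall>k. C_k_on k S f)"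

definition d_t :: "(real \<times> real \<Rightarrow> real) \<Rightarrow> real \<times> real \<Rightarrow> real" where
  "d_t f p = frechet_derivative f (at p) (1, 0)"

definition d_x :: "(real \<times> real \<Rightarrow> real) \<Rightarrow> real \<times> real \<Rightarrow> real" where
  "d_x f p = frechet_derivative f (at p) (0, 1)"

text \<open>Points of the independent variables are pairs \<open>(t, x)\<close>. A local function is an open domain
  together with a total function, whose values outside the domain are irrelevant.\<close>

definition heat_solution :: "(real \<times> real) set \<Rightarrow> (real \<times> real \<Rightarrow> real) \<Rightarrow> bool" where
  "heat_solution \<Omega> f \<longleftrightarrow> open \<Omega> \<and> smooth_on \<Omega> f \<and> (\<forall>p\<in>\<Omega>. d_t f p = d_x (d_x f) p)"

definition nonzero_heat_solutions :: "((real \<times> real) set \<times> (real \<times> real \<Rightarrow> real)) set" where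
  "nonzero_heat_solutions = {(\<Omega>, f). heat_solution \<Omega> f \<and> (\<exists>p\<in>\<Omega>. f p \<noteq> 0)}"


text \<open>Vector fields on the space of \<open>(t, x, u)\<close>, in the basis of the coordinate fields. A vector
  field over an open set \<open>\<Omega>\<close> of the \<open>(t, x)\<close>-plane lives on \<open>\<Omega> \<times> \<real>\<close> and is represented by its
  extension by zero, so that equality of representatives is equality over \<open>\<Omega>\<close>.\<close>

type_synonym vfield = "real \<times> real \<times> real \<Rightarrow> real \<times> real \<times> real"

definition cyl :: "(real \<times> real) set \<Rightarrow> (real \<times> real \<times> real) set" where
  "cyl \<Omega> = {(t, x, u). (t, x) \<in> \<Omega>}"

definition restr :: "(real \<times> real) set \<Rightarrow> vfield \<Rightarrow> vfield" where
  "restr \<Omega> X = (\<lambda>p. if p \<in> cyl \<Omega> then X p else 0)"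

definition vP_t :: vfield where "vP_t = (\<lambda>(t, x, u). (1, 0, 0))"
definition vD :: vfield where "vD = (\<lambda>(t, x, u). (2 * t, x, - (1/2) * u))"
definition vK :: vfield where "vK = (\<lambda>(t, x, u). (t\<^sup>2, t * x, - (1/4) * (x\<^sup>2 + 2 * t) * u))"
definition vG_x :: vfield where "vG_x = (\<lambda>(t, x, u). (0, t, - (1/2) * x * u))"
definition vP_x :: vfield where "vP_x = (\<lambda>(t, x, u). (0, 1, 0))"
definition vI :: vfield where "vI = (\<lambda>(t, x, u). (0, 0, u))"
definition vZ :: "(real \<times> real \<Rightarrow> real) \<Rightarrow> vfield" where "vZ f = (\<lambda>(t, x, u). (0, 0, f (t, x)))"

definition heat_algebra :: "(real \<times> real) set \<Rightarrow> vfield set" where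
  "heat_algebra \<Omega> =
     {restr \<Omega> (\<lambda>p. a1 *\<^sub>R vP_t p + a2 *\<^sub>R vD p + a3 *\<^sub>R vK p + a4 *\<^sub>R vG_x p + a5 *\<^sub>R vP_x p
                  + a6 *\<^sub>R vI p + vZ f p)
      | a1 a2 a3 a4 a5 a6 f. heat_solution \<Omega> f}"

definition lie_bracket :: "vfield \<Rightarrow> vfield \<Rightarrow> vfield" where
  "lie_bracket X Y = (\<lambda>p. frechet_derivative Y (at p) (X p) - frechet_derivative X (at p) (Y p))"

definition lie_subalgebra :: "(real \<times> real) set \<Rightarrow> vfield set \<Rightarrow> bool" where
  "lie_subalgebra \<Omega> S \<longleftrightarrow>
     S \<subseteq> heat_algebra \<Omega> \<and> (\<lambda>p. 0) \<in> S \<and>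
     (\<forall>X\<in>S. \<forall>Y\<in>S. (\<lambda>p. X p + Y p) \<in> S) \<and> (\<forall>c. \<forall>X\<in>S. (\<lambda>p. c *\<^sub>R X p) \<in> S) \<and>
     (\<forall>X\<in>S. \<forall>Y\<in>S. restr \<Omega> (lie_bracket X Y) \<in> S)"

definition line :: "(real \<times> real) set \<Rightarrow> vfield \<Rightarrow> vfield set" where
  "line \<Omega> X = {restr \<Omega> (\<lambda>p. c *\<^sub>R X p) | c. True}"

definition one_dim_subalgebras :: "((real \<times> real) set \<times> vfield set) set" where
  "one_dim_subalgebras =
     {(\<Omega>, S). open \<Omega> \<and> \<Omega> \<noteq> {} \<and> lie_subalgebra \<Omega> S \<and>
              (\<exists>X\<in>S. X \<noteq> (\<lambda>p. 0) \<and> S = line \<Omega> X)}"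


definition heat_trans ::
  "real \<Rightarrow> real \<Rightarrow> real \<Rightarrow> real \<Rightarrow> real \<Rightarrow> real \<Rightarrow> real \<Rightarrow> (real \<times> real \<Rightarrow> real) \<Rightarrow>
   real \<times> real \<times> real \<Rightarrow> real \<times> real \<times> real" where
  "heat_trans \<alpha> \<beta> \<gamma> \<delta> l1 l0 \<sigma> h = (\<lambda>(t, x, u).
     ((\<alpha> * t + \<beta>) / (\<gamma> * t + \<delta>),
      (x + l1 * t + l0) / (\<gamma> * t + \<delta>),
      \<sigma> * sqrt \<bar>\<gamma> * t + \<delta>\<bar>
        * exp (\<gamma> * (x + l1 * t + l0)\<^sup>2 / (4 * (\<gamma> * t + \<delta>)) - l1 / 2 * x - l1\<^sup>2 / 4 * t)
        * (u + h (t, x))))"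

text \<open>An element of the pseudogroup is a pair of its natural domain and a map on it.\<close>

definition heat_pseudogroup ::
  "((real \<times> real \<times> real) set \<times> (real \<times> real \<times> real \<Rightarrow> real \<times> real \<times> real)) set" where
  "heat_pseudogroup =
     {(cyl (\<Omega> \<inter> {(t, x). \<gamma> * t + \<delta> \<noteq> 0}), heat_trans \<alpha> \<beta> \<gamma> \<delta> l1 l0 \<sigma> h)
      | \<alpha> \<beta> \<gamma> \<delta> l1 l0 \<sigma> \<Omega> h. \<alpha> * \<delta> - \<beta> * \<gamma> = 1 \<and> \<sigma> \<noteq> 0 \<and> heat_solution \<Omega> h}"

definition heat_pseudogroup_ess ::
  "((real \<times> real \<times> real) set \<times> (real \<times> real \<times> real \<Rightarrow> real \<times> real \<times> real)) set" where
  "heat_pseudogroup_ess =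
     {(cyl {(t, x). \<gamma> * t + \<delta> \<noteq> 0}, heat_trans \<alpha> \<beta> \<gamma> \<delta> l1 l0 \<sigma> (\<lambda>p. 0))
      | \<alpha> \<beta> \<gamma> \<delta> l1 l0 \<sigma>. \<alpha> * \<delta> - \<beta> * \<gamma> = 1 \<and> \<sigma> \<noteq> 0}"

text \<open>Pushforward of a vector field along a map that is injective on \<open>W\<close>, extended by zero
  outside the image of \<open>W\<close>.\<close>

definition pushforward ::
  "(real \<times> real \<times> real) set \<Rightarrow> (real \<times> real \<times> real \<Rightarrow> real \<times> real \<times> real) \<Rightarrow> vfield \<Rightarrow> vfield" where
  "pushforward W \<Phi> X = (\<lambda>q. if q \<in> \<Phi> ` W
     then (let p = inv_into W \<Phi> q in frechet_derivative \<Phi> (at p) (X p)) else 0)"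


text \<open>Both equivalences are local: the objects may first be shrunk to smaller open sets \<open>U\<close>, \<open>V\<close>.
  Shrinking must not degenerate the object: nonzero vector fields of the subalgebra have to
  stay nonzero, and so does a nonzero solution. This is not automatic, since a smooth solution of
  the heat equation can vanish on an open subset of its domain without vanishing identically.\<close>

definition G_equivalent ::
  "(real \<times> real) set \<times> vfield set \<Rightarrow> (real \<times> real) set \<times> vfield set \<Rightarrow> bool" where
  "G_equivalent = (\<lambda>(\<Omega>1, S1) (\<Omega>2, S2).
     \<exists>(W, \<Phi>) \<in> heat_pseudogroup. \<exists>U V.
       open U \<and> U \<noteq> {} \<and> U \<subseteq> \<Omega>1 \<and> open V \<and> V \<noteq> {} \<and> V \<subseteq> \<Omega>2 \<and>
       inj_on (restr U) S1 \<and> inj_on (restr V) S2 \<and>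
       cyl U \<subseteq> W \<and> \<Phi> ` cyl U = cyl V \<and>
       pushforward (cyl U) \<Phi> ` restr U ` S1 = restr V ` S2)"

definition graph_on :: "(real \<times> real) set \<Rightarrow> (real \<times> real \<Rightarrow> real) \<Rightarrow> (real \<times> real \<times> real) set" where
  "graph_on U f = {(t, x, f (t, x)) | t x. (t, x) \<in> U}"

definition G_ess_equivalent ::
  "(real \<times> real) set \<times> (real \<times> real \<Rightarrow> real) \<Rightarrow> (real \<times> real) set \<times> (real \<times> real \<Rightarrow> real) \<Rightarrow> bool" where
  "G_ess_equivalent = (\<lambda>(\<Omega>1, f1) (\<Omega>2, f2).
     \<exists>(W, \<Phi>) \<in> heat_pseudogroup_ess. \<exists>U V.
       open U \<and> U \<subseteq> \<Omega>1 \<and> open V \<and> V \<subseteq> \<Omega>2 \<and>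
       (\<exists>p\<in>U. f1 p \<noteq> 0) \<and> (\<exists>p\<in>V. f2 p \<noteq> 0) \<and>
       graph_on U f1 \<subseteq> W \<and> \<Phi> ` graph_on U f1 = graph_on V f2)"

definition complete_inequivalent_list :: "('a \<Rightarrow> 'a \<Rightarrow> bool) \<Rightarrow> 'a set \<Rightarrow> 'a set \<Rightarrow> bool" where
  "complete_inequivalent_list R A L \<longleftrightarrow>
     L \<subseteq> A \<and> (\<forall>a\<in>A. \<exists>b\<in>L. R a b) \<and> (\<forall>a\<in>L. \<forall>b\<in>L. a \<noteq> b \<longrightarrow> \<not> R a b)"

end

theory Submission
  imports Defs
begin

text \<open>Write \<open>X = \<tau>(t) \<partial>\<^sub>t + \<xi>(t,x) \<partial>\<^sub>x + (\<eta>(t,x) u + f(t,x)) \<partial>\<^sub>u\<close> for an element of the algebra. The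
  essential part \<open>(\<tau>, \<xi>, \<eta>)\<close> has six coefficients, on which the group acts linearly; the discriminant
  of the quadratic polynomial \<open>\<tau>\<close> and one further polynomial of degree three are invariant. Scaling
  and these invariants yield the normal forms of nonzero essential parts and their inequivalence.

  If the essential part is nonzero, the summand \<open>f \<partial>\<^sub>u\<close> is removed by a shift \<open>u \<mapsto> u + h\<close> with a local
  solution \<open>h\<close> of the heat equation such that \<open>\<tau> h\<^sub>t + \<xi> h\<^sub>x - \<eta> h = - f\<close>. Where \<open>\<tau> > 0\<close>, a gauge factor
  \<open>exp \<theta>\<close> and the invariant \<open>y\<close> of \<open>\<tau> \<partial>\<^sub>t + \<xi> \<partial>\<^sub>x\<close> turn the heat operator into \<open>\<partial>\<^sub>y\<^sup>2 - \<tau> \<partial>\<^sub>t - w(y)\<close> and the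
  first order operator into \<open>\<tau> \<partial>\<^sub>t\<close>. Integration in \<open>t\<close> then leaves a linear second order ODE in \<open>y\<close>
  for the initial value. If \<open>\<tau>\<close> vanishes but \<open>\<xi>\<close> does not, the system for \<open>h\<close> reduces to a closed 1-form.

  If the essential part vanishes, the shift by \<open>h\<close> acts trivially on \<open>f \<partial>\<^sub>u\<close>, and only the essential
  group acts on \<open>f\<close>, in the same way as on graphs of solutions.\<close>

text \<open>The shift \<open>h\<close> must satisfy two equations, the heat equation and a first
  order one. They are compatible because the coefficients stem from a symmetry: the relations
  \<tau>_t = 2 \<xi>_x, \<eta>_x = - \<xi>_t / 2 and \<eta>_t = - \<xi>_xt / 2 close the gauge
  1-form and make the potential constant along the flow of the field. The ranges of the parameters
  come from signs. Multiplying a generator by c scales the discriminant by c^2 and the cubic by c^3.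
  For \<open>vD\<close>, both signs of c can be realized, hence \<mu> \<ge> 0. For
  \<open>vP_t + vK\<close>, the polynomial \<tau> is definite and the group preserves its sign, so
  \<nu> stays arbitrary. For \<open>vP_t + \<delta> vI\<close>, c must be positive but is otherwise
  free, so only the sign of \<delta> survives. For \<open>vP_t + vG_x\<close>, the scaling requires
  a cube root, which exists for both signs.\<close>

section \<open>Smooth functions\<close>

text \<open>Since \<open>S\<close> is open, agreement on \<open>S\<close> is agreement near each of
  its points, so the derivatives agree as well and the induction can continue.\<close>

lemma C_k_on_cong:
  assumes "open S" "\<And>p. p \<in> S \<Longrightarrow> f p = g p" "C_k_on k S f"
  shows "C_k_on k S g"
  using assms(2,3)
proof (induction k arbitrary: f g)
  case 0
  then have "continuous_on S f \<longleftrightarrow> continuous_on S g" by (intro continuous_on_cong) auto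
  with 0(2) show ?case by (simp only: C_k_on.simps)
next
  case (Suc k)
  have D: "(g has_derivative frechet_derivative f (at p)) (at p)" if "p \<in> S" for p
    by (rule has_derivative_transform_within_open[where f = f, OF _ assms(1) that])
      (use Suc.prems that in \<open>simp_all add: frechet_derivative_works\<close>)
  then have eq: "frechet_derivative f (at p) = frechet_derivative g (at p)" if "p \<in> S" for p
    using frechet_derivative_at that by blast
  have "C_k_on k S (\<lambda>p. frechet_derivative g (at p) v)" for v
    by (rule Suc.IH[where f = "\<lambda>p. frechet_derivative f (at p) v"])
      (use Suc.prems(2) in \<open>simp_all add: eq\<close>)
  then show ?case using D by (auto simp: differentiable_def)
qed

lemma C_k_on_SucI:
  assumes "open S" "\<And>p. p \<in> S \<Longrightarrow> (f has_derivative f' p) (at p)" "\<And>v. C_k_on k S (\<lambda>p. f' p v)"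
  shows "C_k_on (Suc k) S f"
proof -
  have "f' p = frechet_derivative f (at p)" if "p \<in> S" for p
    using assms(2) frechet_derivative_at that by blast
  then have "C_k_on k S (\<lambda>p. frechet_derivative f (at p) v)" for v
    using C_k_on_cong[OF assms(1) _ assms(3)[of v]] by simp
  then show ?thesis using assms(2) by (auto simp: differentiable_def)
qed

lemma C_k_on_SucD: "C_k_on (Suc k) S f \<Longrightarrow> C_k_on k S f"
proof (induction k arbitrary: f)
  case 0
  then show ?case
    by (auto intro!: continuous_at_imp_continuous_on differentiable_imp_continuous_within)
next
  case (Suc k)
  then show ?case by (simp del: C_k_on.simps add: C_k_on.simps(2)[of "Suc k"] C_k_on.simps(2)[of k])
qed

lemma C_k_on_subset: "C_k_on k S f \<Longrightarrow> T \<subseteq> S \<Longrightarrow> C_k_on k T f"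
  by (induction k arbitrary: f) (auto intro: continuous_on_subset)

lemma C_k_on_const: "C_k_on k S (\<lambda>p. c)"
  by (induction k arbitrary: c) (auto simp: frechet_derivative_const)

lemma C_k_on_bounded_linear:
  assumes "open S" "bounded_linear L" "C_k_on k S f"
  shows "C_k_on k S (\<lambda>p. L (f p))"
  using assms(3)
proof (induction k arbitrary: f)
  case 0
  then show ?case using assms(2) by (auto intro: bounded_linear.continuous_on)
next
  case (Suc k)
  show ?case
  proof (rule C_k_on_SucI[OF assms(1)])
    show "((\<lambda>p. L (f p)) has_derivative (\<lambda>v. L (frechet_derivative f (at p) v))) (at p)" if "p \<in> S" for p
      using Suc.prems that bounded_linear.has_derivative[OF assms(2)]
      by (auto simp: frechet_derivative_works)
  qed (use Suc in auto)
qed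

lemma C_k_on_add:
  assumes "open S" "C_k_on k S f" "C_k_on k S g"
  shows "C_k_on k S (\<lambda>p. f p + g p)"
  using assms(2,3)
proof (induction k arbitrary: f g)
  case 0
  then show ?case by (auto intro: continuous_intros)
next
  case (Suc k)
  show ?case
  proof (rule C_k_on_SucI[OF assms(1)])
    show "((\<lambda>p. f p + g p) has_derivative
        (\<lambda>v. frechet_derivative f (at p) v + frechet_derivative g (at p) v)) (at p)" if "p \<in> S" for p
      using Suc.prems that by (auto intro!: has_derivative_add simp: frechet_derivative_works)
  qed (use Suc in auto)
qed

lemma C_k_on_mult:
  fixes f g :: "'a::real_normed_vector \<Rightarrow> real"
  assumes "open S" "C_k_on k S f" "C_k_on k S g"
  shows "C_k_on k S (\<lambda>p. f p * g p)"
  using assms(2,3)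
proof (induction k arbitrary: f g)
  case 0
  then show ?case by (auto intro: continuous_intros)
next
  case (Suc k)
  have "C_k_on k S f" "C_k_on k S g" using Suc.prems C_k_on_SucD by blast+
  then show ?case
    using Suc
    by (intro C_k_on_SucI[OF assms(1), where
          f' = "\<lambda>p v. f p * frechet_derivative g (at p) v + frechet_derivative f (at p) v * g p"])
      (auto intro!: C_k_on_add[OF assms(1)] has_derivative_mult simp: frechet_derivative_works)
qed

lemma C_k_on_sum:
  assumes "open S" "finite I" "\<And>i. i \<in> I \<Longrightarrow> C_k_on k S (f i)"
  shows "C_k_on k S (\<lambda>p. \<Sum>i\<in>I. f i p)"
  using assms(2,3) by (induction I) (auto intro: C_k_on_const C_k_on_add[OF assms(1)])

text \<open>The chain rule derivative \<open>f' (\<Psi> p) (\<Psi>' p v)\<close> has a direction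
  that varies with \<open>p\<close>, which the induction hypothesis does not cover. Expanding that
  direction in \<open>Basis\<close> leaves finitely many products of functions of class C^k; this is
  why the middle space is Euclidean.\<close>

lemma C_k_on_compose:
  fixes f :: "'b::euclidean_space \<Rightarrow> real" and \<Psi> :: "'a::real_normed_vector \<Rightarrow> 'b"
  assumes "open S" "open T" "\<Psi> ` S \<subseteq> T" "C_k_on k S \<Psi>" "C_k_on k T f"
  shows "C_k_on k S (\<lambda>p. f (\<Psi> p))"
  using assms(4,5)
proof (induction k arbitrary: f)
  case 0
  then show ?case using assms(3) by (auto intro: continuous_on_compose2)
next
  case (Suc k)
  define f' where "f' = (\<lambda>q. frechet_derivative f (at q))"
  define \<Psi>' where "\<Psi>' = (\<lambda>p. frechet_derivative \<Psi> (at p))"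
  have f': "(f has_derivative f' q) (at q)" if "q \<in> T" for q
    using Suc.prems that by (auto simp: f'_def frechet_derivative_works)
  have \<Psi>': "(\<Psi> has_derivative \<Psi>' p) (at p)" if "p \<in> S" for p
    using Suc.prems that by (auto simp: \<Psi>'_def frechet_derivative_works)
  show ?case
  proof (rule C_k_on_SucI[OF assms(1)])
    fix p assume p: "p \<in> S"
    then have q: "\<Psi> p \<in> T" using assms(3) by auto
    have "((\<lambda>p. f (\<Psi> p)) has_derivative (\<lambda>v. f' (\<Psi> p) (\<Psi>' p v))) (at p)"
      using diff_chain_at[OF \<Psi>'[OF p] f'[OF q]] by (simp add: o_def)
    moreover have "(\<lambda>v. f' (\<Psi> p) (\<Psi>' p v)) = (\<lambda>v. \<Sum>b\<in>Basis. (\<Psi>' p v \<bullet> b) * f' (\<Psi> p) b)"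
    proof
      fix v
      interpret linear "f' (\<Psi> p)" using f'[OF q] has_derivative_linear by blast
      have "f' (\<Psi> p) (\<Psi>' p v) = f' (\<Psi> p) (\<Sum>b\<in>Basis. (\<Psi>' p v \<bullet> b) *\<^sub>R b)"
        by (simp add: euclidean_representation)
      also have "\<dots> = (\<Sum>b\<in>Basis. (\<Psi>' p v \<bullet> b) * f' (\<Psi> p) b)" by (simp add: sum scale)
      finally show "f' (\<Psi> p) (\<Psi>' p v) = (\<Sum>b\<in>Basis. (\<Psi>' p v \<bullet> b) * f' (\<Psi> p) b)" .
    qed
    ultimately show "((\<lambda>p. f (\<Psi> p)) has_derivative
        (\<lambda>v. \<Sum>b\<in>Basis. (\<Psi>' p v \<bullet> b) * f' (\<Psi> p) b)) (at p)"
      by (simp only:)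
  next
    fix v
    have "C_k_on k S (\<lambda>p. f' (\<Psi> p) b)" for b
      by (rule Suc.IH[OF C_k_on_SucD[OF Suc.prems(1)]]) (use Suc.prems(2) in \<open>simp add: f'_def\<close>)
    moreover have "C_k_on k S (\<lambda>p. \<Psi>' p v \<bullet> b)" for b
      unfolding \<Psi>'_def using Suc.prems
      by (intro C_k_on_bounded_linear[OF assms(1) bounded_linear_inner_left]) simp
    ultimately show "C_k_on k S (\<lambda>p. \<Sum>b\<in>Basis. (\<Psi>' p v \<bullet> b) * f' (\<Psi> p) b)"
      by (intro C_k_on_sum C_k_on_mult assms(1)) auto
  qed
qed

section \<open>Closure properties of smooth functions\<close>

lemma smooth_on_cong:
  "open S \<Longrightarrow> (\<And>p. p \<in> S \<Longrightarrow> f p = g p) \<Longrightarrow> smooth_on S f \<Longrightarrow> smooth_on S g"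
  unfolding smooth_on_def using C_k_on_cong by blast

lemma smooth_on_subset: "smooth_on S f \<Longrightarrow> T \<subseteq> S \<Longrightarrow> smooth_on T f"
  unfolding smooth_on_def using C_k_on_subset by blast

lemma smooth_on_const: "smooth_on S (\<lambda>p. c)"
  unfolding smooth_on_def using C_k_on_const by blast

lemma smooth_on_add:
  "open S \<Longrightarrow> smooth_on S f \<Longrightarrow> smooth_on S g \<Longrightarrow> smooth_on S (\<lambda>p. f p + g p)"
  unfolding smooth_on_def using C_k_on_add by blast

lemma smooth_on_mult:
  fixes f g :: "'a::real_normed_vector \<Rightarrow> real"
  shows "open S \<Longrightarrow> smooth_on S f \<Longrightarrow> smooth_on S g \<Longrightarrow> smooth_on S (\<lambda>p. f p * g p)"
  unfolding smooth_on_def using C_k_on_mult by blast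

lemma smooth_on_compose:
  fixes f :: "'b::euclidean_space \<Rightarrow> real" and \<Psi> :: "'a::real_normed_vector \<Rightarrow> 'b"
  shows "open S \<Longrightarrow> open T \<Longrightarrow> \<Psi> ` S \<subseteq> T \<Longrightarrow> smooth_on S \<Psi> \<Longrightarrow> smooth_on T f
    \<Longrightarrow> smooth_on S (\<lambda>p. f (\<Psi> p))"
  unfolding smooth_on_def using C_k_on_compose by blast

lemma smooth_on_bounded_linear_compose:
  "open S \<Longrightarrow> bounded_linear L \<Longrightarrow> smooth_on S f \<Longrightarrow> smooth_on S (\<lambda>p. L (f p))"
  unfolding smooth_on_def using C_k_on_bounded_linear by blast

lemma C_k_on_id: "open S \<Longrightarrow> C_k_on k S (\<lambda>p. p)"
proof (induction k)
  case (Suc k)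
  show ?case
    by (rule C_k_on_SucI[OF Suc.prems has_derivative_ident C_k_on_const])
qed (simp add: continuous_on_id)

lemma smooth_on_bounded_linear: "open S \<Longrightarrow> bounded_linear L \<Longrightarrow> smooth_on S L"
  using smooth_on_bounded_linear_compose[of S L "\<lambda>p. p"] C_k_on_id by (auto simp: smooth_on_def)

lemma smooth_on_fst: "open S \<Longrightarrow> smooth_on S fst"
  and smooth_on_snd: "open S \<Longrightarrow> smooth_on S snd"
  by (simp_all add: smooth_on_bounded_linear bounded_linear_fst bounded_linear_snd)

lemma smooth_on_Pair:
  assumes "open S" "smooth_on S f" "smooth_on S g"
  shows "smooth_on S (\<lambda>p. (f p, g p))"
proof -
  have "bounded_linear (\<lambda>a. (a, 0))" "bounded_linear (\<lambda>b. (0, b))"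
    by (auto intro!: bounded_linear_Pair bounded_linear_ident bounded_linear_zero)
  from smooth_on_add[OF assms(1) smooth_on_bounded_linear_compose[OF assms(1) this(1) assms(2)]
      smooth_on_bounded_linear_compose[OF assms(1) this(2) assms(3)]]
  show ?thesis by simp
qed

lemma smooth_on_minus:
  fixes f :: "'a::real_normed_vector \<Rightarrow> real"
  shows "open S \<Longrightarrow> smooth_on S f \<Longrightarrow> smooth_on S (\<lambda>p. - f p)"
  using smooth_on_mult[of S "\<lambda>p. -1" f] smooth_on_const[of S "-1::real"] by simp

lemma smooth_on_diff:
  fixes f g :: "'a::real_normed_vector \<Rightarrow> real"
  shows "open S \<Longrightarrow> smooth_on S f \<Longrightarrow> smooth_on S g \<Longrightarrow> smooth_on S (\<lambda>p. f p - g p)"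
  using smooth_on_add[of S f "\<lambda>p. - g p"] smooth_on_minus[of S g] by simp

lemma smooth_on_power:
  fixes f :: "'a::real_normed_vector \<Rightarrow> real"
  shows "open S \<Longrightarrow> smooth_on S f \<Longrightarrow> smooth_on S (\<lambda>p. f p ^ n)"
  by (induction n) (auto intro: smooth_on_const smooth_on_mult)

lemma smooth_on_real_exp:
  fixes f :: "'a::real_normed_vector \<Rightarrow> real"
  assumes "open S" "smooth_on S f"
  shows "smooth_on S (\<lambda>p. exp (f p))"
proof -
  have "C_k_on k UNIV (exp :: real \<Rightarrow> real)" for k
  proof (induction k)
    case (Suc k)
    show ?case
      by (rule C_k_on_SucI[where f' = "\<lambda>p v. exp p * v"])
        (auto intro!: derivative_eq_intros C_k_on_mult Suc C_k_on_const)
  qed (auto intro: continuous_intros)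
  then show ?thesis
    using smooth_on_compose[OF assms(1) open_UNIV _ assms(2), of exp] by (simp add: smooth_on_def)
qed

lemma smooth_on_inverse:
  fixes f :: "'a::real_normed_vector \<Rightarrow> real"
  assumes "open S" "smooth_on S f" "\<And>p. p \<in> S \<Longrightarrow> f p \<noteq> 0"
  shows "smooth_on S (\<lambda>p. inverse (f p))"
proof -
  have "C_k_on k (- {0}) (inverse :: real \<Rightarrow> real)" for k
  proof (induction k)
    case (Suc k)
    have "C_k_on k (- {0}) (\<lambda>p. inverse p * (- v) * inverse p)" for v :: real
      by (intro C_k_on_mult Suc C_k_on_const) auto
    then show ?case
      by (intro C_k_on_SucI[where f' = "\<lambda>p v. inverse p * (- v) * inverse p"])
        (auto intro!: derivative_eq_intros)
  qed (auto intro: continuous_intros)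
  then show ?thesis
    using smooth_on_compose[OF assms(1) _ _ assms(2), of "- {0}" inverse] assms(3)
    by (force simp: smooth_on_def)
qed

lemma smooth_on_divide:
  fixes f g :: "'a::real_normed_vector \<Rightarrow> real"
  shows "open S \<Longrightarrow> smooth_on S f \<Longrightarrow> smooth_on S g \<Longrightarrow> (\<And>p. p \<in> S \<Longrightarrow> g p \<noteq> 0) \<Longrightarrow>
    smooth_on S (\<lambda>p. f p / g p)"
  unfolding divide_inverse by (intro smooth_on_mult smooth_on_inverse)

lemma smooth_on_sqrt:
  fixes f :: "'a::real_normed_vector \<Rightarrow> real"
  assumes "open S" "smooth_on S f" "\<And>p. p \<in> S \<Longrightarrow> f p > 0"
  shows "smooth_on S (\<lambda>p. sqrt (f p))"
proof -
  have "C_k_on k {0<..} sqrt" for k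
  proof (induction k)
    case (Suc k)
    \<comment> \<open>Writing the derivative 1 / (2 sqrt x) with \<open>sqrt x * inverse x\<close>
      makes it a product of the square root itself, covered by the induction hypothesis, and the
      smooth inverse.\<close>
    have "C_k_on k {0<..} (\<lambda>x. inverse (x::real))"
      using smooth_on_inverse[OF _ smooth_on_bounded_linear[OF _ bounded_linear_ident], of "{0<..}"]
      by (auto simp: smooth_on_def)
    then have "C_k_on k {0<..} (\<lambda>x. sqrt x * inverse x * (v / 2))" for v
      by (intro C_k_on_mult Suc C_k_on_const) auto
    moreover have "(sqrt has_derivative (\<lambda>v. sqrt x * inverse x * (v / 2))) (at x)" if "x \<in> {0<..}" for x
    proof -
      have "(sqrt has_derivative (\<lambda>v. inverse (sqrt x) / 2 * v)) (at x)"
        using that by (intro DERIV_real_sqrt[unfolded has_field_derivative_def]) simp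
      moreover have "(\<lambda>v. inverse (sqrt x) / 2 * v) = (\<lambda>v. sqrt x * inverse x * (v / 2))"
        using that real_sqrt_mult_self[of x] by (auto simp: field_simps)
      ultimately show ?thesis by simp
    qed
    ultimately show ?case
      by (intro C_k_on_SucI[where f' = "\<lambda>x v. sqrt x * inverse x * (v / 2)"]) auto
  qed (auto intro: continuous_intros)
  then show ?thesis
    using smooth_on_compose[OF assms(1) _ _ assms(2), of "{0<..}" sqrt] assms(3)
    by (force simp: smooth_on_def)
qed

lemmas smooth_on_intros =
  smooth_on_const smooth_on_add smooth_on_mult smooth_on_minus smooth_on_diff smooth_on_power
  smooth_on_real_exp smooth_on_divide smooth_on_sqrt smooth_on_fst smooth_on_snd smooth_on_Pair

lemma smooth_on_imp_continuous_on: "smooth_on S f \<Longrightarrow> continuous_on S f"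
  unfolding smooth_on_def by (drule spec[of _ 0]) simp

lemma smooth_on_imp_has_derivative:
  "smooth_on S f \<Longrightarrow> p \<in> S \<Longrightarrow> (f has_derivative frechet_derivative f (at p)) (at p)"
  unfolding smooth_on_def by (drule spec[of _ "Suc 0"]) (simp add: frechet_derivative_works)

lemma smooth_on_frechet_derivative:
  "smooth_on S f \<Longrightarrow> smooth_on S (\<lambda>p. frechet_derivative f (at p) v)"
  unfolding smooth_on_def
proof
  fix k
  assume "\<forall>k. C_k_on k S f"
  then show "C_k_on k S (\<lambda>p. frechet_derivative f (at p) v)" by (drule_tac spec[of _ "Suc k"]) simp
qed

lemma smooth_on_has_derivativeI:
  assumes "open S" "\<And>p. p \<in> S \<Longrightarrow> (f has_derivative f' p) (at p)" "\<And>v. smooth_on S (\<lambda>p. f' p v)"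
  shows "smooth_on S f"
  unfolding smooth_on_def
proof
  fix k
  have "C_k_on (Suc k) S f"
    using assms by (intro C_k_on_SucI) (auto simp: smooth_on_def)
  then show "C_k_on k S f" by (rule C_k_on_SucD)
qed

section \<open>Linear ordinary differential equations and parameter integrals\<close>

text \<open>Banach's fixed point theorem for the integral equation with initial value 0. The
  Lipschitz condition holds on the whole space, so no ball has to be kept invariant.\<close>

lemma Picard_Lipschitz_right:
  fixes F :: "real \<Rightarrow> 'a::banach \<Rightarrow> 'a"
  assumes "a < b" and cont: "continuous_on ({a..b} \<times> UNIV) (\<lambda>(t, y). F t y)"
    and L: "L \<ge> 0" "\<And>t y z. t \<in> {a..b} \<Longrightarrow> norm (F t y - F t z) \<le> L * norm (y - z)"
  obtains c Y where "a < c" "c \<le> b"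
    "\<And>t. t \<in> {a..c} \<Longrightarrow> (Y has_vector_derivative F t (Y t)) (at t within {a..c})"
proof -
  \<comment> \<open>The interval is short enough for the contraction constant 1/2;
    \<open>L + 1\<close> keeps the divisor positive when \<open>L = 0\<close>.\<close>
  define c where "c = a + min (b - a) (1 / (2 * (L + 1)))"
  have c: "a < c" "c \<le> b" using assms(1) L(1) by (auto simp: c_def)
  have "L * (c - a) \<le> L * (1 / (2 * (L + 1)))" unfolding c_def using L(1) by (intro mult_left_mono) auto
  also have "\<dots> \<le> 1 / 2" using L(1) by (simp add: field_simps)
  finally have Lc: "L * (c - a) \<le> 1 / 2" .
  have contF: "continuous_on {a..c} (\<lambda>s. F s (\<phi> s))" if "continuous_on {a..c} \<phi>" for \<phi>
    using continuous_on_compose2[OF cont continuous_on_Pair[OF continuous_on_id that]] c(2) by force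
  define J where "J = (\<lambda>\<phi>. \<lambda>t. integral {a..t} (\<lambda>s. F s (\<phi> s)))"
  have contJ: "continuous_on (cbox a c) (J \<phi>)" if "continuous_on {a..c} \<phi>" for \<phi>
    using indefinite_integral_continuous_1[OF integrable_continuous_interval[OF contF[OF that]]]
    by (simp add: J_def)
  \<comment> \<open>\<open>clamp\<close> continues the integral constantly outside
    \<open>{a..c}\<close>, so that the Picard operator acts on the Banach space of bounded
    continuous functions on the line.\<close>
  have "\<exists>\<psi>::real \<Rightarrow>\<^sub>C 'a. \<forall>t. \<psi> t = J (apply_bcontfun \<phi>) (clamp a c t)" for \<phi> :: "real \<Rightarrow>\<^sub>C 'a"
    by (rule continuous_on_cbox_bcontfunE[OF contJ[OF continuous_on_apply_bcontfun, of \<phi>]]) blast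
  then obtain T :: "(real \<Rightarrow>\<^sub>C 'a) \<Rightarrow> (real \<Rightarrow>\<^sub>C 'a)"
    where T: "\<And>\<phi> t. T \<phi> t = J (apply_bcontfun \<phi>) (clamp a c t)" by metis
  have "dist (T \<phi>) (T \<psi>) \<le> 1 / 2 * dist \<phi> \<psi>" for \<phi> \<psi>
  proof (rule dist_bound)
    fix t
    define s where "s = clamp a c t"
    have s: "a \<le> s" "s \<le> c" using clamp_in_interval[of a c t] c by (auto simp: s_def)
    have int: "(\<lambda>r. F r (f r)) integrable_on {a..s}" for f :: "real \<Rightarrow>\<^sub>C 'a"
      using s by (intro integrable_continuous_interval continuous_on_subset[OF contF]) auto
    have "dist (T \<phi> t) (T \<psi> t) = norm (integral {a..s} (\<lambda>r. F r (\<phi> r) - F r (\<psi> r)))"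
      by (simp add: T J_def s_def[symmetric] dist_norm integral_diff[OF int int])
    also have "\<dots> \<le> L * dist \<phi> \<psi> * (s - a)"
    proof (rule integral_bound)
      show "continuous_on {a..s} (\<lambda>r. F r (\<phi> r) - F r (\<psi> r))"
        using s by (intro continuous_on_diff continuous_on_subset[OF contF]) auto
      fix r assume "r \<in> {a..s}"
      then have "norm (F r (\<phi> r) - F r (\<psi> r)) \<le> L * norm (\<phi> r - \<psi> r)"
        using s c by (intro L) auto
      also have "\<dots> \<le> L * dist \<phi> \<psi>"
        using L(1) dist_bounded[of \<phi> r \<psi>] by (intro mult_left_mono) (auto simp: dist_norm)
      finally show "norm (F r (\<phi> r) - F r (\<psi> r)) \<le> L * dist \<phi> \<psi>" .
    qed (use s in auto)
    also have "\<dots> \<le> L * dist \<phi> \<psi> * (c - a)" using s L(1) by (intro mult_left_mono) auto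
    also have "\<dots> = L * (c - a) * dist \<phi> \<psi>" by simp
    also have "\<dots> \<le> 1 / 2 * dist \<phi> \<psi>" using Lc by (intro mult_right_mono) auto
    finally show "dist (T \<phi> t) (T \<psi> t) \<le> 1 / 2 * dist \<phi> \<psi>" .
  qed
  then obtain Y where "T Y = Y" using banach_fix_type[of "1 / 2" T] by auto
  then have "Y t = J Y t" if "t \<in> {a..c}" for t
    using T[of Y t] that by (simp add: clamp_cancel_cbox)
  moreover have "(J Y has_vector_derivative F t (Y t)) (at t within {a..c})" if "t \<in> {a..c}" for t
    unfolding J_def using integral_has_vector_derivative[OF contF that] by simp
  ultimately have "(Y has_vector_derivative F t (Y t)) (at t within {a..c})" if "t \<in> {a..c}" for t
    using that by (intro has_vector_derivative_transform[of t "{a..c}" Y "J Y"]) auto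
  with c show ?thesis using that by blast
qed

text \<open>Some solution near the left end is enough for the construction, so no initial values are
  prescribed. \<open>w\<close> is bounded on the compact interval, which makes the first order
  system for \<open>(g, g')\<close> globally Lipschitz.\<close>

lemma linear_ode2_right:
  fixes w p :: "real \<Rightarrow> real"
  assumes "a < b" "continuous_on {a..b} w" "continuous_on {a..b} p"
  obtains c g g' where "a < c" "c \<le> b"
    "\<And>y. y \<in> {a<..<c} \<Longrightarrow> (g has_real_derivative g' y) (at y)"
    "\<And>y. y \<in> {a<..<c} \<Longrightarrow> (g' has_real_derivative w y * g y + p y) (at y)"
proof -
  have "bounded (w ` {a..b})" by (intro compact_imp_bounded compact_continuous_image assms(2)) simp
  then obtain M where M: "\<And>y. y \<in> {a..b} \<Longrightarrow> \<bar>w y\<bar> \<le> M"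
    unfolding bounded_iff by (metis imageI real_norm_def)
  define F where "F = (\<lambda>t (z :: real \<times> real). (snd z, w t * fst z + p t))"
  have contF: "continuous_on ({a..b} \<times> UNIV) (\<lambda>(t, z). F t z)"
  proof -
    have "continuous_on ({a..b} \<times> (UNIV :: (real \<times> real) set)) (\<lambda>q. w (fst q))"
      "continuous_on ({a..b} \<times> (UNIV :: (real \<times> real) set)) (\<lambda>q. p (fst q))"
      by (auto intro!: continuous_on_compose2[OF assms(2)] continuous_on_compose2[OF assms(3)] continuous_intros)
    then show ?thesis unfolding F_def case_prod_unfold by (intro continuous_intros)
  qed
  have lip: "norm (F t y - F t z) \<le> (1 + max M 0) * norm (y - z)" if t: "t \<in> {a..b}" for t y z
  proof -
    have "norm (F t y - F t z) \<le> \<bar>snd y - snd z\<bar> + \<bar>w t * (fst y - fst z)\<bar>"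
      using norm_Pair_le[of "snd y - snd z" "w t * (fst y - fst z)"]
      by (simp add: F_def algebra_simps)
    also have "\<dots> \<le> norm (y - z) + max M 0 * norm (y - z)"
      unfolding abs_mult using norm_fst_le[of "fst (y - z)" "snd (y - z)"] norm_snd_le[of "snd (y - z)" "fst (y - z)"] M[OF t]
      by (intro add_mono mult_mono) (auto simp: minus_prod_def)
    finally show ?thesis by (simp add: algebra_simps)
  qed
  obtain c Y where c: "a < c" "c \<le> b" and
    Y: "\<And>t. t \<in> {a..c} \<Longrightarrow> (Y has_vector_derivative F t (Y t)) (at t within {a..c})"
    by (rule Picard_Lipschitz_right[OF assms(1) contF _ lip]) auto
  have Y': "(Y has_vector_derivative F t (Y t)) (at t)" if "t \<in> {a<..<c}" for t
  proof -
    have "t \<in> {a..c}" "{a<..<c} \<subseteq> {a..c}" using that by auto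
    from has_vector_derivative_within_subset[OF Y[OF this(1)] this(2)]
    show ?thesis by (simp only: at_within_open[OF that open_greaterThanLessThan])
  qed
  show ?thesis
  proof (rule that[OF c, of "\<lambda>y. fst (Y y)" "\<lambda>y. snd (Y y)"])
    fix y assume "y \<in> {a<..<c}"
    from has_derivative_fst[OF Y'[OF this, unfolded has_vector_derivative_def]]
      has_derivative_snd[OF Y'[OF this, unfolded has_vector_derivative_def]]
    show "((\<lambda>y. fst (Y y)) has_real_derivative snd (Y y)) (at y)"
      "((\<lambda>y. snd (Y y)) has_real_derivative w y * fst (Y y) + p y) (at y)"
      by (simp_all add: has_real_derivative_iff_has_vector_derivative has_vector_derivative_def F_def)
  qed
qed

text \<open>Leibniz' rule gives the partial derivative in \<open>y\<close>, the fundamental theorem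
  the one in \<open>t\<close>. Joint differentiability follows because the latter, \<open>B\<close>,
  is jointly continuous.\<close>

lemma has_derivative_integral_parameter:
  fixes B B' :: "real \<Rightarrow> real \<Rightarrow> real"
  assumes "continuous_on ({a..b} \<times> {c..d}) (\<lambda>(s, y). B s y)"
    "continuous_on ({a..b} \<times> {c..d}) (\<lambda>(s, y). B' s y)"
    "\<And>s y. s \<in> {a..b} \<Longrightarrow> y \<in> {c..d} \<Longrightarrow> (B s has_real_derivative B' s y) (at y within {c..d})"
    and t: "t \<in> {a<..<b}" and y: "y \<in> {c<..<d}"
  shows "((\<lambda>(t, y). integral {a..t} (\<lambda>s. B s y)) has_derivative
    (\<lambda>(dt, dy). dt * B t y + dy * integral {a..t} (\<lambda>s. B' s y))) (at (t, y))"
proof -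
  have swap: "continuous_on ({c..d} \<times> {a..b}) (\<lambda>(y, s). B s y)"
     "continuous_on ({c..d} \<times> {a..b}) (\<lambda>(y, s). B' s y)"
    using continuous_on_compose2[OF assms(1) continuous_on_swap[of "{c..d} \<times> {a..b}"]]
      continuous_on_compose2[OF assms(2) continuous_on_swap[of "{c..d} \<times> {a..b}"]]
    by (force simp: prod.swap_def case_prod_unfold)+
  have sec: "continuous_on {a..b} (\<lambda>s. B s z)" if "z \<in> {c..d}" for z
    using continuous_on_compose2[OF assms(1), of "{a..b}" "\<lambda>s. (s, z)"] that
    by (force intro: continuous_intros)
  have "((\<lambda>z. integral (cbox a t) (\<lambda>s. B s z)) has_field_derivative integral (cbox a t) (\<lambda>s. B' s y))
      (at y within {c..d})"
  proof (rule leibniz_rule_field_derivative)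
    show "(\<lambda>s. B s z) integrable_on cbox a t" if "z \<in> {c..d}" for z
      using continuous_on_subset[OF sec[OF that], of "{a..t}"] t by (auto intro: integrable_continuous_interval)
    show "continuous_on ({c..d} \<times> cbox a t) (\<lambda>(z, s). B' s z)"
      using t by (intro continuous_on_subset[OF swap(2)]) auto
  qed (use assms(3) t y in auto)
  then have 1: "((\<lambda>z. integral {a..t} (\<lambda>s. B s z)) has_derivative (\<lambda>dy. dy * integral {a..t} (\<lambda>s. B' s y)))
      (at y within {c<..<d})"
    by (auto simp: has_field_derivative_def mult_commute_abs intro: has_derivative_subset)
  have 2: "((\<lambda>s. integral {a..s} (\<lambda>s. B s z)) has_derivative blinfun_apply (blinfun_mult_left (B s z)))
      (at s within {a<..<b})" if "z \<in> {c<..<d}" "s \<in> {a<..<b}" for z s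
    using integral_has_real_derivative[OF sec, of z s] that
    by (auto simp: has_field_derivative_def mult_commute_abs intro: has_derivative_subset)
  have 3: "continuous (at (y, t) within {c<..<d} \<times> {a<..<b}) (\<lambda>(z, s). blinfun_mult_left (B s z))"
  proof -
    have "continuous_on ({c<..<d} \<times> {a<..<b}) (\<lambda>q. blinfun_mult_left (B (snd q) (fst q)))"
      by (intro bounded_linear.continuous_on[OF bounded_linear_blinfun_mult_left]
          continuous_on_subset[OF swap(1)[unfolded case_prod_unfold]]) auto
    then show ?thesis using t y by (simp add: continuous_on_eq_continuous_within case_prod_unfold)
  qed
  from has_derivative_partialsI[OF 1 2 3]
  have "((\<lambda>(z, s). integral {a..s} (\<lambda>s. B s z)) has_derivative
      (\<lambda>(dy, dt). dy * integral {a..t} (\<lambda>s. B' s y) + dt * B t y)) (at (y, t) within {c<..<d} \<times> {a<..<b})"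
    using t by (simp add: case_prod_unfold)
  then have D: "((\<lambda>(z, s). integral {a..s} (\<lambda>s. B s z)) has_derivative
      (\<lambda>(dy, dt). dy * integral {a..t} (\<lambda>s. B' s y) + dt * B t y)) (at (y, t))"
    using t y by (subst (asm) at_within_open) (auto intro: open_Times)
  \<comment> \<open>\<open>has_derivative_partialsI\<close> wants the variable with the continuous
    partial derivative second, so the two variables are exchanged back here.\<close>
  have "((\<lambda>p. (snd p, fst p)) has_derivative (\<lambda>p. (snd p, fst p))) (at (t, y))"
    by (auto intro!: derivative_eq_intros)
  from diff_chain_at[OF this, where g = "\<lambda>(z, s). integral {a..s} (\<lambda>s. B s z)"
      and g' = "\<lambda>(dy, dt). dy * integral {a..t} (\<lambda>s. B' s y) + dt * B t y"] D
  show ?thesis by (simp add: o_def case_prod_unfold add.commute)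
qed

section \<open>Functions of two variables\<close>

lemma d_t_d_x_eq:
  assumes "(f has_derivative (\<lambda>(dt, dx). dt * a + dx * b)) (at p)"
  shows "d_t f p = a" "d_x f p = b"
  by (simp_all add: d_t_def d_x_def flip: frechet_derivative_at[OF assms])

lemma smooth_on_has_derivative_partials:
  assumes "smooth_on S f" "p \<in> S"
  shows "(f has_derivative (\<lambda>(dt, dx). dt * d_t f p + dx * d_x f p)) (at p)"
proof -
  note D = smooth_on_imp_has_derivative[OF assms]
  interpret linear "frechet_derivative f (at p)" using D has_derivative_linear by blast
  have "frechet_derivative f (at p) (dt, dx) = dt * d_t f p + dx * d_x f p" for dt dx
    using add[of "dt *\<^sub>R (1, 0)" "dx *\<^sub>R (0, 1)"] scale[of dt "(1, 0)"] scale[of dx "(0, 1)"]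
    by (simp add: d_t_def d_x_def)
  then have "frechet_derivative f (at p) = (\<lambda>(dt, dx). dt * d_t f p + dx * d_x f p)" by auto
  with D show ?thesis by simp
qed

lemma smooth_on_d_x: "smooth_on S f \<Longrightarrow> smooth_on S (d_x f)"
  unfolding d_x_def[abs_def] by (rule smooth_on_frechet_derivative)

lemma smooth_on_section_derivatives:
  assumes "smooth_on S f" "(t, x) \<in> S"
  shows "((\<lambda>t. f (t, x)) has_real_derivative d_t f (t, x)) (at t)"
    "((\<lambda>x. f (t, x)) has_real_derivative d_x f (t, x)) (at x)"
proof -
  have 1: "((\<lambda>t. (t, x)) has_derivative (\<lambda>dt. (dt, 0))) (at t)"
    and 2: "((\<lambda>x. (t, x)) has_derivative (\<lambda>dx. (0, dx))) (at x)"
    by (auto intro!: derivative_eq_intros)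
  from diff_chain_at[OF 1 smooth_on_has_derivative_partials[OF assms]]
  show "((\<lambda>t. f (t, x)) has_real_derivative d_t f (t, x)) (at t)"
    by (simp add: has_field_derivative_def o_def mult_commute_abs)
  from diff_chain_at[OF 2 smooth_on_has_derivative_partials[OF assms]]
  show "((\<lambda>x. f (t, x)) has_real_derivative d_x f (t, x)) (at x)"
    by (simp add: has_field_derivative_def o_def mult_commute_abs)
qed

lemma continuous_on_sections:
  assumes "continuous_on S f"
  shows "(\<And>s. s \<in> A \<Longrightarrow> (s, y) \<in> S) \<Longrightarrow> continuous_on A (\<lambda>s. f (s, y))"
    "(\<And>y. y \<in> B \<Longrightarrow> (s, y) \<in> S) \<Longrightarrow> continuous_on B (\<lambda>y. f (s, y))"
  by (auto intro!: continuous_on_compose2[OF assms] continuous_intros)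

lemma smooth_on_integral_has_derivative:
  assumes A: "smooth_on S A" "{a..b} \<times> {c..d} \<subseteq> S" and "t \<in> {a<..<b}" "y \<in> {c<..<d}"
  shows "((\<lambda>(t, y). integral {a..t} (\<lambda>s. A (s, y))) has_derivative
    (\<lambda>(dt, dy). dt * A (t, y) + dy * integral {a..t} (\<lambda>s. d_x A (s, y)))) (at (t, y))"
proof (rule has_derivative_integral_parameter[OF _ _ _ assms(3,4)])
  show "continuous_on ({a..b} \<times> {c..d}) (\<lambda>(s, y). A (s, y))"
    "continuous_on ({a..b} \<times> {c..d}) (\<lambda>(s, y). d_x A (s, y))"
    using smooth_on_imp_continuous_on[OF A(1)] smooth_on_imp_continuous_on[OF smooth_on_d_x[OF A(1)]] A(2)
    by (auto intro: continuous_on_subset)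
  show "((\<lambda>y. A (s, y)) has_real_derivative d_x A (s, y)) (at y within {c..d})"
    if "s \<in> {a..b}" "y \<in> {c..d}" for s y
    by (rule has_field_derivative_at_within[OF smooth_on_section_derivatives(2)[OF A(1)]]) (use A(2) that in auto)
qed

text \<open>The Poincare lemma on a rectangle: integrate \<open>B\<close> along the edge
  \<open>t = a\<close>, then \<open>A\<close> in the \<open>t\<close> direction. The
  \<open>x\<close>-derivative of the second integral is the integral of
  \<open>d_x A = d_t B\<close>, which equals \<open>B (t, x) - B (a, x)\<close>.\<close>

lemma closed_form_potential:
  assumes A: "smooth_on S A" and B: "smooth_on S B" and sub: "{a..b} \<times> {c..d} \<subseteq> S"
    and closed: "\<And>p. p \<in> S \<Longrightarrow> d_x A p = d_t B p"
  obtains v where "\<And>p. p \<in> {a<..<b} \<times> {c<..<d} \<Longrightarrow>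
    (v has_derivative (\<lambda>(dt, dx). dt * A p + dx * B p)) (at p)"
proof (rule that)
  fix p assume "p \<in> {a<..<b} \<times> {c<..<d}"
  then obtain t x where p: "p = (t, x)" "t \<in> {a<..<b}" "x \<in> {c<..<d}" by auto
  have "((\<lambda>x. integral {c..x} (\<lambda>z. B (a, z))) has_real_derivative B (a, x)) (at x within {c..d})"
    using p sub by (intro integral_has_real_derivative continuous_on_sections(2)[OF smooth_on_imp_continuous_on[OF B]]) auto
  then have "((\<lambda>x. integral {c..x} (\<lambda>z. B (a, z))) has_real_derivative B (a, x)) (at x)"
    using p at_within_interior[of x "{c..d}"] by (simp add: interior_atLeastAtMost_real)
  then have G: "((\<lambda>x. integral {c..x} (\<lambda>z. B (a, z))) has_derivative (\<lambda>dx. dx * B (a, x))) (at (snd (t, x)))"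
    by (simp add: has_field_derivative_def mult_commute_abs)
  from diff_chain_at[OF has_derivative_snd[OF has_derivative_ident] G]
  have "((\<lambda>(t, x). integral {c..x} (\<lambda>z. B (a, z))) has_derivative (\<lambda>(dt, dx). dx * B (a, x))) (at (t, x))"
    by (simp add: o_def case_prod_unfold)
  from has_derivative_add[OF smooth_on_integral_has_derivative[OF A sub p(2,3)] this]
  have D: "((\<lambda>(t, x). integral {a..t} (\<lambda>s. A (s, x)) + integral {c..x} (\<lambda>z. B (a, z))) has_derivative
      (\<lambda>(dt, dx). dt * A p + dx * (integral {a..t} (\<lambda>s. d_x A (s, x)) + B (a, x)))) (at p)"
    by (simp add: p(1) case_prod_unfold algebra_simps)
  have "((\<lambda>s. d_x A (s, x)) has_integral (B (t, x) - B (a, x))) {a..t}"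
  proof (rule fundamental_theorem_of_calculus)
    fix s assume "s \<in> {a..t}"
    then have "(s, x) \<in> S" using p sub by auto
    from has_field_derivative_at_within[OF smooth_on_section_derivatives(1)[OF B this]] closed[OF this]
    show "((\<lambda>s. B (s, x)) has_vector_derivative d_x A (s, x)) (at s within {a..t})"
      by (simp add: has_real_derivative_iff_has_vector_derivative)
  qed (use p in auto)
  then have "integral {a..t} (\<lambda>s. d_x A (s, x)) + B (a, x) = B p" by (simp add: p(1) integral_unique)
  with D show "((\<lambda>(t, x). integral {a..t} (\<lambda>s. A (s, x)) + integral {c..x} (\<lambda>z. B (a, z))) has_derivative
      (\<lambda>(dt, dx). dt * A p + dx * B p)) (at p)" by simp
qed

lemma smooth_on_partialsI:
  fixes f A B :: "real \<times> real \<Rightarrow> real"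
  assumes "open S" "\<And>p. p \<in> S \<Longrightarrow> (f has_derivative (\<lambda>(dt, dx). dt * A p + dx * B p)) (at p)"
    "smooth_on S A" "smooth_on S B"
  shows "smooth_on S f"
  using assms(1,3,4) by (intro smooth_on_has_derivativeI[OF assms(1,2)]) (auto intro!: smooth_on_intros)

text \<open>The finite order version of \<open>smooth_on_partialsI\<close>, for bootstrapping when
  the partial derivatives contain the unknown function itself.\<close>

lemma C_k_on_partialsI:
  fixes f A B :: "real \<times> real \<Rightarrow> real"
  assumes "open S" "\<And>p. p \<in> S \<Longrightarrow> (f has_derivative (\<lambda>(dt, dx). dt * A p + dx * B p)) (at p)"
    "C_k_on k S A" "C_k_on k S B"
  shows "C_k_on (Suc k) S f"
  using assms(1,3,4)
  by (intro C_k_on_SucI[OF assms(1,2)]) (auto intro!: C_k_on_add C_k_on_mult C_k_on_const)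

text \<open>With \<open>B = - \<phi> / \<tau>\<close>, the equation for \<open>B\<close> is the heat equation for \<open>\<phi>\<close> in gauged coordinates, and
  \<open>v = g(y) + \<integral> B dt\<close> solves \<open>v\<^sub>y\<^sub>y = w v + \<tau> v\<^sub>t\<close> as soon as it does so at the initial time.\<close>

lemma stationary_gauge_solution:
  assumes "a < b" "c < d" and sub: "{a..b} \<times> {c..d} \<subseteq> S"
    and \<phi>: "smooth_on S \<phi>" and B: "smooth_on S B" and w: "smooth_on S (\<lambda>p. w (snd p))"
    and eq: "\<And>t y. (t, y) \<in> S \<Longrightarrow> d_x (d_x B) (t, y) = w y * B (t, y) - d_t \<phi> (t, y)"
  obtains d' v k where "c < d'" "d' \<le> d"
    "smooth_on ({a<..<b} \<times> {c<..<d'}) v" "smooth_on ({a<..<b} \<times> {c<..<d'}) k"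
    "\<And>p. p \<in> {a<..<b} \<times> {c<..<d'} \<Longrightarrow> (v has_derivative (\<lambda>(dt, dy). dt * B p + dy * k p)) (at p)"
    "\<And>p. p \<in> {a<..<b} \<times> {c<..<d'} \<Longrightarrow>
      (k has_derivative (\<lambda>(dt, dy). dt * d_x B p + dy * (w (snd p) * v p - \<phi> p))) (at p)"
proof -
  have cw: "continuous_on {c..d} w"
    using continuous_on_sections(2)[OF smooth_on_imp_continuous_on[OF w], of "{c..d}" a] sub assms(1) by (auto simp: subset_iff)
  have c\<phi>: "continuous_on {c..d} (\<lambda>y. - \<phi> (a, y))"
    using sub assms(1) by (intro continuous_on_minus continuous_on_sections(2)[OF smooth_on_imp_continuous_on[OF \<phi>]]) auto
  obtain d' g g' where d': "c < d'" "d' \<le> d" and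
    g: "\<And>y. y \<in> {c<..<d'} \<Longrightarrow> (g has_real_derivative g' y) (at y)" and
    g': "\<And>y. y \<in> {c<..<d'} \<Longrightarrow> (g' has_real_derivative w y * g y + - \<phi> (a, y)) (at y)"
    using linear_ode2_right[OF assms(2) cw c\<phi>] by blast
  define R where "R = {a<..<b} \<times> {c<..<d'}"
  have R: "open R" "R \<subseteq> S" using sub d' by (auto simp: R_def open_Times)
  have sub': "{a..b} \<times> {c..d'} \<subseteq> S" using sub d' by auto
  \<comment> \<open>\<open>v\<close> has the initial value \<open>g\<close> at \<open>t = a\<close>
    and the time derivative \<open>B\<close>; \<open>k\<close> is built to be its
    \<open>y\<close>-derivative.\<close>
  define v where "v = (\<lambda>(t, y). integral {a..t} (\<lambda>s. B (s, y)) + g y)"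
  define k where "k = (\<lambda>(t, y). integral {a..t} (\<lambda>s. d_x B (s, y)) + g' y)"
  have lift: "((\<lambda>(t, y). q y) has_derivative (\<lambda>(dt, dy). dy * r)) (at (t, y))"
    if "(q has_real_derivative r) (at y)" for q r and t y :: real
    using that diff_chain_at[OF has_derivative_snd[OF has_derivative_ident], of q "\<lambda>dy. dy * r" "(t, y)"]
    by (simp add: o_def case_prod_unfold has_field_derivative_def mult_commute_abs)
  have Dv: "(v has_derivative (\<lambda>(dt, dy). dt * B p + dy * k p)) (at p)" if pR: "p \<in> R" for p
  proof -
    obtain t y where p: "p = (t, y)" "t \<in> {a<..<b}" "y \<in> {c<..<d'}" using pR unfolding R_def by blast
    show ?thesis
      using has_derivative_add[OF smooth_on_integral_has_derivative[OF B sub' p(2,3)] lift[OF g[OF p(3)]]]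
      by (simp add: p(1) v_def k_def case_prod_unfold algebra_simps)
  qed
  have Dk: "(k has_derivative (\<lambda>(dt, dy). dt * d_x B p + dy * (w (snd p) * v p - \<phi> p))) (at p)" if pR: "p \<in> R" for p
  proof -
    obtain t y where p: "p = (t, y)" "t \<in> {a<..<b}" "y \<in> {c<..<d'}" using pR unfolding R_def by blast
    have "((\<lambda>s. d_t \<phi> (s, y)) has_integral (\<phi> (t, y) - \<phi> (a, y))) {a..t}"
    proof (rule fundamental_theorem_of_calculus)
      fix s assume "s \<in> {a..t}"
      then have "(s, y) \<in> S" using p sub' by auto
      from has_field_derivative_at_within[OF smooth_on_section_derivatives(1)[OF \<phi> this]]
      show "((\<lambda>s. \<phi> (s, y)) has_vector_derivative d_t \<phi> (s, y)) (at s within {a..t})"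
        by (simp add: has_real_derivative_iff_has_vector_derivative)
    qed (use p in auto)
    moreover have "((\<lambda>s. w y * B (s, y)) has_integral (w y * integral {a..t} (\<lambda>s. B (s, y)))) {a..t}"
      using p sub' by (intro has_integral_mult_right integrable_integral integrable_continuous_interval
        continuous_on_sections(1)[OF smooth_on_imp_continuous_on[OF B]]) auto
    ultimately have "((\<lambda>s. w y * B (s, y) - d_t \<phi> (s, y)) has_integral
        (w y * integral {a..t} (\<lambda>s. B (s, y)) - (\<phi> (t, y) - \<phi> (a, y)))) {a..t}"
      using has_integral_diff by blast
    then have "((\<lambda>s. d_x (d_x B) (s, y)) has_integral
        (w y * integral {a..t} (\<lambda>s. B (s, y)) - (\<phi> (t, y) - \<phi> (a, y)))) {a..t}"
      by (rule has_integral_eq[rotated]) (use p sub' eq in \<open>auto simp: subset_iff\<close>)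
    \<comment> \<open>The boundary term \<open>\<phi> (a, y)\<close> left by the time integral
      cancels against the inhomogeneity chosen in the ODE for \<open>g\<close>.\<close>
    then have "integral {a..t} (\<lambda>s. d_x (d_x B) (s, y)) + (w y * g y + - \<phi> (a, y)) = w (snd p) * v p - \<phi> p"
      by (simp add: p(1) v_def integral_unique algebra_simps)
    moreover have "(k has_derivative (\<lambda>(dt, dy). dt * d_x B p +
        dy * (integral {a..t} (\<lambda>s. d_x (d_x B) (s, y)) + (w y * g y + - \<phi> (a, y))))) (at p)"
      using has_derivative_add[OF smooth_on_integral_has_derivative[OF smooth_on_d_x[OF B] sub' p(2,3)] lift[OF g'[OF p(3)]]]
      by (simp add: p(1) k_def case_prod_unfold algebra_simps)
    ultimately show ?thesis by (simp only:)
  qed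
  \<comment> \<open>Bootstrapping: the partial derivatives of \<open>v\<close> and \<open>k\<close>
    are expressed by \<open>v\<close>, \<open>k\<close> and smooth functions, so each round gains
    one order.\<close>
  have "C_k_on n R v \<and> C_k_on n R k" for n
  proof (induction n)
    case 0
    show ?case
      using has_derivative_continuous[OF Dv] has_derivative_continuous[OF Dk]
      by (simp add: continuous_at_imp_continuous_on)
  next
    case (Suc n)
    have *: "C_k_on n R B" "C_k_on n R (d_x B)" "C_k_on n R \<phi>" "C_k_on n R (\<lambda>p. w (snd p))"
      using smooth_on_subset[OF B R(2)] smooth_on_subset[OF smooth_on_d_x[OF B] R(2)]
        smooth_on_subset[OF \<phi> R(2)] smooth_on_subset[OF w R(2)] by (auto simp: smooth_on_def)
    have "C_k_on n R (\<lambda>p. w (snd p) * v p + (-1) * \<phi> p)"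
      using * Suc R(1) by (intro C_k_on_add C_k_on_mult C_k_on_const) auto
    then have "C_k_on n R (\<lambda>p. w (snd p) * v p - \<phi> p)" by simp
    then show ?case
      using C_k_on_partialsI[OF R(1) Dv *(1)] C_k_on_partialsI[OF R(1) Dk *(2)] Suc by blast
  qed
  then have "smooth_on R v" "smooth_on R k" by (auto simp: smooth_on_def)
  then show ?thesis by (rule that[OF d', folded R_def, OF _ _ Dv Dk])
qed

section \<open>Local solvability of the determining equation\<close>

text \<open>The coefficients of \<open>vP_t\<close>, \<open>vD\<close>, \<open>vK\<close>,
  \<open>vG_x\<close>, \<open>vP_x\<close>, \<open>vI\<close>, in this order.\<close>

type_synonym coeffs = "real \<times> real \<times> real \<times> real \<times> real \<times> real"

fun tau :: "coeffs \<Rightarrow> real \<Rightarrow> real" where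
  "tau (a1, a2, a3, a4, a5, a6) t = a1 + 2 * a2 * t + a3 * t\<^sup>2"

fun half_dtau :: "coeffs \<Rightarrow> real \<Rightarrow> real" where
  "half_dtau (a1, a2, a3, a4, a5, a6) t = a2 + a3 * t"

fun zeta :: "coeffs \<Rightarrow> real \<Rightarrow> real" where
  "zeta (a1, a2, a3, a4, a5, a6) t = a4 * t + a5"

definition xi :: "coeffs \<Rightarrow> real \<Rightarrow> real \<Rightarrow> real" where
  "xi a t x = half_dtau a t * x + zeta a t"

fun eta :: "coeffs \<Rightarrow> real \<Rightarrow> real \<Rightarrow> real" where
  "eta (a1, a2, a3, a4, a5, a6) t x = a6 - a2 / 2 - a3 * (x\<^sup>2 + 2 * t) / 4 - a4 * x / 2"

text \<open>\<open>coeff3\<close> and \<open>coeff4\<close> are the slopes of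
  \<open>half_dtau\<close> and \<open>zeta\<close>; with them the derivative rules below are stated
  without taking the tuple apart.\<close>

fun coeff3 :: "coeffs \<Rightarrow> real" where
  "coeff3 (a1, a2, a3, a4, a5, a6) = a3"

fun coeff4 :: "coeffs \<Rightarrow> real" where
  "coeff4 (a1, a2, a3, a4, a5, a6) = a4"

lemma DERIV_tau [derivative_intros]:
  "(X has_real_derivative X') (at s within S) \<Longrightarrow>
    ((\<lambda>s. tau a (X s)) has_real_derivative 2 * half_dtau a (X s) * X') (at s within S)"
  and DERIV_half_dtau [derivative_intros]:
  "(X has_real_derivative X') (at s within S) \<Longrightarrow>
    ((\<lambda>s. half_dtau a (X s)) has_real_derivative coeff3 a * X') (at s within S)"
  and DERIV_zeta [derivative_intros]:
  "(X has_real_derivative X') (at s within S) \<Longrightarrow>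
    ((\<lambda>s. zeta a (X s)) has_real_derivative coeff4 a * X') (at s within S)"
  by (cases a; auto intro!: derivative_eq_intros simp: algebra_simps)+

lemma DERIV_xi [derivative_intros]:
  "(X has_real_derivative X') (at s within S) \<Longrightarrow> (Y has_real_derivative Y') (at s within S) \<Longrightarrow>
    ((\<lambda>s. xi a (X s) (Y s)) has_real_derivative
      (coeff3 a * Y s + coeff4 a) * X' + half_dtau a (X s) * Y') (at s within S)"
  unfolding xi_def by (auto intro!: derivative_eq_intros simp: algebra_simps)

lemma DERIV_eta [derivative_intros]:
  "(X has_real_derivative X') (at s within S) \<Longrightarrow> (Y has_real_derivative Y') (at s within S) \<Longrightarrow>
    ((\<lambda>s. eta a (X s) (Y s)) has_real_derivative
      - coeff3 a / 2 * X' - (coeff3 a * Y s + coeff4 a) / 2 * Y') (at s within S)"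
  by (cases a) (auto intro!: derivative_eq_intros simp: field_simps)

section \<open>Tools for verifying the heat equation\<close>

lemma smooth_on_curve_derivative:
  assumes "smooth_on S f" "(X s, Y s) \<in> S"
    "(X has_real_derivative X') (at s)" "(Y has_real_derivative Y') (at s)"
    "X' * d_t f (X s, Y s) + Y' * d_x f (X s, Y s) = D"
  shows "((\<lambda>s. f (X s, Y s)) has_real_derivative D) (at s)"
proof -
  have "((\<lambda>s. (X s, Y s)) has_derivative (\<lambda>h. (X' * h, Y' * h))) (at s)"
    using assms(3,4) by (auto simp: has_field_derivative_def intro: has_derivative_Pair)
  from diff_chain_at[OF this smooth_on_has_derivative_partials[OF assms(1,2)]]
  have "((\<lambda>s. f (X s, Y s)) has_derivative (\<lambda>h. D * h)) (at s)"
    by (simp add: o_def case_prod_unfold algebra_simps flip: assms(5))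
  then show ?thesis by (simp add: has_field_derivative_def)
qed

lemma d_t_eqI:
  assumes "smooth_on S f" "(t, x) \<in> S" "((\<lambda>t. f (t, x)) has_real_derivative D) (at t)"
  shows "d_t f (t, x) = D"
  using DERIV_unique[OF smooth_on_section_derivatives(1)[OF assms(1,2)] assms(3)] .

lemma d_x_eqI:
  assumes "smooth_on S f" "(t, x) \<in> S" "((\<lambda>x. f (t, x)) has_real_derivative D) (at x)"
  shows "d_x f (t, x) = D"
  using DERIV_unique[OF smooth_on_section_derivatives(2)[OF assms(1,2)] assms(3)] .

lemma open_contains_rectangle:
  fixes a c :: real
  assumes "open S" "(a, c) \<in> S"
  obtains e where "e > 0" "{a - e..a + e} \<times> {c - e..c + e} \<subseteq> S"
proof -
  from open_prod_elim[OF assms] obtain A C where AC: "open A" "open C" "(a, c) \<in> A \<times> C" "A \<times> C \<subseteq> S" .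
  then obtain e e' where e: "e > 0" "cball a e \<subseteq> A" "e' > 0" "cball c e' \<subseteq> C"
    by (meson SigmaD1 SigmaD2 open_contains_cball)
  have "{a - min e e'..a + min e e'} \<subseteq> {a - e..a + e}" "{c - min e e'..c + min e e'} \<subseteq> {c - e'..c + e'}"
    by auto
  then have "{a - min e e'..a + min e e'} \<subseteq> A" "{c - min e e'..c + min e e'} \<subseteq> C"
    using e(2,4) unfolding cball_eq_atLeastAtMost by blast+
  with AC(4) have "{a - min e e'..a + min e e'} \<times> {c - min e e'..c + min e e'} \<subseteq> S" by blast
  then show ?thesis using that[of "min e e'"] e by simp
qed

text \<open>For second derivatives: an explicit formula for \<open>d_x h\<close> that holds on the
  open set \<open>S\<close> may be differentiated in place of \<open>d_x h\<close>.\<close>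

lemma d_x_section_transform:
  fixes S :: "(real \<times> real) set" and f g :: "real \<times> real \<Rightarrow> real"
  assumes "open S" "\<And>p. p \<in> S \<Longrightarrow> f p = g p" "(t, x) \<in> S"
    "((\<lambda>x. f (t, x)) has_real_derivative D) (at x)"
  shows "((\<lambda>x. g (t, x)) has_real_derivative D) (at x)"
proof -
  obtain e where "e > 0" "{t - e..t + e} \<times> {x - e..x + e} \<subseteq> S"
    using open_contains_rectangle[OF assms(1,3)] .
  then have "f (t, z) = g (t, z)" if "z \<in> {x - e<..<x + e}" for z
    using that by (intro assms(2)) (auto simp: subset_iff)
  then show ?thesis
    using \<open>e > 0\<close> by (intro has_field_derivative_transform_within_open[OF assms(4), of "{x - e<..<x + e}"]) auto
qed

lemma heat_solutionI:
  assumes "open S" "smooth_on S h"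
    and t: "\<And>t x. (t, x) \<in> S \<Longrightarrow> ((\<lambda>t. h (t, x)) has_real_derivative A (t, x)) (at t)"
    and x: "\<And>t x. (t, x) \<in> S \<Longrightarrow> ((\<lambda>x. h (t, x)) has_real_derivative m (t, x)) (at x)"
    and xx: "\<And>t x. (t, x) \<in> S \<Longrightarrow> ((\<lambda>x. m (t, x)) has_real_derivative A (t, x)) (at x)"
  shows "heat_solution S h"
  unfolding heat_solution_def
proof (intro conjI ballI)
  fix p assume "p \<in> S"
  then obtain t x where p: "p = (t, x)" "(t, x) \<in> S" by (cases p) auto
  have m: "m q = d_x h q" if "q \<in> S" for q
    using d_x_eqI[OF assms(2) _ x] that by (cases q) auto
  from d_x_eqI[OF smooth_on_d_x[OF assms(2)] p(2) d_x_section_transform[OF assms(1) m p(2) xx[OF p(2)]]]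
    d_t_eqI[OF assms(2) p(2) t[OF p(2)]] show "d_t h p = d_x (d_x h) p" by (simp add: p)
qed (use assms in auto)

lemma heat_solution_d_x_d_x:
  assumes "heat_solution S f" "(t, x) \<in> S"
  shows "d_x (d_x f) (t, x) = d_t f (t, x)"
  using assms by (auto simp: heat_solution_def)

lemma smooth_on_fst_lift:
  assumes "open J" "\<And>t. t \<in> J \<Longrightarrow> (q has_real_derivative q' t) (at t)"
    "smooth_on (J \<times> UNIV) (\<lambda>p::real \<times> real. q' (fst p))"
  shows "smooth_on (J \<times> UNIV) (\<lambda>p::real \<times> real. q (fst p))"
proof (rule smooth_on_partialsI[where A = "\<lambda>p. q' (fst p)" and B = "\<lambda>p. 0"])
  fix p :: "real \<times> real" assume "p \<in> J \<times> UNIV"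
  then have "(q has_derivative (\<lambda>h. h * q' (fst p))) (at (fst p))"
    using assms(2)[of "fst p"] by (auto simp: has_field_derivative_def mult_commute_abs)
  from diff_chain_at[OF has_derivative_fst[OF has_derivative_ident] this]
  show "((\<lambda>p. q (fst p)) has_derivative (\<lambda>(dt, dx). dt * q' (fst p) + dx * 0)) (at p)"
    by (simp add: o_def case_prod_unfold)
qed (use assms(1,3) in \<open>auto intro: open_Times smooth_on_const\<close>)

lemma antiderivative_open_interval:
  fixes q :: "real \<Rightarrow> real"
  assumes "continuous_on {a..b} q"
  obtains Q where "\<And>t. t \<in> {a<..<b} \<Longrightarrow> (Q has_real_derivative q t) (at t)"
proof (rule that)
  fix t assume t: "t \<in> {a<..<b}"
  then have "((\<lambda>t. integral {a..t} q) has_real_derivative q t) (at t within {a..b})"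
    by (intro integral_has_real_derivative assms) auto
  then show "((\<lambda>t. integral {a..t} q) has_real_derivative q t) (at t)"
    using t at_within_interior[of t "{a..b}"] by (simp add: interior_atLeastAtMost_real)
qed

lemma smooth_on_coefficients:
  assumes "open S"
  shows "smooth_on S (\<lambda>p::real \<times> real. tau a (fst p))" "smooth_on S (\<lambda>p::real \<times> real. half_dtau a (fst p))"
    "smooth_on S (\<lambda>p::real \<times> real. zeta a (fst p))" "smooth_on S (\<lambda>p. xi a (fst p) (snd p))"
    "smooth_on S (\<lambda>p. eta a (fst p) (snd p))"
  using assms by (cases a; auto simp: xi_def intro!: smooth_on_intros)+

section \<open>The determining equation where \<open>tau\<close> is positive\<close>

text \<open>In the proof, \<open>y = x / r + \<kappa>(t)\<close> with \<open>r = \<surd>\<tau>\<close> is an invariant of \<open>\<tau> \<partial>\<^sub>t + \<xi> \<partial>\<^sub>x\<close>; the gauge \<open>\<theta>\<close> is chosen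
  so that \<open>exp \<theta>\<close> solves the homogeneous first order equation and \<open>v\<^sub>y\<close> drops out of the heat equation.\<close>

lemma tau_pos_rectangle_solution:
  assumes f: "heat_solution \<Omega> f" and sub: "{t0 - e..t0 + e} \<times> {x0 - e..x0 + e} \<subseteq> \<Omega>" and "e > 0"
    and \<tau>: "\<And>t. t \<in> {t0 - e..t0 + e} \<Longrightarrow> tau a t > 0"
  obtains U h where "open U" "U \<noteq> {}" "U \<subseteq> \<Omega>" "heat_solution U h"
    "\<And>t x. (t, x) \<in> U \<Longrightarrow>
      tau a t * d_t h (t, x) + xi a t x * d_x h (t, x) - eta a t x * h (t, x) = - f (t, x)"
proof -
  define I where "I = {t0 - e<..<t0 + e}"
  define N where "N = I \<times> {x0 - e<..<x0 + e}"
  have N: "open N" "N \<subseteq> \<Omega>" "N \<subseteq> I \<times> UNIV"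
    using sub by (auto simp: N_def I_def intro!: open_Times)
  have IU: "open (I \<times> (UNIV :: real set))" by (auto simp: I_def intro!: open_Times)
  have \<tau>I: "tau a t > 0" if "t \<in> I" for t using \<tau> that by (auto simp: I_def)
  note sm = smooth_on_coefficients[of _ a]
  \<comment> \<open>For \<open>h = exp \<theta> * v(t, y)\<close> the terms with \<open>v_y\<close>
    cancel in the heat equation iff \<theta>_x = - \<xi> / (2 \<tau>); the homogeneous equation
    \<tau> \<theta>_t + \<xi> \<theta>_x = \<eta> then determines \<theta>_t.\<close>
  define \<theta>\<^sub>t where "\<theta>\<^sub>t = (\<lambda>p. (2 * tau a (fst p) * eta a (fst p) (snd p) + (xi a (fst p) (snd p))\<^sup>2) / (2 * (tau a (fst p))\<^sup>2))"
  define \<theta>\<^sub>x where "\<theta>\<^sub>x = (\<lambda>p. - xi a (fst p) (snd p) / (2 * tau a (fst p)))"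
  obtain \<theta> where \<theta>: "smooth_on N \<theta>" "\<And>p. p \<in> N \<Longrightarrow> d_t \<theta> p = \<theta>\<^sub>t p" "\<And>p. p \<in> N \<Longrightarrow> d_x \<theta> p = \<theta>\<^sub>x p"
  proof -
    define T where "T = {p :: real \<times> real. tau a (fst p) > 0}"
    have T: "open T"
      unfolding T_def
      by (intro open_Collect_less continuous_intros smooth_on_imp_continuous_on sm(1) open_UNIV)
    have A: "smooth_on T \<theta>\<^sub>t" and B: "smooth_on T \<theta>\<^sub>x"
      unfolding \<theta>\<^sub>t_def \<theta>\<^sub>x_def using T sm[OF T]
      by (auto intro!: smooth_on_divide smooth_on_add smooth_on_mult smooth_on_minus smooth_on_power smooth_on_const
          simp: T_def)
    have closed: "d_x \<theta>\<^sub>t p = d_t \<theta>\<^sub>x p" if "p \<in> T" for p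
    proof -
      obtain t x where p: "p = (t, x)" by (cases p)
      have pos: "tau a t > 0" using that by (simp add: p T_def)
      have dA: "d_x \<theta>\<^sub>t p = (2 * tau a t * (- (coeff3 a * x + coeff4 a) / 2) + 2 * xi a t x * half_dtau a t) / (2 * (tau a t)\<^sup>2)"
        using that pos unfolding p
        by (intro d_x_eqI[OF A], simp,
            auto simp: \<theta>\<^sub>t_def intro!: derivative_eq_intros,
            simp add: field_simps eval_nat_numeral)
      have dB: "d_t \<theta>\<^sub>x p = (xi a t x * (2 * half_dtau a t) - (coeff3 a * x + coeff4 a) * tau a t) / (2 * (tau a t)\<^sup>2)"
        using that pos unfolding p
        by (intro d_t_eqI[OF B], simp,
            auto simp: \<theta>\<^sub>x_def intro!: derivative_eq_intros,
            simp add: field_simps power2_eq_square)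
      show ?thesis unfolding dA dB using pos by (simp add: field_simps)
    qed
    have "{t0 - e..t0 + e} \<times> {x0 - e..x0 + e} \<subseteq> T" using \<tau> by (auto simp: T_def)
    from closed_form_potential[OF A B this closed] obtain \<theta> where
      \<theta>: "\<And>p. p \<in> N \<Longrightarrow> (\<theta> has_derivative (\<lambda>(dt, dx). dt * \<theta>\<^sub>t p + dx * \<theta>\<^sub>x p)) (at p)"
      unfolding N_def I_def by blast
    have "N \<subseteq> T" using N(3) \<tau>I by (auto simp: T_def)
    have "smooth_on N \<theta>"
      by (rule smooth_on_partialsI[OF N(1) \<theta> smooth_on_subset[OF A \<open>N \<subseteq> T\<close>] smooth_on_subset[OF B \<open>N \<subseteq> T\<close>]])
    then show ?thesis using d_t_d_x_eq[OF \<theta>] by (rule that)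
  qed
  have sf: "smooth_on N f" using f N(2) smooth_on_subset by (auto simp: heat_solution_def)
  define r where "r = (\<lambda>t. sqrt (tau a t))"
  have r: "r t > 0" "r t * r t = tau a t" "(r t)\<^sup>2 = tau a t" if "t \<in> I" for t
    using \<tau>I[OF that] by (auto simp: r_def)
  have Dr: "(r has_real_derivative half_dtau a t / r t) (at t)" if "t \<in> I" for t
    unfolding r_def using \<tau>I[OF that] by (auto intro!: derivative_eq_intros simp: field_simps)
  have sr: "smooth_on (I \<times> UNIV) (\<lambda>p::real \<times> real. r (fst p))"
    unfolding r_def using \<tau>I by (intro smooth_on_sqrt IU sm) auto
  \<comment> \<open>This slope makes \<open>y = x / r t + \<kappa> t\<close> constant along the
    field: the part of \<xi> that is linear in \<open>x\<close> is absorbed by \<open>r\<close>, the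
    part \<open>zeta\<close> by \<open>\<kappa>\<close>.\<close>
  obtain \<kappa> where D\<kappa>: "\<And>t. t \<in> I \<Longrightarrow> (\<kappa> has_real_derivative - zeta a t / (tau a t * r t)) (at t)"
  proof -
    have "continuous_on {t0 - e..t0 + e} (tau a)" "continuous_on {t0 - e..t0 + e} (zeta a)"
      by (auto intro!: DERIV_continuous_on derivative_eq_intros)
    then have "continuous_on {t0 - e..t0 + e} (\<lambda>t. - zeta a t / (tau a t * r t))"
      unfolding r_def using \<tau> by (intro continuous_intros) (auto simp: less_imp_neq[symmetric])
    from antiderivative_open_interval[OF this] that show ?thesis unfolding I_def by blast
  qed
  have s\<kappa>: "smooth_on (I \<times> UNIV) (\<lambda>p::real \<times> real. \<kappa> (fst p))"
  proof (rule smooth_on_fst_lift[OF _ D\<kappa>])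
    show "smooth_on (I \<times> UNIV) (\<lambda>p::real \<times> real. - zeta a (fst p) / (tau a (fst p) * r (fst p)))"
      using \<tau>I r(1) by (intro smooth_on_divide smooth_on_minus smooth_on_mult sm IU sr) (auto simp: less_imp_neq[symmetric])
  qed (auto simp: I_def)
  define X where "X = (\<lambda>t y. r t * (y - \<kappa> t))"
  define Y where "Y = (\<lambda>t x. x / r t + \<kappa> t)"
  have XY: "X t (Y t x) = x" "Y t (X t y) = y" if "t \<in> I" for t x y
    using r(1)[OF that] by (auto simp: X_def Y_def)
  have DX: "((\<lambda>t. X t y) has_real_derivative xi a t (X t y) / tau a t) (at t)" if "t \<in> I" for t y
    unfolding X_def xi_def using r(1)[OF that] \<tau>I[OF that]
    by (auto intro!: derivative_eq_intros Dr[OF that] D\<kappa>[OF that] simp: field_simps r(2)[OF that, symmetric])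
  have DX': "(X t has_real_derivative r t) (at y)" for t y
    unfolding X_def by (auto intro!: derivative_eq_intros)
  have DY: "((\<lambda>t. Y t x) has_real_derivative - xi a t x / (tau a t * r t)) (at t)" if "t \<in> I" for t x
    unfolding Y_def xi_def using r(1)[OF that] \<tau>I[OF that]
    by (auto intro!: derivative_eq_intros Dr[OF that] D\<kappa>[OF that] simp: field_simps r(2)[OF that, symmetric])
  have DY': "(Y t has_real_derivative 1 / r t) (at x)" if "t \<in> I" for t x
    unfolding Y_def using r(1)[OF that] by (auto intro!: derivative_eq_intros)
  \<comment> \<open>The potential that the gauge leaves in the heat equation, \<tau> (\<theta>_t -
    \<theta>_xx - \<theta>_x^2). Its derivative along the curves of constant \<open>y\<close>
    vanishes, so it is a function \<open>w\<close> of \<open>y\<close> alone, which can be read off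
    at the time \<open>t0\<close>.\<close>
  define W where "W = (\<lambda>t x. eta a t x + half_dtau a t / 2 + (xi a t x)\<^sup>2 / (4 * tau a t))"
  define w where "w = (\<lambda>y. W t0 (X t0 y))"
  have t0: "t0 \<in> I" using \<open>e > 0\<close> by (simp add: I_def)
  have W: "W t (X t y) = w y" if "t \<in> I" for t y
  proof -
    have "((\<lambda>s. W s (X s y)) has_real_derivative 0) (at s)" if "s \<in> I" for s
      unfolding W_def using \<tau>I[OF that]
      by (auto intro!: derivative_eq_intros DX[OF that]) (simp add: field_simps power2_eq_square)
    then have "((\<lambda>s. W s (X s y)) has_real_derivative 0) (at s within I)" if "s \<in> I" for s
      by (rule has_field_derivative_at_within) (rule that)
    moreover have "convex I" by (simp add: I_def)
    ultimately obtain c where "\<And>s. s \<in> I \<Longrightarrow> W s (X s y) = c"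
      using has_field_derivative_zero_constant[of I "\<lambda>s. W s (X s y)"] by blast
    with that t0 show ?thesis by (simp add: w_def)
  qed
  \<comment> \<open>Mutually inverse changes of variables: \<open>\<Psi>\<close> leads from
    \<open>(t, y)\<close> to \<open>(t, x)\<close>, and \<open>\<Lambda>\<close> back.\<close>
  define \<Psi> where "\<Psi> = (\<lambda>q. (fst q, X (fst q) (snd q)))"
  define \<Lambda> where "\<Lambda> = (\<lambda>p. (fst p, Y (fst p) (snd p)))"
  have s\<Psi>: "smooth_on (I \<times> UNIV) \<Psi>" and s\<Lambda>: "smooth_on (I \<times> UNIV) \<Lambda>"
    unfolding \<Psi>_def \<Lambda>_def X_def Y_def using r(1)
    by (auto intro!: smooth_on_intros IU sr s\<kappa> simp: less_imp_neq[symmetric])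
  define S where "S = (I \<times> UNIV) \<inter> \<Psi> -` N"
  have S: "open S" "\<Psi> ` S \<subseteq> N" "S \<subseteq> I \<times> UNIV"
    using continuous_open_preimage[OF smooth_on_imp_continuous_on[OF s\<Psi>] IU N(1)] by (auto simp: S_def)
  have memS: "t \<in> I" "(t, X t y) \<in> N" if "(t, y) \<in> S" for t y
    using that by (auto simp: S_def \<Psi>_def)
  define F where "F = (\<lambda>p. f p * exp (- \<theta> p))"
  define G where "G = (\<lambda>p. (d_x f p - \<theta>\<^sub>x p * f p) * exp (- \<theta> p))"
  define \<phi> where "\<phi> = (\<lambda>q. F (\<Psi> q))"
  \<comment> \<open>In the new variables the first order equation reads \<tau> v_t = - \<phi>, so
    \<open>B\<close> is the prescribed time derivative of \<open>v\<close>.\<close>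
  define B where "B = (\<lambda>q. - \<phi> q / tau a (fst q))"
  have s\<theta>x: "smooth_on N \<theta>\<^sub>x"
    using smooth_on_cong[OF N(1) \<theta>(3) smooth_on_d_x[OF \<theta>(1)]] .
  have sF: "smooth_on N F"
    unfolding F_def by (intro smooth_on_mult smooth_on_real_exp smooth_on_minus N sf \<theta>)
  have s\<phi>: "smooth_on S \<phi>"
    unfolding \<phi>_def using smooth_on_subset[OF s\<Psi> S(3)] by (intro smooth_on_compose[OF S(1) N(1) S(2) _ sF])
  have sB: "smooth_on S B"
    unfolding B_def using S memS \<tau>I
    by (intro smooth_on_divide smooth_on_minus s\<phi> sm) (auto simp: less_imp_neq[symmetric])
  have sw: "smooth_on S (\<lambda>p. w (snd p))"
    unfolding w_def W_def X_def xi_def using \<tau>I[OF t0]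
    by (cases a) (auto intro!: smooth_on_intros S(1))
  have cf: "((\<lambda>s. f (P s, Q s)) has_real_derivative P' * d_t f (P s, Q s) + Q' * d_x f (P s, Q s)) (at s)"
    if "(P s, Q s) \<in> N" "(P has_real_derivative P') (at s)" "(Q has_real_derivative Q') (at s)" for P Q P' Q' s
    by (rule smooth_on_curve_derivative[OF sf that]) simp
  have c\<theta>: "((\<lambda>s. \<theta> (P s, Q s)) has_real_derivative P' * \<theta>\<^sub>t (P s, Q s) + Q' * \<theta>\<^sub>x (P s, Q s)) (at s)"
    if "(P s, Q s) \<in> N" "(P has_real_derivative P') (at s)" "(Q has_real_derivative Q') (at s)" for P Q P' Q' s
    by (rule smooth_on_curve_derivative[OF \<theta>(1) that]) (simp add: \<theta> that)
  have cfx: "((\<lambda>x. d_x f (t, x)) has_real_derivative d_t f (t, x)) (at x)" if "(t, x) \<in> N" for t x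
    using smooth_on_section_derivatives(2)[OF smooth_on_d_x[OF sf] that] heat_solution_d_x_d_x[OF f, of t x] that N(2)
    by auto
  have D\<theta>x: "((\<lambda>x. \<theta>\<^sub>x (t, x)) has_real_derivative - half_dtau a t / (2 * tau a t)) (at x)" if "t \<in> I" for t x
    unfolding \<theta>\<^sub>x_def using \<tau>I[OF that] by (auto intro!: derivative_eq_intros simp: field_simps)
  have DF: "((\<lambda>x. F (t, x)) has_real_derivative G (t, x)) (at x)" if "(t, x) \<in> N" for t x
    unfolding F_def G_def using that
    by (auto intro!: derivative_eq_intros cf c\<theta> simp: algebra_simps)
  have DG: "((\<lambda>x. G (t, x)) has_real_derivative
      (d_t f (t, x) + half_dtau a t / (2 * tau a t) * f (t, x) + (xi a t x / tau a t) * d_x f (t, x)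
        + (\<theta>\<^sub>x (t, x))\<^sup>2 * f (t, x)) * exp (- \<theta> (t, x))) (at x)" if "(t, x) \<in> N" for t x
  proof -
    have "t \<in> I" using that N(3) by auto
    with that \<tau>I[OF this] show ?thesis
      unfolding G_def
      by (auto intro!: derivative_eq_intros cf c\<theta> cfx D\<theta>x simp: \<theta>\<^sub>x_def field_simps power2_eq_square)
  qed
  have eq: "d_x (d_x B) (t, y) = w y * B (t, y) - d_t \<phi> (t, y)" if ty: "(t, y) \<in> S" for t y
  proof -
    note t = memS[OF ty]
    define p where "p = (t, X t y)"
    have d\<phi>: "d_t \<phi> (t, y) = (d_t f p - \<theta>\<^sub>t p * f p + xi a t (X t y) / tau a t * (d_x f p - \<theta>\<^sub>x p * f p)) * exp (- \<theta> p)"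
      unfolding p_def using t
      by (intro d_t_eqI[OF s\<phi> ty])
        (auto simp: \<phi>_def F_def \<Psi>_def algebra_simps intro!: derivative_eq_intros cf c\<theta> DX)
    have dB: "- G (\<Psi> q) / r (fst q) = d_x B q" if "q \<in> S" for q
    proof -
      obtain s z where q: "q = (s, z)" by (cases q)
      note s = memS[OF that[unfolded q]]
      have "((\<lambda>z. F (s, X s z)) has_real_derivative G (s, X s z) * r s) (at z)"
        using DERIV_chain2[OF DF[OF s(2)] DX'] .
      then have "((\<lambda>z. B (s, z)) has_real_derivative - G (s, X s z) * r s / tau a s) (at z)"
        unfolding B_def \<phi>_def \<Psi>_def using \<tau>I[OF s(1)] by (auto intro!: derivative_eq_intros)
      also have "- G (s, X s z) * r s / tau a s = - G (\<Psi> q) / r (fst q)"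
        using r(1)[OF s(1)] by (simp add: q \<Psi>_def field_simps flip: r(2)[OF s(1)])
      finally show ?thesis using d_x_eqI[OF sB that[unfolded q]] q by simp
    qed
    have ddB: "d_x (d_x B) (t, y) = - ((d_t f p + half_dtau a t / (2 * tau a t) * f p + (xi a t (X t y) / tau a t) * d_x f p
        + (\<theta>\<^sub>x p)\<^sup>2 * f p) * exp (- \<theta> p))"
    proof (rule d_x_eqI[OF smooth_on_d_x[OF sB] ty], rule d_x_section_transform[OF S(1) dB ty])
      show "((\<lambda>y. - G (\<Psi> (t, y)) / r (fst (t, y))) has_real_derivative
        - ((d_t f p + half_dtau a t / (2 * tau a t) * f p + (xi a t (X t y) / tau a t) * d_x f p
        + (\<theta>\<^sub>x p)\<^sup>2 * f p) * exp (- \<theta> p))) (at y)"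
        using r(1)[OF t(1)] DERIV_cdivide[OF DERIV_minus[OF DERIV_chain2[OF DG[OF t(2)] DX']], of "r t"]
        by (simp add: \<Psi>_def p_def)
    qed
    have wy: "w y = W t (X t y)" using W[OF t(1)] by simp
    have B: "B (t, y) = - (f p * exp (- \<theta> p)) / tau a t"
      by (simp add: B_def \<phi>_def \<Psi>_def F_def p_def)
    define E where "E = exp (- \<theta> p)"
    show ?thesis
      unfolding ddB d\<phi> B wy W_def E_def[symmetric] using \<tau>I[OF t(1)]
      by (simp add: \<theta>\<^sub>t_def \<theta>\<^sub>x_def p_def) (simp add: field_simps power2_eq_square)
  qed
  have "(t0, Y t0 x0) \<in> S"
    using t0 \<open>e > 0\<close> by (simp add: S_def \<Psi>_def XY N_def)
  then obtain e' where e': "e' > 0" "{t0 - e'..t0 + e'} \<times> {Y t0 x0 - e'..Y t0 x0 + e'} \<subseteq> S"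
    by (rule open_contains_rectangle[OF S(1)])
  define J where "J = {t0 - e'<..<t0 + e'}"
  obtain d' v k where d': "Y t0 x0 - e' < d'" "d' \<le> Y t0 x0 + e'"
    and sv: "smooth_on (J \<times> {Y t0 x0 - e'<..<d'}) v" and sk: "smooth_on (J \<times> {Y t0 x0 - e'<..<d'}) k"
    and Dv: "\<And>p. p \<in> J \<times> {Y t0 x0 - e'<..<d'} \<Longrightarrow> (v has_derivative (\<lambda>(dt, dy). dt * B p + dy * k p)) (at p)"
    and Dk: "\<And>p. p \<in> J \<times> {Y t0 x0 - e'<..<d'} \<Longrightarrow>
      (k has_derivative (\<lambda>(dt, dy). dt * d_x B p + dy * (w (snd p) * v p - \<phi> p))) (at p)"
    unfolding J_def
    by (rule stationary_gauge_solution[OF _ _ e'(2) s\<phi> sB sw eq]) (use e'(1) in auto)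
  define R where "R = J \<times> {Y t0 x0 - e'<..<d'}"
  have R: "open R" "R \<subseteq> S"
    using e' d' by (auto simp: R_def J_def subset_iff intro!: open_Times)
  define U where "U = ((I \<times> UNIV) \<inter> \<Lambda> -` R) \<inter> N"
  have U: "open U" "U \<subseteq> N" "\<Lambda> ` U \<subseteq> R" "U \<subseteq> I \<times> UNIV"
    using continuous_open_preimage[OF smooth_on_imp_continuous_on[OF s\<Lambda>] IU R(1)] N(1)
    by (auto simp: U_def)
  \<comment> \<open>The ODE is solved only to the right of \<open>Y t0 x0 - e'\<close>, on an
    interval that may miss \<open>Y t0 x0\<close>. Its midpoint therefore witnesses that
    \<open>U\<close> is nonempty.\<close>
  have "(t0, (Y t0 x0 - e' + d') / 2) \<in> R"
    using e' d' by (auto simp: R_def J_def)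
  moreover from this have "\<Psi> (t0, (Y t0 x0 - e' + d') / 2) \<in> N" using R(2) S(2) by blast
  ultimately have "\<Psi> (t0, (Y t0 x0 - e' + d') / 2) \<in> U"
    using t0 by (simp add: U_def \<Psi>_def \<Lambda>_def XY)
  then have "U \<noteq> {}" by blast
  have memU: "(t, x) \<in> N" "t \<in> I" "(t, Y t x) \<in> R" if "(t, x) \<in> U" for t x
    using that by (auto simp: U_def \<Lambda>_def)
  have B\<phi>: "\<phi> (t, Y t x) = F (t, x)" "B (t, Y t x) = - F (t, x) / tau a t" "w (Y t x) = W t x"
    if "(t, x) \<in> U" for t x
    using memU[OF that] W[of t "Y t x"] by (simp_all add: B_def \<phi>_def \<Psi>_def XY)
  have cv: "((\<lambda>s. v (P s, Q s)) has_real_derivative P' * B (P s, Q s) + Q' * k (P s, Q s)) (at s)"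
    if "(P s, Q s) \<in> R" "(P has_real_derivative P') (at s)" "(Q has_real_derivative Q') (at s)" for P Q P' Q' s
    by (rule smooth_on_curve_derivative[OF sv[folded R_def] that]) (use d_t_d_x_eq[OF Dv] that(1) in \<open>simp add: R_def\<close>)
  have ck: "((\<lambda>x. k (t, Y t x)) has_real_derivative (W t x * v (t, Y t x) - F (t, x)) / r t) (at x)"
    if "(t, x) \<in> U" for t x
    using memU[OF that] d_t_d_x_eq(2)[OF Dk[of "(t, Y t x)"]] B\<phi>[OF that]
    by (intro smooth_on_curve_derivative[OF sk[folded R_def] _ DERIV_const DY']) (simp_all add: R_def)
  define h where "h = (\<lambda>p. exp (\<theta> p) * v (\<Lambda> p))"
  \<comment> \<open>\<open>m\<close> is the formula for h_x; \<open>A\<close> will turn out to be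
    both h_t and h_xx.\<close>
  define m where "m = (\<lambda>p. exp (\<theta> p) * (\<theta>\<^sub>x p * v (\<Lambda> p) + k (\<Lambda> p) / r (fst p)))"
  define A where "A = (\<lambda>p. exp (\<theta> p) * (\<theta>\<^sub>t p * v (\<Lambda> p) - F p / tau a (fst p)
    - k (\<Lambda> p) * xi a (fst p) (snd p) / (tau a (fst p) * r (fst p))))"
  have sh: "smooth_on U h"
    unfolding h_def
    by (intro smooth_on_mult smooth_on_real_exp U smooth_on_subset[OF \<theta>(1)]
        smooth_on_compose[OF U(1) R(1) U(3) smooth_on_subset[OF s\<Lambda> U(4)] sv[folded R_def]])
  have ht: "((\<lambda>t. h (t, x)) has_real_derivative A (t, x)) (at t)" if tx: "(t, x) \<in> U" for t x
    unfolding h_def A_def \<Lambda>_def using memU[OF tx] B\<phi>[OF tx]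
    by (auto intro!: derivative_eq_intros c\<theta> cv DY simp: algebra_simps)
  have hx: "((\<lambda>x. h (t, x)) has_real_derivative m (t, x)) (at x)" if tx: "(t, x) \<in> U" for t x
    unfolding h_def m_def \<Lambda>_def using memU[OF tx]
    by (auto intro!: derivative_eq_intros c\<theta> cv DY' simp: algebra_simps)
  have hxx: "((\<lambda>x. m (t, x)) has_real_derivative A (t, x)) (at x)" if tx: "(t, x) \<in> U" for t x
  proof -
    note t = memU[OF tx]
    define v0 where "v0 = v (t, Y t x)"
    define k0 where "k0 = k (t, Y t x)"
    define E where "E = exp (\<theta> (t, x))"
    have 1: "((\<lambda>x. v (t, Y t x)) has_real_derivative k0 / r t) (at x)"
      using cv[OF t(3) DERIV_const DY'[OF t(2)]] by (simp add: k0_def)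
    have 2: "((\<lambda>x. \<theta> (t, x)) has_real_derivative \<theta>\<^sub>x (t, x)) (at x)"
      using c\<theta>[OF t(1) DERIV_const DERIV_ident] by simp
    have "((\<lambda>x. m (t, x)) has_real_derivative
        E * \<theta>\<^sub>x (t, x) * (\<theta>\<^sub>x (t, x) * v0 + k0 / r t) + E * (- half_dtau a t / (2 * tau a t) * v0
        + \<theta>\<^sub>x (t, x) * (k0 / r t) + (W t x * v0 - F (t, x)) / r t / r t)) (at x)"
      unfolding m_def \<Lambda>_def using r(1)[OF t(2)]
      by (auto intro!: derivative_eq_intros 1 2 D\<theta>x t ck tx simp: v0_def k0_def E_def algebra_simps)
        (simp add: field_simps)
    moreover have "E * \<theta>\<^sub>x (t, x) * (\<theta>\<^sub>x (t, x) * v0 + k0 / r t) + E * (- half_dtau a t / (2 * tau a t) * v0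
        + \<theta>\<^sub>x (t, x) * (k0 / r t) + (W t x * v0 - F (t, x)) / r t / r t) = A (t, x)"
    proof -
      have rr: "(W t x * v0 - F (t, x)) / r t / r t = (W t x * v0 - F (t, x)) / tau a t"
        using r(2)[OF t(2)] by simp
      show ?thesis
        unfolding rr using r(1)[OF t(2)] \<tau>I[OF t(2)]
        by (simp add: A_def \<Lambda>_def W_def \<theta>\<^sub>x_def \<theta>\<^sub>t_def flip: v0_def k0_def E_def)
          (simp add: field_simps power2_eq_square)
    qed
    ultimately show ?thesis by simp
  qed
  have "heat_solution U h" using heat_solutionI[OF U(1) sh ht hx hxx] .
  moreover have "tau a t * d_t h (t, x) + xi a t x * d_x h (t, x) - eta a t x * h (t, x) = - f (t, x)"
    if tx: "(t, x) \<in> U" for t x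
  proof -
    note t = memU[OF tx]
    have f: "f (t, x) = F (t, x) * exp (\<theta> (t, x))" by (simp add: F_def exp_minus field_simps)
    show ?thesis
      unfolding d_t_eqI[OF sh tx ht[OF tx]] d_x_eqI[OF sh tx hx[OF tx]] f
      using r(1)[OF t(2)] \<tau>I[OF t(2)]
      by (simp add: A_def m_def h_def \<theta>\<^sub>x_def \<theta>\<^sub>t_def) (simp add: field_simps power2_eq_square)
  qed
  ultimately show ?thesis
    using that[OF U(1) \<open>U \<noteq> {}\<close>] U(2) N(2) by blast
qed

section \<open>Heat solutions, and the determining equation with vanishing
  \<open>tau\<close>\<close>

lemma heat_solution_section_derivatives:
  assumes "heat_solution S f" "(t, x) \<in> S"
  shows "((\<lambda>t. f (t, x)) has_real_derivative d_t f (t, x)) (at t)"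
    "((\<lambda>x. f (t, x)) has_real_derivative d_x f (t, x)) (at x)"
    "((\<lambda>x. d_x f (t, x)) has_real_derivative d_t f (t, x)) (at x)"
  using smooth_on_section_derivatives[of S f t x] smooth_on_section_derivatives(2)[of S "d_x f" t x]
    smooth_on_d_x[of S f] assms by (auto simp: heat_solution_def)

lemma heat_solution_subset: "heat_solution S f \<Longrightarrow> open T \<Longrightarrow> T \<subseteq> S \<Longrightarrow> heat_solution T f"
  by (auto simp: heat_solution_def intro: smooth_on_subset)

lemma heat_solution_scale:
  assumes "heat_solution S f"
  shows "heat_solution S (\<lambda>p. c * f p)"
proof (rule heat_solutionI[where A = "\<lambda>p. c * d_t f p" and m = "\<lambda>p. c * d_x f p"])
  show "open S" "smooth_on S (\<lambda>p. c * f p)"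
    using assms by (auto simp: heat_solution_def intro!: smooth_on_mult smooth_on_const)
qed (intro DERIV_cmult heat_solution_section_derivatives[OF assms]; assumption)+

text \<open>With \<tau> = 0 the first order equation yields h_x, and one more derivative in
  \<open>x\<close> yields h_xx = h_t. So both partial derivatives are prescribed, affinely in
  \<open>h\<close>. The factor \<open>exp \<theta>\<close> solves the homogeneous system, and
  variation of constants leaves a closed 1-form for \<open>v\<close>.\<close>

lemma xi_solution:
  assumes f: "heat_solution \<Omega> f" and sub: "{t0 - e..t0 + e} \<times> {x0 - e..x0 + e} \<subseteq> \<Omega>" and "e > 0"
    and \<tau>: "tau a = (\<lambda>t. 0)" "half_dtau a = (\<lambda>t. 0)" and \<zeta>: "\<And>t. t \<in> {t0 - e..t0 + e} \<Longrightarrow> zeta a t \<noteq> 0"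
  obtains U h where "open U" "U \<noteq> {}" "U \<subseteq> \<Omega>" "heat_solution U h"
    "\<And>t x. (t, x) \<in> U \<Longrightarrow>
      tau a t * d_t h (t, x) + xi a t x * d_x h (t, x) - eta a t x * h (t, x) = - f (t, x)"
proof -
  have c3: "coeff3 a = 0" using fun_cong[OF \<tau>(2), of 0] fun_cong[OF \<tau>(2), of 1] by (cases a) simp
  define N where "N = {t0 - e<..<t0 + e} \<times> {x0 - e<..<x0 + e}"
  have N: "open N" "N \<subseteq> \<Omega>" using sub by (auto simp: N_def intro!: open_Times)
  have \<zeta>N: "zeta a t \<noteq> 0" if "(t, x) \<in> N" for t x using \<zeta> that by (auto simp: N_def)
  have fN: "heat_solution N f" using heat_solution_subset[OF f N] .
  then have sf: "smooth_on N f" by (simp add: heat_solution_def)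
  note sm = smooth_on_coefficients[of _ a]
  define \<theta>\<^sub>x where "\<theta>\<^sub>x = (\<lambda>p. eta a (fst p) (snd p) / zeta a (fst p))"
  \<comment> \<open>This is \<theta>_x^2 + \<theta>_xx, so that \<open>exp \<theta>\<close> solves
    the heat equation.\<close>
  define \<theta>\<^sub>t where "\<theta>\<^sub>t = (\<lambda>p. (\<theta>\<^sub>x p)\<^sup>2 - coeff4 a / (2 * zeta a (fst p)))"
  define T where "T = {p :: real \<times> real. zeta a (fst p) \<noteq> 0}"
  have T: "open T"
    unfolding T_def
    by (intro open_Collect_neq continuous_intros smooth_on_imp_continuous_on sm(3) open_UNIV)
  have B: "smooth_on T \<theta>\<^sub>x"
    unfolding \<theta>\<^sub>x_def using T by (intro smooth_on_divide sm) (auto simp: T_def)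
  have A: "smooth_on T \<theta>\<^sub>t"
    unfolding \<theta>\<^sub>t_def using T
    by (intro smooth_on_diff smooth_on_power B smooth_on_divide smooth_on_mult smooth_on_const sm) (auto simp: T_def)
  have D\<theta>x: "((\<lambda>x. \<theta>\<^sub>x (t, x)) has_real_derivative - coeff4 a / (2 * zeta a t)) (at x)"
    if "zeta a t \<noteq> 0" for t x
    unfolding \<theta>\<^sub>x_def using that by (auto intro!: derivative_eq_intros simp: c3)
  obtain \<theta> where \<theta>: "smooth_on N \<theta>" "\<And>p. p \<in> N \<Longrightarrow> d_t \<theta> p = \<theta>\<^sub>t p" "\<And>p. p \<in> N \<Longrightarrow> d_x \<theta> p = \<theta>\<^sub>x p"
  proof -
    have closed: "d_x \<theta>\<^sub>t p = d_t \<theta>\<^sub>x p" if "p \<in> T" for p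
    proof -
      obtain t x where p: "p = (t, x)" by (cases p)
      have nz: "zeta a t \<noteq> 0" using that by (simp add: p T_def)
      have dA: "d_x \<theta>\<^sub>t p = - (coeff4 a / zeta a t) * \<theta>\<^sub>x p"
        using that nz unfolding p
        by (intro d_x_eqI[OF A], simp,
            auto simp: \<theta>\<^sub>t_def intro!: derivative_eq_intros D\<theta>x)
      have dB: "d_t \<theta>\<^sub>x p = - (coeff4 a / zeta a t) * \<theta>\<^sub>x p"
        using that nz unfolding p
        by (intro d_t_eqI[OF B], simp,
            auto simp: \<theta>\<^sub>x_def c3 intro!: derivative_eq_intros)
      show ?thesis unfolding dA dB ..
    qed
    have "{t0 - e..t0 + e} \<times> {x0 - e..x0 + e} \<subseteq> T" using \<zeta> by (auto simp: T_def)
    from closed_form_potential[OF A B this closed] obtain \<theta> where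
      \<theta>: "\<And>p. p \<in> N \<Longrightarrow> (\<theta> has_derivative (\<lambda>(dt, dx). dt * \<theta>\<^sub>t p + dx * \<theta>\<^sub>x p)) (at p)"
      unfolding N_def by blast
    have "N \<subseteq> T" using \<zeta>N by (auto simp: T_def)
    have "smooth_on N \<theta>"
      by (rule smooth_on_partialsI[OF N(1) \<theta> smooth_on_subset[OF A \<open>N \<subseteq> T\<close>] smooth_on_subset[OF B \<open>N \<subseteq> T\<close>]])
    then show ?thesis using d_t_d_x_eq[OF \<theta>] by (rule that)
  qed
  have D\<theta>: "((\<lambda>t. \<theta> (t, x)) has_real_derivative \<theta>\<^sub>t (t, x)) (at t)"
    "((\<lambda>x. \<theta> (t, x)) has_real_derivative \<theta>\<^sub>x (t, x)) (at x)" if "(t, x) \<in> N" for t x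
    using smooth_on_section_derivatives[OF \<theta>(1) that] \<theta>(2,3)[OF that] by simp_all
  note Df = heat_solution_section_derivatives[OF fN]
  have s\<theta>x: "smooth_on N \<theta>\<^sub>x"
    using smooth_on_cong[OF N(1) \<theta>(3) smooth_on_d_x[OF \<theta>(1)]] .
  \<comment> \<open>\<open>\<phi>\<close> and \<open>\<psi>\<close> are what v_x and v_t have to be
    for \<open>v = exp (- \<theta>) * h\<close>.\<close>
  define \<phi> where "\<phi> = (\<lambda>p. - (f p * exp (- \<theta> p)) / zeta a (fst p))"
  define \<psi> where "\<psi> = (\<lambda>p. - ((d_x f p + \<theta>\<^sub>x p * f p) * exp (- \<theta> p)) / zeta a (fst p))"
  have s\<phi>: "smooth_on N \<phi>" and s\<psi>: "smooth_on N \<psi>"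
    unfolding \<phi>_def \<psi>_def using \<zeta>N
    by (intro smooth_on_divide smooth_on_minus smooth_on_mult smooth_on_add smooth_on_real_exp s\<theta>x
        smooth_on_d_x sf sm \<theta>(1) N(1); force)+
  have closed: "d_x \<psi> p = d_t \<phi> p" if "p \<in> N" for p
  proof -
    obtain t x where p: "p = (t, x)" by (cases p)
    note tx = that[unfolded p]
    define E where "E = exp (- \<theta> p)"
    have d\<psi>: "d_x \<psi> p = - ((d_t f p - coeff4 a / (2 * zeta a t) * f p - (\<theta>\<^sub>x p)\<^sup>2 * f p) * E) / zeta a t"
      unfolding p using \<zeta>N[OF tx] tx
      by (intro d_x_eqI[OF s\<psi>], simp,
          auto simp: \<psi>_def E_def p intro!: derivative_eq_intros Df D\<theta> D\<theta>x,
          simp add: field_simps power2_eq_square)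
    have d\<phi>: "d_t \<phi> p = - (d_t f p - \<theta>\<^sub>t p * f p) * E / zeta a t + coeff4 a * f p * E / (zeta a t)\<^sup>2"
      unfolding p using \<zeta>N[OF tx] tx
      by (intro d_t_eqI[OF s\<phi>], simp,
          auto simp: \<phi>_def E_def p intro!: derivative_eq_intros Df D\<theta>,
          simp add: field_simps power2_eq_square)
    show ?thesis
      unfolding d\<psi> d\<phi> \<theta>\<^sub>t_def using \<zeta>N[OF tx] by (simp add: p field_simps power2_eq_square)
  qed
  define U where "U = {t0 - e / 2<..<t0 + e / 2} \<times> {x0 - e / 2<..<x0 + e / 2}"
  have "{t0 - e / 2..t0 + e / 2} \<times> {x0 - e / 2..x0 + e / 2} \<subseteq> N"
    using \<open>e > 0\<close> by (auto simp: N_def)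
  from closed_form_potential[OF s\<psi> s\<phi> this closed] obtain v where
    Dv: "\<And>p. p \<in> U \<Longrightarrow> (v has_derivative (\<lambda>(dt, dx). dt * \<psi> p + dx * \<phi> p)) (at p)"
    unfolding U_def by blast
  have U: "open U" "U \<noteq> {}" "U \<subseteq> N"
    using \<open>e > 0\<close> by (auto simp: N_def U_def intro!: open_Times)
  have sv: "smooth_on U v"
    by (rule smooth_on_partialsI[OF U(1) Dv smooth_on_subset[OF s\<psi> U(3)] smooth_on_subset[OF s\<phi> U(3)]])
  have Dv': "((\<lambda>t. v (t, x)) has_real_derivative \<psi> (t, x)) (at t)"
    "((\<lambda>x. v (t, x)) has_real_derivative \<phi> (t, x)) (at x)" if "(t, x) \<in> U" for t x
    using smooth_on_section_derivatives[OF sv that] d_t_d_x_eq[OF Dv[OF that]] by simp_all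
  define h where "h = (\<lambda>p. exp (\<theta> p) * v p)"
  define m where "m = (\<lambda>p. \<theta>\<^sub>x p * h p - f p / zeta a (fst p))"
  define A where "A = (\<lambda>p. \<theta>\<^sub>t p * h p - (d_x f p + \<theta>\<^sub>x p * f p) / zeta a (fst p))"
  have sh: "smooth_on U h"
    unfolding h_def by (intro smooth_on_mult smooth_on_real_exp U smooth_on_subset[OF \<theta>(1)] sv)
  have memU: "(t, x) \<in> N" "zeta a t \<noteq> 0" if "(t, x) \<in> U" for t x
    using that U(3) \<zeta>N by blast+
  have ht: "((\<lambda>t. h (t, x)) has_real_derivative A (t, x)) (at t)" if tx: "(t, x) \<in> U" for t x
    unfolding h_def A_def using memU[OF tx]
    by (auto intro!: derivative_eq_intros D\<theta> Dv' tx simp: \<psi>_def exp_minus field_simps)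
  have hx: "((\<lambda>x. h (t, x)) has_real_derivative m (t, x)) (at x)" if tx: "(t, x) \<in> U" for t x
    unfolding h_def m_def using memU[OF tx]
    by (auto intro!: derivative_eq_intros D\<theta> Dv' tx simp: \<phi>_def exp_minus field_simps)
  have hxx: "((\<lambda>x. m (t, x)) has_real_derivative A (t, x)) (at x)" if tx: "(t, x) \<in> U" for t x
  proof -
    have "((\<lambda>x. m (t, x)) has_real_derivative - coeff4 a / (2 * zeta a t) * h (t, x)
        + \<theta>\<^sub>x (t, x) * m (t, x) - d_x f (t, x) / zeta a t) (at x)"
      using memU[OF tx] hx[OF tx] unfolding m_def
      by (auto intro!: derivative_eq_intros D\<theta>x Df)
    then show ?thesis
      by (rule DERIV_cong) (use memU[OF tx] in \<open>simp add: m_def A_def \<theta>\<^sub>t_def field_simps power2_eq_square\<close>)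
  qed
  have "heat_solution U h" using heat_solutionI[OF U(1) sh ht hx hxx] .
  moreover have "tau a t * d_t h (t, x) + xi a t x * d_x h (t, x) - eta a t x * h (t, x) = - f (t, x)"
    if tx: "(t, x) \<in> U" for t x
    unfolding d_x_eqI[OF sh tx hx[OF tx]] using memU[OF tx]
    by (simp add: \<tau> xi_def m_def \<theta>\<^sub>x_def field_simps)
  ultimately show ?thesis
    using that[OF U(1,2)] U(3) N(2) by blast
qed

lemma coefficient_minus:
  "tau (- a) t = - tau a t" "xi (- a) t x = - xi a t x" "eta (- a) t x = - eta a t x"
  by (cases a; simp add: xi_def field_simps)+

text \<open>Three cases, by the first of \<open>tau\<close>, \<open>zeta\<close>, \<open>a6\<close>
  that does not vanish identically. A negative \<open>tau\<close> is reduced to a positive one by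
  passing from \<open>(a, f)\<close> to \<open>(- a, - f)\<close>, which does not change the
  equation.\<close>

lemma determining_equation_solvable:
  assumes f: "heat_solution \<Omega> f" and "\<Omega> \<noteq> {}" "a \<noteq> 0"
  obtains U h where "open U" "U \<noteq> {}" "U \<subseteq> \<Omega>" "heat_solution U h"
    "\<And>t x. (t, x) \<in> U \<Longrightarrow>
      tau a t * d_t h (t, x) + xi a t x * d_x h (t, x) - eta a t x * h (t, x) = - f (t, x)"
proof -
  have "open \<Omega>" using f by (simp add: heat_solution_def)
  obtain t0 x0 where "(t0, x0) \<in> \<Omega>" using \<open>\<Omega> \<noteq> {}\<close> by fast
  then obtain e where e: "e > 0" "{t0 - e..t0 + e} \<times> {x0 - e..x0 + e} \<subseteq> \<Omega>"
    by (rule open_contains_rectangle[OF \<open>open \<Omega>\<close>])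
  obtain a1 a2 a3 a4 a5 a6 where a: "a = (a1, a2, a3, a4, a5, a6)" by (cases a)
  have shrink: "\<exists>t1 d. d > 0 \<and> {t1 - d..t1 + d} \<times> {x0 - d..x0 + d} \<subseteq> \<Omega> \<and> (\<forall>t\<in>{t1 - d..t1 + d}. q t \<noteq> 0)"
    if "continuous_on UNIV q" "t \<in> {t0 - e..t0 + e}" "q t \<noteq> 0" for t and q :: "real \<Rightarrow> real"
  proof -
    have "open (\<Omega> \<inter> {p. q (fst p) \<noteq> 0})"
      by (intro open_Int \<open>open \<Omega>\<close> open_Collect_neq continuous_on_compose2[OF that(1)] continuous_intros) auto
    moreover have "(t, x0) \<in> \<Omega> \<inter> {p. q (fst p) \<noteq> 0}" using that e by auto
    ultimately obtain d where d: "d > 0" "{t - d..t + d} \<times> {x0 - d..x0 + d} \<subseteq> \<Omega> \<inter> {p. q (fst p) \<noteq> 0}"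
      by (rule open_contains_rectangle)
    have "q s \<noteq> 0" if "s \<in> {t - d..t + d}" for s
    proof -
      have "(s, x0) \<in> {t - d..t + d} \<times> {x0 - d..x0 + d}" using that d(1) by auto
      from subsetD[OF d(2) this] show ?thesis by simp
    qed
    with d show ?thesis by blast
  qed
  have cont: "continuous_on UNIV (tau a)" "continuous_on UNIV (zeta a)"
    by (auto intro!: DERIV_continuous_on derivative_eq_intros)
  consider (tau) t where "t \<in> {t0 - e..t0 + e}" "tau a t \<noteq> 0"
    | (zeta) t where "a1 = 0" "a2 = 0" "a3 = 0" "t \<in> {t0 - e..t0 + e}" "zeta a t \<noteq> 0"
    | (const) "a1 = 0" "a2 = 0" "a3 = 0" "a4 = 0" "a5 = 0" "a6 \<noteq> 0"
  proof -
    note tau = that(1) and zeta = that(2) and const = that(3)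
    have mem: "t0 - e \<in> {t0 - e..t0 + e}" "t0 \<in> {t0 - e..t0 + e}" "t0 + e \<in> {t0 - e..t0 + e}" using e by auto
    \<comment> \<open>A polynomial of degree at most 2 with three zeros is zero; second and first
      differences extract its coefficients.\<close>
    have "a1 = 0 \<and> a2 = 0 \<and> a3 = 0" if 0: "tau a (t0 - e) = 0" "tau a t0 = 0" "tau a (t0 + e) = 0"
    proof -
      have "2 * a3 * e\<^sup>2 = tau a (t0 - e) + tau a (t0 + e) - 2 * tau a t0"
        by (simp add: a power2_eq_square algebra_simps)
      then have "a3 = 0" using 0 e by simp
      then have "4 * a2 * e = tau a (t0 + e) - tau a (t0 - e)" by (simp add: a algebra_simps)
      then have "a2 = 0" using 0 e by simp
      with \<open>a3 = 0\<close> 0(2) show ?thesis by (simp add: a)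
    qed
    moreover have "a4 = 0 \<and> a5 = 0" if 0: "zeta a t0 = 0" "zeta a (t0 + e) = 0"
    proof -
      have "a4 * e = zeta a (t0 + e) - zeta a t0" by (simp add: a algebra_simps)
      then have "a4 = 0" using 0 e by simp
      with 0(1) show ?thesis by (simp add: a)
    qed
    moreover have "a1 \<noteq> 0 \<or> a2 \<noteq> 0 \<or> a3 \<noteq> 0 \<or> a4 \<noteq> 0 \<or> a5 \<noteq> 0 \<or> a6 \<noteq> 0"
      using \<open>a \<noteq> 0\<close> by (simp add: a zero_prod_def)
    ultimately show ?thesis using mem tau zeta const by blast
  qed
  then show ?thesis
  proof cases
    case (tau t)
    obtain t1 d where d: "d > 0" "{t1 - d..t1 + d} \<times> {x0 - d..x0 + d} \<subseteq> \<Omega>" "\<forall>t\<in>{t1 - d..t1 + d}. tau a t \<noteq> 0"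
      using shrink[OF cont(1) tau] by blast
    have c: "connected (tau a ` {t1 - d..t1 + d})"
      by (intro connected_continuous_image continuous_on_subset[OF cont(1)]) auto
    have "(\<forall>t\<in>{t1 - d..t1 + d}. tau a t > 0) \<or> (\<forall>t\<in>{t1 - d..t1 + d}. tau a t < 0)"
    proof (rule ccontr)
      assume "\<not> ?thesis"
      then obtain s s' where s: "s \<in> {t1 - d..t1 + d}" "s' \<in> {t1 - d..t1 + d}" "tau a s \<le> 0" "0 \<le> tau a s'"
        by (auto simp: not_less)
      then have "0 \<in> tau a ` {t1 - d..t1 + d}"
        using connectedD_interval[OF c] by (meson image_eqI)
      with d(3) show False by force
    qed
    then show ?thesis
    proof
      assume "\<forall>t\<in>{t1 - d..t1 + d}. tau a t > 0"
      then show ?thesis using tau_pos_rectangle_solution[OF f d(2,1), of a] that by blast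
    next
      assume "\<forall>t\<in>{t1 - d..t1 + d}. tau a t < 0"
      then have "tau (- a) t > 0" if "t \<in> {t1 - d..t1 + d}" for t
        using that by (simp add: coefficient_minus)
      from tau_pos_rectangle_solution[OF heat_solution_scale[OF f, of "-1"] d(2,1) this]
      obtain U h where U: "open U" "U \<noteq> {}" "U \<subseteq> \<Omega>" "heat_solution U h" and
        eq: "\<And>t x. (t, x) \<in> U \<Longrightarrow>
          tau (- a) t * d_t h (t, x) + xi (- a) t x * d_x h (t, x) - eta (- a) t x * h (t, x) = - (- 1 * f (t, x))"
        by blast
      show ?thesis
        by (rule that[OF U]) (use eq in \<open>fastforce simp: coefficient_minus\<close>)
    qed
  next
    case (zeta t)
    obtain t1 d where "d > 0" "{t1 - d..t1 + d} \<times> {x0 - d..x0 + d} \<subseteq> \<Omega>" "\<forall>t\<in>{t1 - d..t1 + d}. zeta a t \<noteq> 0"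
      using shrink[OF cont(2) zeta(4,5)] by blast
    moreover have "tau a = (\<lambda>t. 0)" "half_dtau a = (\<lambda>t. 0)" using zeta by (auto simp: a)
    ultimately show ?thesis using xi_solution[OF f, of t1 d x0 a] that by blast
  next
    case const
    \<comment> \<open>Only \<open>a6\<close> is left, and the equation is algebraic:
      \<open>a6 * h = f\<close>.\<close>
    show ?thesis
      by (rule that[OF \<open>open \<Omega>\<close> \<open>\<Omega> \<noteq> {}\<close> order_refl heat_solution_scale[OF f, of "1 / a6"]])
        (use const in \<open>simp add: a xi_def\<close>)
  qed
qed

section \<open>The action on the essential coefficients\<close>

text \<open>The group element with these parameters maps the essential field with coefficients
  \<open>pull_coeffs \<dots> b\<close> to the one with coefficients \<open>b\<close>. The matrix acts first on \<open>b\<close>, with \<open>c4\<close>, \<open>c5\<close> as the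
  resulting Heisenberg components, and the Galilean shift acts second.\<close>

fun pull_coeffs :: "real \<Rightarrow> real \<Rightarrow> real \<Rightarrow> real \<Rightarrow> real \<Rightarrow> real \<Rightarrow> coeffs \<Rightarrow> coeffs" where
  "pull_coeffs \<alpha> \<beta> \<gamma> \<delta> l1 l0 (b1, b2, b3, b4, b5, b6) =
     (let a1 = b1 * \<delta>\<^sup>2 + 2 * b2 * \<beta> * \<delta> + b3 * \<beta>\<^sup>2;
          a2 = b1 * \<gamma> * \<delta> + b2 * (\<alpha> * \<delta> + \<beta> * \<gamma>) + b3 * \<alpha> * \<beta>;
          a3 = b1 * \<gamma>\<^sup>2 + 2 * b2 * \<alpha> * \<gamma> + b3 * \<alpha>\<^sup>2;
          c4 = \<alpha> * b4 + \<gamma> * b5;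
          c5 = \<beta> * b4 + \<delta> * b5
      in (a1, a2, a3, l0 * a3 - l1 * a2 + c4, l0 * a2 - l1 * a1 + c5,
          b6 - a3 * l0\<^sup>2 / 4 + a2 * l0 * l1 / 2 - a1 * l1\<^sup>2 / 4 - c4 * l0 / 2 + c5 * l1 / 2))"

text \<open>This and the next two lemmas are the components in \<open>t\<close>, in \<open>x\<close>
  and linear in \<open>u\<close> of one assertion: the differential of the transformation carries
  the field with the pulled back coefficients to the one with coefficients \<open>b\<close>. The
  factor \<open>1 / N\<^sup>2\<close> is the derivative of \<open>M / N\<close> for determinant
  1.\<close>

lemma pull_coeffs_tau:
  fixes \<alpha> \<beta> \<gamma> \<delta> t :: real
  defines "N \<equiv> \<gamma> * t + \<delta>" and "M \<equiv> \<alpha> * t + \<beta>"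
  assumes "N \<noteq> 0"
  shows "tau (pull_coeffs \<alpha> \<beta> \<gamma> \<delta> l1 l0 b) t / N\<^sup>2 = tau b (M / N)"
proof -
  obtain b1 b2 b3 b4 b5 b6 where b: "b = (b1, b2, b3, b4, b5, b6)" by (cases b)
  have T: "tau (pull_coeffs \<alpha> \<beta> \<gamma> \<delta> l1 l0 b) t = b1 * N\<^sup>2 + 2 * b2 * M * N + b3 * M\<^sup>2"
    by (simp add: b N_def M_def Let_def power2_eq_square algebra_simps)
  show ?thesis unfolding T using assms(3) by (simp add: b field_simps power2_eq_square)
qed

lemma pull_coeffs_xi:
  fixes x l1 l0 \<alpha> \<beta> \<gamma> \<delta> t :: real and b :: coeffs
  defines "N \<equiv> \<gamma> * t + \<delta>" and "M \<equiv> \<alpha> * t + \<beta>" and "Y \<equiv> x + l1 * t + l0"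
  assumes N: "N \<noteq> 0" and det: "\<alpha> * \<delta> - \<beta> * \<gamma> = 1"
  defines "a \<equiv> pull_coeffs \<alpha> \<beta> \<gamma> \<delta> l1 l0 b"
  shows "xi a t x / N + tau a t * (l1 / N - \<gamma> * Y / N\<^sup>2) = xi b (M / N) (Y / N)"
proof -
  obtain b1 b2 b3 b4 b5 b6 where b: "b = (b1, b2, b3, b4, b5, b6)" by (cases b)
  \<comment> \<open>\<open>H\<close> is \<open>half_dtau a t\<close> in terms of \<open>N\<close>
    and \<open>M\<close>, so that the determinant enters only through
    \<open>\<alpha> * N - \<gamma> * M = 1\<close>.\<close>
  define H where "H = b1 * \<gamma> * N + b2 * (\<alpha> * N + \<gamma> * M) + b3 * \<alpha> * M"
  have T: "tau a t = b1 * N\<^sup>2 + 2 * b2 * M * N + b3 * M\<^sup>2"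
    by (simp add: a_def N_def M_def b Let_def power2_eq_square algebra_simps)
  have X: "xi a t x = H * Y - l1 * tau a t + b4 * M + b5 * N"
    by (simp add: a_def N_def M_def Y_def H_def b Let_def xi_def power2_eq_square algebra_simps)
  have MN: "\<alpha> * N - \<gamma> * M = 1" using det by (simp add: N_def M_def algebra_simps)
  have "N * H - \<gamma> * tau a t = (\<alpha> * N - \<gamma> * M) * (b2 * N + b3 * M)"
    unfolding T H_def by (simp add: power2_eq_square algebra_simps)
  then have H: "N * H - \<gamma> * tau a t = b2 * N + b3 * M" by (simp add: MN)
  have "xi a t x / N + tau a t * (l1 / N - \<gamma> * Y / N\<^sup>2)
      = (Y * (N * H - \<gamma> * tau a t) + N * (b4 * M + b5 * N)) / N\<^sup>2"
    unfolding X using N by (simp add: field_simps power2_eq_square)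
  also have "\<dots> = xi b (M / N) (Y / N)"
    unfolding H using N by (simp add: b xi_def field_simps power2_eq_square)
  finally show ?thesis .
qed

lemma pull_coeffs_eta:
  fixes x l1 l0 \<alpha> \<beta> \<gamma> \<delta> t :: real and b :: coeffs
  defines "N \<equiv> \<gamma> * t + \<delta>" and "M \<equiv> \<alpha> * t + \<beta>" and "Y \<equiv> x + l1 * t + l0"
  assumes N: "N \<noteq> 0" and det: "\<alpha> * \<delta> - \<beta> * \<gamma> = 1"
  defines "a \<equiv> pull_coeffs \<alpha> \<beta> \<gamma> \<delta> l1 l0 b"
  shows "eta a t x + tau a t * (\<gamma> / (2 * N) + \<gamma> * l1 * Y / (2 * N) - \<gamma>\<^sup>2 * Y\<^sup>2 / (4 * N\<^sup>2) - l1\<^sup>2 / 4)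
      + xi a t x * (\<gamma> * Y / (2 * N) - l1 / 2) = eta b (M / N) (Y / N)"
proof -
  obtain b1 b2 b3 b4 b5 b6 where b: "b = (b1, b2, b3, b4, b5, b6)" by (cases b)
  define H where "H = b1 * \<gamma> * N + b2 * (\<alpha> * N + \<gamma> * M) + b3 * \<alpha> * M"
  \<comment> \<open>\<open>P\<close> is the third coefficient of \<open>a\<close>, the slope of
    \<open>H\<close> in \<open>t\<close>.\<close>
  define P where "P = b1 * \<gamma>\<^sup>2 + 2 * b2 * \<alpha> * \<gamma> + b3 * \<alpha>\<^sup>2"
  have T: "tau a t = b1 * N\<^sup>2 + 2 * b2 * M * N + b3 * M\<^sup>2"
    by (simp add: a_def N_def M_def b Let_def power2_eq_square algebra_simps)
  have X: "xi a t x = H * Y - l1 * tau a t + b4 * M + b5 * N"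
    by (simp add: a_def N_def M_def Y_def H_def b Let_def xi_def power2_eq_square algebra_simps)
  have E: "eta a t x = b6 - H / 2 - P * Y\<^sup>2 / 4 + H * Y * l1 / 2 - tau a t * l1\<^sup>2 / 4
      - (\<alpha> * b4 + \<gamma> * b5) * Y / 2 + (b4 * M + b5 * N) * l1 / 2"
    by (simp add: a_def N_def M_def Y_def H_def P_def b Let_def) (simp add: field_simps power2_eq_square)
  have MN: "\<alpha> * N - \<gamma> * M = 1" using det by (simp add: N_def M_def algebra_simps)
  have H: "N * H - \<gamma> * tau a t = b2 * N + b3 * M"
    using MN unfolding T H_def by algebra
  have P: "P * N\<^sup>2 - 2 * \<gamma> * N * H + \<gamma>\<^sup>2 * tau a t = b3"
    using MN unfolding T H_def P_def by algebra
  have "eta a t x + tau a t * (\<gamma> / (2 * N) + \<gamma> * l1 * Y / (2 * N) - \<gamma>\<^sup>2 * Y\<^sup>2 / (4 * N\<^sup>2) - l1\<^sup>2 / 4)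
      + xi a t x * (\<gamma> * Y / (2 * N) - l1 / 2)
      = b6 - (N * H - \<gamma> * tau a t) / (2 * N) - (P * N\<^sup>2 - 2 * \<gamma> * N * H + \<gamma>\<^sup>2 * tau a t) * Y\<^sup>2 / (4 * N\<^sup>2)
        - (b4 * (\<alpha> * N - \<gamma> * M)) * Y / (2 * N)"
    unfolding E X using N by (simp add: field_simps power2_eq_square)
  also have "\<dots> = eta b (M / N) (Y / N)"
    unfolding H P MN using N by (simp add: b field_simps power2_eq_square)
  finally show ?thesis .
qed

text \<open>The parameters on the right are those of the composed transformation: the matrix
  product, and \<open>(l1, l0)\<close> plus the row vector \<open>(l1', l0')\<close> times the
  unprimed matrix. This makes equivalence of coefficients transitive without composing partially
  defined maps.\<close>

lemma pull_coeffs_pull_coeffs: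
  assumes det: "\<alpha> * \<delta> - \<beta> * \<gamma> = 1"
  shows "pull_coeffs \<alpha> \<beta> \<gamma> \<delta> l1 l0 (pull_coeffs \<alpha>' \<beta>' \<gamma>' \<delta>' l1' l0' b) =
    pull_coeffs (\<alpha>' * \<alpha> + \<beta>' * \<gamma>) (\<alpha>' * \<beta> + \<beta>' * \<delta>) (\<gamma>' * \<alpha> + \<delta>' * \<gamma>) (\<gamma>' * \<beta> + \<delta>' * \<delta>)
      (l1 + l1' * \<alpha> + l0' * \<gamma>) (l0 + l1' * \<beta> + l0' * \<delta>) b"
proof -
  obtain b1 b2 b3 b4 b5 b6 where b: "b = (b1, b2, b3, b4, b5, b6)" by (cases b)
  define p1 where "p1 = b1 * \<delta>'\<^sup>2 + 2 * b2 * \<beta>' * \<delta>' + b3 * \<beta>'\<^sup>2"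
  define p2 where "p2 = b1 * \<gamma>' * \<delta>' + b2 * (\<alpha>' * \<delta>' + \<beta>' * \<gamma>') + b3 * \<alpha>' * \<beta>'"
  define p3 where "p3 = b1 * \<gamma>'\<^sup>2 + 2 * b2 * \<alpha>' * \<gamma>' + b3 * \<alpha>'\<^sup>2"
  define c4 where "c4 = \<alpha>' * b4 + \<gamma>' * b5"
  define c5 where "c5 = \<beta>' * b4 + \<delta>' * b5"
  note defs = p1_def p2_def p3_def c4_def c5_def
  have 1: "b1 * (\<gamma>' * \<beta> + \<delta>' * \<delta>)\<^sup>2 + 2 * b2 * (\<alpha>' * \<beta> + \<beta>' * \<delta>) * (\<gamma>' * \<beta> + \<delta>' * \<delta>) + b3 * (\<alpha>' * \<beta> + \<beta>' * \<delta>)\<^sup>2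
      = p1 * \<delta>\<^sup>2 + 2 * p2 * \<beta> * \<delta> + p3 * \<beta>\<^sup>2"
    by (simp add: defs power2_eq_square algebra_simps)
  have 2: "b1 * (\<gamma>' * \<alpha> + \<delta>' * \<gamma>) * (\<gamma>' * \<beta> + \<delta>' * \<delta>)
      + b2 * ((\<alpha>' * \<alpha> + \<beta>' * \<gamma>) * (\<gamma>' * \<beta> + \<delta>' * \<delta>) + (\<alpha>' * \<beta> + \<beta>' * \<delta>) * (\<gamma>' * \<alpha> + \<delta>' * \<gamma>))
      + b3 * (\<alpha>' * \<alpha> + \<beta>' * \<gamma>) * (\<alpha>' * \<beta> + \<beta>' * \<delta>)
      = p1 * \<gamma> * \<delta> + p2 * (\<alpha> * \<delta> + \<beta> * \<gamma>) + p3 * \<alpha> * \<beta>"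
    by (simp add: defs power2_eq_square algebra_simps)
  have 3: "b1 * (\<gamma>' * \<alpha> + \<delta>' * \<gamma>)\<^sup>2 + 2 * b2 * (\<alpha>' * \<alpha> + \<beta>' * \<gamma>) * (\<gamma>' * \<alpha> + \<delta>' * \<gamma>) + b3 * (\<alpha>' * \<alpha> + \<beta>' * \<gamma>)\<^sup>2
      = p1 * \<gamma>\<^sup>2 + 2 * p2 * \<alpha> * \<gamma> + p3 * \<alpha>\<^sup>2"
    by (simp add: defs power2_eq_square algebra_simps)
  have 4: "(\<alpha>' * \<alpha> + \<beta>' * \<gamma>) * b4 + (\<gamma>' * \<alpha> + \<delta>' * \<gamma>) * b5 = \<alpha> * c4 + \<gamma> * c5"
    "(\<alpha>' * \<beta> + \<beta>' * \<delta>) * b4 + (\<gamma>' * \<beta> + \<delta>' * \<delta>) * b5 = \<beta> * c4 + \<delta> * c5"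
    by (simp_all add: defs algebra_simps)
  define A1 where "A1 = p1 * \<delta>\<^sup>2 + 2 * p2 * \<beta> * \<delta> + p3 * \<beta>\<^sup>2"
  define A2 where "A2 = p1 * \<gamma> * \<delta> + p2 * (\<alpha> * \<delta> + \<beta> * \<gamma>) + p3 * \<alpha> * \<beta>"
  define A3 where "A3 = p1 * \<gamma>\<^sup>2 + 2 * p2 * \<alpha> * \<gamma> + p3 * \<alpha>\<^sup>2"
  define e4 where "e4 = \<alpha> * c4 + \<gamma> * c5"
  define e5 where "e5 = \<beta> * c4 + \<delta> * c5"
  define v0 where "v0 = l1' * \<beta> + l0' * \<delta>"
  define v1 where "v1 = l1' * \<alpha> + l0' * \<gamma>"
  note defs' = A1_def A2_def A3_def e4_def e5_def v0_def v1_def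
  \<comment> \<open>The transformed form, paired with the transformed row vector
    \<open>(v1, v0)\<close>, reproduces the original pairing up to powers of the determinant, which
    is 1.\<close>
  have "(\<alpha> * \<delta> - \<beta> * \<gamma>) * (\<alpha> * (l0' * p3 - l1' * p2) + \<gamma> * (l0' * p2 - l1' * p1)) = A3 * v0 - A2 * v1"
    "(\<alpha> * \<delta> - \<beta> * \<gamma>) * (\<beta> * (l0' * p3 - l1' * p2) + \<delta> * (l0' * p2 - l1' * p1)) = A2 * v0 - A1 * v1"
    "(\<alpha> * \<delta> - \<beta> * \<gamma>)\<^sup>2 * (p3 * l0'\<^sup>2 - 2 * p2 * l0' * l1' + p1 * l1'\<^sup>2) = A3 * v0\<^sup>2 - 2 * A2 * v0 * v1 + A1 * v1\<^sup>2"
    "(\<alpha> * \<delta> - \<beta> * \<gamma>) * (c5 * l1' - c4 * l0') = e5 * v1 - e4 * v0"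
    by (simp_all add: defs' power2_eq_square algebra_simps)
  then have k4: "\<alpha> * (l0' * p3 - l1' * p2 + c4) + \<gamma> * (l0' * p2 - l1' * p1 + c5) = A3 * v0 - A2 * v1 + e4"
    and k5: "\<beta> * (l0' * p3 - l1' * p2 + c4) + \<delta> * (l0' * p2 - l1' * p1 + c5) = A2 * v0 - A1 * v1 + e5"
    and k6: "p3 * l0'\<^sup>2 - 2 * p2 * l0' * l1' + p1 * l1'\<^sup>2 = A3 * v0\<^sup>2 - 2 * A2 * v0 * v1 + A1 * v1\<^sup>2"
      "c5 * l1' - c4 * l0' = e5 * v1 - e4 * v0"
    by (simp_all add: det e4_def e5_def algebra_simps)
  have k6': "b6 - p3 * l0'\<^sup>2 / 4 + p2 * l0' * l1' / 2 - p1 * l1'\<^sup>2 / 4 - c4 * l0' / 2 + c5 * l1' / 2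
      = b6 - (A3 * v0\<^sup>2 - 2 * A2 * v0 * v1 + A1 * v1\<^sup>2) / 4 + (e5 * v1 - e4 * v0) / 2"
    unfolding k6[symmetric] by (simp add: field_simps)
  have v: "l1 + l1' * \<alpha> + l0' * \<gamma> = l1 + v1" "l0 + l1' * \<beta> + l0' * \<delta> = l0 + v0"
    by (simp_all add: v0_def v1_def)
  show ?thesis
    unfolding b pull_coeffs.simps Let_def prod.inject 1 2 3 4 defs[symmetric] v k6'
      A1_def[symmetric] A2_def[symmetric] A3_def[symmetric] e4_def[symmetric] e5_def[symmetric] k4 k5
    by (simp add: field_simps power2_eq_square)
qed

section \<open>Equivalence of coefficient tuples and its invariants\<close>

definition equiv_coeffs :: "coeffs \<Rightarrow> coeffs \<Rightarrow> bool" where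
  "equiv_coeffs a b \<longleftrightarrow> (\<exists>\<alpha> \<beta> \<gamma> \<delta> l1 l0. \<alpha> * \<delta> - \<beta> * \<gamma> = 1 \<and> a = pull_coeffs \<alpha> \<beta> \<gamma> \<delta> l1 l0 b)"

lemma equiv_coeffsI:
  "\<alpha> * \<delta> - \<beta> * \<gamma> = 1 \<Longrightarrow> a = pull_coeffs \<alpha> \<beta> \<gamma> \<delta> l1 l0 b \<Longrightarrow> equiv_coeffs a b"
  unfolding equiv_coeffs_def by blast

lemma equiv_coeffs_trans:
  assumes "equiv_coeffs a b" "equiv_coeffs b c"
  shows "equiv_coeffs a c"
proof -
  obtain \<alpha> \<beta> \<gamma> \<delta> l1 l0 where 1: "\<alpha> * \<delta> - \<beta> * \<gamma> = 1" "a = pull_coeffs \<alpha> \<beta> \<gamma> \<delta> l1 l0 b"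
    using assms(1) unfolding equiv_coeffs_def by blast
  obtain \<alpha>' \<beta>' \<gamma>' \<delta>' l1' l0' where 2: "\<alpha>' * \<delta>' - \<beta>' * \<gamma>' = 1" "b = pull_coeffs \<alpha>' \<beta>' \<gamma>' \<delta>' l1' l0' c"
    using assms(2) unfolding equiv_coeffs_def by blast
  show ?thesis
  proof (rule equiv_coeffsI)
    show "(\<alpha>' * \<alpha> + \<beta>' * \<gamma>) * (\<gamma>' * \<beta> + \<delta>' * \<delta>) - (\<alpha>' * \<beta> + \<beta>' * \<delta>) * (\<gamma>' * \<alpha> + \<delta>' * \<gamma>) = 1"
      using 1(1) 2(1) by algebra
    show "a = pull_coeffs (\<alpha>' * \<alpha> + \<beta>' * \<gamma>) (\<alpha>' * \<beta> + \<beta>' * \<delta>) (\<gamma>' * \<alpha> + \<delta>' * \<gamma>) (\<gamma>' * \<beta> + \<delta>' * \<delta>)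
        (l1 + l1' * \<alpha> + l0' * \<gamma>) (l0 + l1' * \<beta> + l0' * \<delta>) c"
      unfolding 1(2) 2(2) by (rule pull_coeffs_pull_coeffs[OF 1(1)])
  qed
qed

text \<open>A quarter of the discriminant of \<open>tau\<close>.\<close>

fun discr :: "coeffs \<Rightarrow> real" where
  "discr (a1, a2, a3, a4, a5, a6) = a2\<^sup>2 - a1 * a3"

text \<open>Galilean shifts change \<open>a6\<close>; the quadratic form of \<open>tau\<close>,
  evaluated on the Heisenberg part, compensates for this. If \<open>a4 = a5 = 0\<close>, the value
  is \<open>4 * discr * a6\<close>, so \<open>cubic\<close> fixes the coefficient of
  \<open>vI\<close> in a normal form with nonzero \<open>discr\<close>.\<close>

fun cubic :: "coeffs \<Rightarrow> real" where
  "cubic (a1, a2, a3, a4, a5, a6) = 4 * (a2\<^sup>2 - a1 * a3) * a6 - (a1 * a4\<^sup>2 - 2 * a2 * a4 * a5 + a3 * a5\<^sup>2)"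

lemma equiv_coeffs_invariants:
  assumes "equiv_coeffs a b"
  shows "discr a = discr b" "cubic a = cubic b"
proof -
  obtain b1 b2 b3 b4 b5 b6 where b: "b = (b1, b2, b3, b4, b5, b6)" by (cases b)
  obtain \<alpha> \<beta> \<gamma> \<delta> l1 l0 where det: "\<alpha> * \<delta> - \<beta> * \<gamma> = 1" and a: "a = pull_coeffs \<alpha> \<beta> \<gamma> \<delta> l1 l0 b"
    using assms unfolding equiv_coeffs_def by blast
  have "discr a = (\<alpha> * \<delta> - \<beta> * \<gamma>)\<^sup>2 * discr b"
    by (simp add: a b Let_def power2_eq_square algebra_simps)
  then show "discr a = discr b" by (simp add: det)
  define a1 where "a1 = b1 * \<delta>\<^sup>2 + 2 * b2 * \<beta> * \<delta> + b3 * \<beta>\<^sup>2"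
  define a2 where "a2 = b1 * \<gamma> * \<delta> + b2 * (\<alpha> * \<delta> + \<beta> * \<gamma>) + b3 * \<alpha> * \<beta>"
  define a3 where "a3 = b1 * \<gamma>\<^sup>2 + 2 * b2 * \<alpha> * \<gamma> + b3 * \<alpha>\<^sup>2"
  define c4 where "c4 = \<alpha> * b4 + \<gamma> * b5"
  define c5 where "c5 = \<beta> * b4 + \<delta> * b5"
  have "cubic a = 4 * (a2\<^sup>2 - a1 * a3) * b6 - (a1 * c4\<^sup>2 - 2 * a2 * c4 * c5 + a3 * c5\<^sup>2)"
    unfolding a b pull_coeffs.simps Let_def cubic.simps
      a1_def[symmetric] a2_def[symmetric] a3_def[symmetric] c4_def[symmetric] c5_def[symmetric]
    by (simp add: field_simps power2_eq_square)
  moreover have "a2\<^sup>2 - a1 * a3 = (\<alpha> * \<delta> - \<beta> * \<gamma>)\<^sup>2 * (b2\<^sup>2 - b1 * b3)"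
    by (simp add: a1_def a2_def a3_def power2_eq_square algebra_simps)
  moreover have "a1 * c4\<^sup>2 - 2 * a2 * c4 * c5 + a3 * c5\<^sup>2
      = (\<alpha> * \<delta> - \<beta> * \<gamma>)\<^sup>2 * (b1 * b4\<^sup>2 - 2 * b2 * b4 * b5 + b3 * b5\<^sup>2)"
    by (simp add: a1_def a2_def a3_def c4_def c5_def power2_eq_square algebra_simps)
  ultimately show "cubic a = cubic b" by (simp add: b det)
qed

section \<open>Existence and uniqueness of normal forms\<close>

definition normal_forms :: "coeffs set" where
  "normal_forms = {(1, 0, 0, 1, 0, 0), (0, 0, 0, 0, 1, 0), (0, 0, 0, 0, 0, 1)}
     \<union> {(1, 0, 0, 0, 0, \<delta>) | \<delta>. \<delta> \<in> {-1, 0, 1}}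
     \<union> {(0, 1, 0, 0, 0, \<mu>) | \<mu>. \<mu> \<ge> 0} \<union> {(1, 0, 1, 0, 0, \<nu>) | \<nu>. True}"

lemma normal_formsI:
  "(1, 0, 0, 1, 0, 0) \<in> normal_forms" "(0, 0, 0, 0, 1, 0) \<in> normal_forms" "(0, 0, 0, 0, 0, 1) \<in> normal_forms"
  "\<delta> \<in> {-1, 0, 1} \<Longrightarrow> (1, 0, 0, 0, 0, \<delta>) \<in> normal_forms"
  "\<mu> \<ge> 0 \<Longrightarrow> (0, 1, 0, 0, 0, \<mu>) \<in> normal_forms"
  "(1, 0, 1, 0, 0, \<nu>) \<in> normal_forms"
  by (auto simp: normal_forms_def)

lemma equiv_coeffs_refl: "equiv_coeffs a a"
  by (cases a) (auto intro!: equiv_coeffsI[of 1 1 0 0 _ 0 0] simp: Let_def)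

text \<open>The shift acts on \<open>(a4, a5)\<close> through a linear system in \<open>l0\<close>,
  \<open>l1\<close> whose determinant is \<open>a2\<^sup>2 - a1 * a3\<close>. If this is nonzero,
  the Heisenberg part can be removed, and only a matrix bringing \<open>tau\<close> to normal form
  remains to be found.\<close>

lemma normal_form_nondegenerate:
  assumes det: "\<alpha> * \<delta> - \<beta> * \<gamma> = 1" and "c \<noteq> 0" and nz: "a2\<^sup>2 - a1 * a3 \<noteq> 0"
    and a: "a1 = c * (b1 * \<delta>\<^sup>2 + 2 * b2 * \<beta> * \<delta> + b3 * \<beta>\<^sup>2)"
      "a2 = c * (b1 * \<gamma> * \<delta> + b2 * (\<alpha> * \<delta> + \<beta> * \<gamma>) + b3 * \<alpha> * \<beta>)"
      "a3 = c * (b1 * \<gamma>\<^sup>2 + 2 * b2 * \<alpha> * \<gamma> + b3 * \<alpha>\<^sup>2)"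
  obtains m where "equiv_coeffs (a1, a2, a3, a4, a5, a6) (c *\<^sub>R (b1, b2, b3, 0, 0, m))"
proof -
  define D where "D = a2\<^sup>2 - a1 * a3"
  \<comment> \<open>Cramer's rule for \<open>a4 = l0 * a3 - l1 * a2\<close> and
    \<open>a5 = l0 * a2 - l1 * a1\<close>.\<close>
  define l0 where "l0 = (a5 * a2 - a4 * a1) / D"
  define l1 where "l1 = (a5 * a3 - a4 * a2) / D"
  have D: "D \<noteq> 0" using nz by (simp add: D_def)
  have "l0 * a3 - l1 * a2 = a4 * D / D" "l0 * a2 - l1 * a1 = a5 * D / D"
    unfolding l0_def l1_def diff_divide_distrib[symmetric] times_divide_eq_left
    by (rule arg_cong[of _ _ "\<lambda>x. x / D"], simp add: D_def power2_eq_square algebra_simps)+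
  then have l: "a4 = l0 * a3 - l1 * a2" "a5 = l0 * a2 - l1 * a1" using D by simp_all
  define m where "m = (a6 + a3 * l0\<^sup>2 / 4 - a2 * l0 * l1 / 2 + a1 * l1\<^sup>2 / 4) / c"
  have A: "c * b1 * \<delta>\<^sup>2 + 2 * (c * b2) * \<beta> * \<delta> + c * b3 * \<beta>\<^sup>2 = a1"
    "c * b1 * \<gamma> * \<delta> + c * b2 * (\<alpha> * \<delta> + \<beta> * \<gamma>) + c * b3 * \<alpha> * \<beta> = a2"
    "c * b1 * \<gamma>\<^sup>2 + 2 * (c * b2) * \<alpha> * \<gamma> + c * b3 * \<alpha>\<^sup>2 = a3"
    by (simp_all add: a algebra_simps)
  have "(a1, a2, a3, a4, a5, a6) = pull_coeffs \<alpha> \<beta> \<gamma> \<delta> l1 l0 (c * b1, c * b2, c * b3, 0, 0, c * m)"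
    unfolding pull_coeffs.simps Let_def A using \<open>c \<noteq> 0\<close> by (simp add: l m_def)
  then show ?thesis using that[of m] equiv_coeffsI[OF det] by simp
qed

text \<open>This factors \<open>tau\<close> as
  \<open>2 * c * (\<alpha> * t + \<beta>) * (\<gamma> * t + \<delta>)\<close>; for a unimodular pair
  of linear forms, the product has \<open>discr\<close> equal to \<open>c\<^sup>2\<close>.\<close>

lemma hyperbolic_factorization:
  assumes "a2\<^sup>2 - a1 * a3 = c\<^sup>2" "c \<noteq> (0::real)"
  obtains \<alpha> \<beta> \<gamma> \<delta> where "\<alpha> * \<delta> - \<beta> * \<gamma> = 1" "a1 = c * (2 * \<beta> * \<delta>)" "a2 = c * (\<alpha> * \<delta> + \<beta> * \<gamma>)" "a3 = c * (2 * \<alpha> * \<gamma>)"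
proof (cases "a3 = 0")
  case False
  have a1: "a1 = (a2\<^sup>2 - c\<^sup>2) / a3" using assms(1) False by (simp add: field_simps)
  show ?thesis
    \<comment> \<open>Linear factors for the two roots \<open>(- a2 \<plusminus> c) / a3\<close>;
      the arguments stand for \<alpha>, \<delta>, \<beta>, \<gamma>, in the order of first
      occurrence.\<close>
    by (rule that[of "a3 / (2 * c)" "(a2 + c) / a3" "(a2 - c) / (2 * c)" 1]; (subst a1)?)
      (use False assms(2) in \<open>simp_all add: field_simps power2_eq_square\<close>)
next
  case True
  then have "a2 = c \<or> a2 = - c" using assms(1) by (simp add: power2_eq_iff)
  then show ?thesis
    using that[of 1 1 "a1 / (2 * c)" 0] that[of 0 "a1 / (2 * c)" 1 "-1"] True assms(2) by auto
qed

lemma normal_form_exists_hyperbolic: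
  assumes "a2\<^sup>2 - a1 * a3 > 0"
  obtains c b where "c \<noteq> 0" "b \<in> normal_forms" "equiv_coeffs (a1, a2, a3, a4, a5, a6) (c *\<^sub>R b)"
proof -
  \<comment> \<open>\<open>c\<close> is fixed up to sign by \<open>discr\<close>. Since
    \<open>cubic\<close> will equal \<open>4 * c ^ 3 * m\<close>, giving \<open>c\<close> the sign
    of \<open>cubic\<close> makes the coefficient \<open>m\<close> of \<open>vI\<close>
    nonnegative.\<close>
  define c where "c = (if cubic (a1, a2, a3, a4, a5, a6) \<ge> 0 then 1 else -1) * sqrt (a2\<^sup>2 - a1 * a3)"
  have c: "c\<^sup>2 = a2\<^sup>2 - a1 * a3" "c \<noteq> 0"
    using assms by (auto simp: c_def power_mult_distrib)
  obtain \<alpha> \<beta> \<gamma> \<delta> where det: "\<alpha> * \<delta> - \<beta> * \<gamma> = 1"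
    and A: "a1 = c * (2 * \<beta> * \<delta>)" "a2 = c * (\<alpha> * \<delta> + \<beta> * \<gamma>)" "a3 = c * (2 * \<alpha> * \<gamma>)"
    using hyperbolic_factorization[OF c(1)[symmetric] c(2)] .
  obtain m where m: "equiv_coeffs (a1, a2, a3, a4, a5, a6) (c *\<^sub>R (0, 1, 0, 0, 0, m))"
  proof (rule normal_form_nondegenerate[OF det c(2), of a2 a1 a3 0 1 0 a4 a5 a6])
    show "a2\<^sup>2 - a1 * a3 \<noteq> 0" using assms by simp
  qed (simp_all add: A algebra_simps)
  from equiv_coeffs_invariants(2)[OF m]
  have cub: "cubic (a1, a2, a3, a4, a5, a6) = 4 * c ^ 3 * m"
    by (simp add: eval_nat_numeral)
  have "m \<ge> 0"
  proof (cases "cubic (a1, a2, a3, a4, a5, a6) \<ge> 0")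
    case True
    then have "c > 0" using assms by (simp add: c_def)
    moreover have "0 \<le> 4 * c ^ 3 * m" using True unfolding cub .
    ultimately show ?thesis by (simp add: zero_le_mult_iff)
  next
    case False
    then have "c < 0" using assms by (simp add: c_def)
    then have "c ^ 3 < 0" by (simp add: odd_power_less_zero)
    moreover have "4 * c ^ 3 * m < 0" using False unfolding cub by simp
    ultimately show ?thesis by (simp add: mult_less_0_iff)
  qed
  with that[OF c(2) normal_formsI(5) m] show ?thesis .
qed

lemma normal_form_exists_elliptic:
  assumes "a2\<^sup>2 - a1 * a3 < 0"
  obtains c b where "c \<noteq> 0" "b \<in> normal_forms" "equiv_coeffs (a1, a2, a3, a4, a5, a6) (c *\<^sub>R b)"
proof -
  have "a1 * a3 > 0" using assms by (smt (verit) zero_le_power2)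
  then have a3: "a3 \<noteq> 0" by auto
  \<comment> \<open>\<open>tau\<close> is definite here, and \<open>c\<close> has to carry its
    sign.\<close>
  define c where "c = sgn a3 * sqrt (a1 * a3 - a2\<^sup>2)"
  have c: "c\<^sup>2 = a1 * a3 - a2\<^sup>2" "c \<noteq> 0"
    using assms a3 by (auto simp: c_def power_mult_distrib sgn_if)
  have pos: "a3 / c > 0" using assms a3 by (auto simp: c_def sgn_if zero_less_divide_iff)
  \<comment> \<open>Completing the square: \<open>tau / c\<close> is the sum of the squares of
    \<open>\<alpha> * t + a2 / (c * \<alpha>)\<close> and \<open>1 / \<alpha>\<close>, which become
    the rows of a triangular matrix.\<close>
  define \<alpha> where "\<alpha> = sqrt (a3 / c)"
  have \<alpha>: "\<alpha> > 0" "\<alpha>\<^sup>2 = a3 / c" using pos by (simp_all add: \<alpha>_def)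
  have "a1 = (c\<^sup>2 + a2\<^sup>2) / a3" using c(1) a3 by (simp add: field_simps)
  also have "\<dots> = c * ((1 / \<alpha>)\<^sup>2 + (a2 / (c * \<alpha>))\<^sup>2)"
    unfolding power_divide power_mult_distrib \<alpha>(2) using c(2) a3 by (simp add: field_simps power2_eq_square)
  finally have a1: "a1 = c * (1 * (1 / \<alpha>)\<^sup>2 + 2 * 0 * (a2 / (c * \<alpha>)) * (1 / \<alpha>) + 1 * (a2 / (c * \<alpha>))\<^sup>2)" by simp
  obtain m where "equiv_coeffs (a1, a2, a3, a4, a5, a6) (c *\<^sub>R (1, 0, 1, 0, 0, m))"
  proof (rule normal_form_nondegenerate[OF _ c(2) _ a1])
    show "\<alpha> * (1 / \<alpha>) - a2 / (c * \<alpha>) * 0 = 1" "a2\<^sup>2 - a1 * a3 \<noteq> 0" using \<alpha>(1) assms by simp_all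
    show "a2 = c * (1 * 0 * (1 / \<alpha>) + 0 * (\<alpha> * (1 / \<alpha>) + a2 / (c * \<alpha>) * 0) + 1 * \<alpha> * (a2 / (c * \<alpha>)))"
      using \<alpha>(1) c(2) by simp
    show "a3 = c * (1 * 0\<^sup>2 + 2 * 0 * \<alpha> * 0 + 1 * \<alpha>\<^sup>2)" using \<alpha>(2) c(2) by simp
  qed
  with that[OF c(2) normal_formsI(6)] show ?thesis .
qed

text \<open>\<open>tau\<close> is constant. The shift by \<open>l1\<close> removes
  \<open>a5\<close>. If \<open>a4\<close> is nonzero, the shift by \<open>l0\<close> removes the
  coefficient of \<open>vI\<close>; otherwise that coefficient is only rescaled.\<close>

lemma normal_form_exists_parabolic_aux:
  assumes "c \<noteq> 0"
  obtains c' b where "c' \<noteq> 0" "b \<in> normal_forms" "equiv_coeffs (c, 0, 0, a4, a5, a6) (c' *\<^sub>R b)"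
proof -
  \<comment> \<open>What becomes of \<open>a6\<close> under the shift with
    \<open>l1 = - a5 / c\<close>.\<close>
  define m where "m = a6 + a5\<^sup>2 / (4 * c)"
  have 1: "equiv_coeffs (c, 0, 0, a4, a5, a6) (c, 0, 0, a4, 0, m)"
    by (rule equiv_coeffsI[of 1 1 0 0 _ "- a5 / c" 0])
      (use assms in \<open>simp_all add: Let_def m_def power2_eq_square\<close>)
  consider "a4 \<noteq> 0" | "a4 = 0" "m = 0" | "a4 = 0" "m \<noteq> 0" by blast
  then show ?thesis
  proof cases
    case 1
    define \<alpha> where "\<alpha> = root 3 (a4 / c)"
    \<comment> \<open>The diagonal matrix with entries \<open>\<alpha>\<close> and
      \<open>1 / \<alpha>\<close> multiplies the ratio of the fourth to the first coefficient by
      \<open>\<alpha> ^ 3\<close>, so a real cube root produces any ratio from the ratio 1.\<close>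
    have \<alpha>: "\<alpha> ^ 3 = a4 / c" by (simp add: \<alpha>_def odd_real_root_pow)
    then have \<alpha>0: "\<alpha> \<noteq> 0" using 1 assms by auto
    have "equiv_coeffs (c, 0, 0, a4, 0, m) (c, 0, 0, a4, 0, 0)"
      by (rule equiv_coeffsI[of 1 1 0 0 _ 0 "- 2 * m / a4"]) (use 1 in \<open>simp_all add: Let_def\<close>)
    moreover have "equiv_coeffs (c, 0, 0, a4, 0, 0) ((a4 / \<alpha>) *\<^sub>R (1, 0, 0, 1, 0, 0))"
    proof (rule equiv_coeffsI[of \<alpha> "1 / \<alpha>" 0 0 _ 0 0])
      have "c = a4 / \<alpha> * (1 / \<alpha>)\<^sup>2"
        using \<alpha> \<alpha>0 assms by (simp add: field_simps eval_nat_numeral)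
      then show "(c, 0, 0, a4, 0, 0) = pull_coeffs \<alpha> 0 0 (1 / \<alpha>) 0 0 ((a4 / \<alpha>) *\<^sub>R (1, 0, 0, 1, 0, 0))"
        using \<alpha>0 by (simp add: Let_def)
    qed (use \<alpha>0 in simp)
    ultimately have "equiv_coeffs (c, 0, 0, a4, a5, a6) ((a4 / \<alpha>) *\<^sub>R (1, 0, 0, 1, 0, 0))"
      using \<open>equiv_coeffs (c, 0, 0, a4, a5, a6) (c, 0, 0, a4, 0, m)\<close> equiv_coeffs_trans by blast
    then show ?thesis using that[OF _ normal_formsI(1), of "a4 / \<alpha>"] 1 \<alpha>0 by simp
  next
    case 2
    then show ?thesis using that[OF assms normal_formsI(4)[of 0]] 1 by simp
  next
    case 3
    \<comment> \<open>A square scales the first coefficient, so \<open>c'\<close> must have the sign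
      of \<open>c\<close>; its size makes \<open>m / c'\<close> a sign.\<close>
    define c' where "c' = sgn c * \<bar>m\<bar>"
    have "c / c' = \<bar>c\<bar> / \<bar>m\<bar>" by (simp add: c'_def sgn_if)
    then have c': "c' \<noteq> 0" "c / c' > 0" "m / c' \<in> {-1, 0, 1}" "\<bar>c'\<bar> = \<bar>m\<bar>"
      using assms 3 by (auto simp: c'_def sgn_if)
    have "equiv_coeffs (c, 0, 0, a4, 0, m) (c' *\<^sub>R (1, 0, 0, 0, 0, m / c'))"
      by (rule equiv_coeffsI[of "1 / sqrt (c / c')" "sqrt (c / c')" 0 0 _ 0 0])
        (use 3 c' assms in \<open>simp_all add: Let_def\<close>)
    with 1 have "equiv_coeffs (c, 0, 0, a4, a5, a6) (c' *\<^sub>R (1, 0, 0, 0, 0, m / c'))"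
      by (rule equiv_coeffs_trans)
    with that[OF c'(1) normal_formsI(4)[OF c'(3)]] show ?thesis .
  qed
qed

lemma normal_form_exists_parabolic:
  assumes "a2\<^sup>2 - a1 * a3 = 0" "(a1, a2, a3) \<noteq> (0, 0, 0)"
  obtains c b where "c \<noteq> 0" "b \<in> normal_forms" "equiv_coeffs (a1, a2, a3, a4, a5, a6) (c *\<^sub>R b)"
proof (cases "a3 = 0")
  case True
  then have "a2 = 0" "a1 \<noteq> 0" using assms by auto
  with True that show ?thesis using normal_form_exists_parabolic_aux[of a1 a4 a5 a6] by blast
next
  case False
  have "a1 = a2\<^sup>2 / a3" using assms(1) False by (simp add: field_simps)
  \<comment> \<open>As \<open>tau\<close> is a3 (t + a2 / a3)^2, this matrix moves its double root
    to infinity, and \<open>tau\<close> becomes the constant \<open>a3\<close>.\<close>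
  then have 1: "equiv_coeffs (a1, a2, a3, a4, a5, a6) (a3, 0, 0, a2 / a3 * a4 - a5, a4, a6)"
    by (intro equiv_coeffsI[of 0 "a2 / a3" "-1" 1 _ 0 0])
      (use False in \<open>simp_all add: Let_def power2_eq_square\<close>)
  obtain c b where "c \<noteq> 0" "b \<in> normal_forms" "equiv_coeffs (a3, 0, 0, a2 / a3 * a4 - a5, a4, a6) (c *\<^sub>R b)"
    using normal_form_exists_parabolic_aux[OF False] .
  with that equiv_coeffs_trans[OF 1] show ?thesis by blast
qed

lemma normal_form_exists:
  assumes "a \<noteq> 0"
  obtains c b where "c \<noteq> 0" "b \<in> normal_forms" "equiv_coeffs a (c *\<^sub>R b)"
proof -
  obtain a1 a2 a3 a4 a5 a6 where a: "a = (a1, a2, a3, a4, a5, a6)" by (cases a)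
  consider "a2\<^sup>2 - a1 * a3 > 0" | "a2\<^sup>2 - a1 * a3 < 0" | "a2\<^sup>2 - a1 * a3 = 0" "(a1, a2, a3) \<noteq> (0, 0, 0)"
    | "a1 = 0" "a2 = 0" "a3 = 0" "a4 \<noteq> 0 \<or> a5 \<noteq> 0" | "a1 = 0" "a2 = 0" "a3 = 0" "a4 = 0" "a5 = 0"
    by fastforce
  then show ?thesis
  proof cases
    case 1
    then show ?thesis using normal_form_exists_hyperbolic that unfolding a by blast
  next
    case 2
    then show ?thesis using normal_form_exists_elliptic that unfolding a by blast
  next
    case 3
    then show ?thesis using normal_form_exists_parabolic that unfolding a by blast
  next
    case 4
    \<comment> \<open>\<open>(a4, a5)\<close> is the lower row of the matrix, and the orthogonal
      vector \<open>(a5, - a4)\<close> divided by \<open>q\<close> is the upper row, for determinant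
      1. The shift \<open>(l1, l0)\<close> is \<open>2 * a6\<close> times the upper row, which
      produces \<open>a6\<close>.\<close>
    define q where "q = a4\<^sup>2 + a5\<^sup>2"
    have q: "q \<noteq> 0" using 4(4) by (simp add: q_def sum_power2_eq_zero_iff)
    have "equiv_coeffs a (1 *\<^sub>R (0, 0, 0, 0, 1, 0))"
    proof (rule equiv_coeffsI)
      have "a5 / q * a5 - - a4 / q * a4 = (a4\<^sup>2 + a5\<^sup>2) / q"
        by (simp add: power2_eq_square add_divide_distrib)
      then show "a5 / q * a5 - - a4 / q * a4 = 1" using q by (simp add: q_def)
      have "a6 = a6 * (a4\<^sup>2 + a5\<^sup>2) / q" using q by (simp add: q_def)
      then have "a6 = - a4 * (- 2 * a6 * a4 / q) / 2 + a5 * (2 * a6 * a5 / q) / 2"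
        by (simp add: power2_eq_square add_divide_distrib algebra_simps)
      then show "a = pull_coeffs (a5 / q) (- a4 / q) a4 a5 (2 * a6 * a5 / q) (- 2 * a6 * a4 / q) (1 *\<^sub>R (0, 0, 0, 0, 1, 0))"
        using 4 by (simp add: a Let_def)
    qed
    then show ?thesis using that[OF _ normal_formsI(2), of 1] by simp
  next
    case 5
    then have "a = a6 *\<^sub>R (0, 0, 0, 0, 0, 1)" "a6 \<noteq> 0" using assms by (auto simp: a zero_prod_def)
    then show ?thesis using that[OF _ normal_formsI(3)] equiv_coeffs_refl[of a] by metis
  qed
qed

text \<open>The sign of \<open>discr\<close> separates \<open>vD\<close>, \<open>vP_t + vK\<close>
  and the rest. In the rest, \<open>cubic\<close> vanishes except for \<open>vP_t + vG_x\<close>,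
  and the remaining types differ in which coefficients can vanish. Within a type, the possible
  values of \<open>c\<close> decide.\<close>

lemma normal_forms_inequivalent:
  assumes "a \<in> normal_forms" and "b \<in> normal_forms" and "c \<noteq> 0" and eq: "equiv_coeffs a (c *\<^sub>R b)"
  shows "a = b"
proof -
  obtain b1 b2 b3 b4 b5 b6 where b': "b = (b1, b2, b3, b4, b5, b6)" by (cases b)
  obtain \<alpha> \<beta> \<gamma> \<delta> l1 l0 where det: "\<alpha> * \<delta> - \<beta> * \<gamma> = 1" and pull: "a = pull_coeffs \<alpha> \<beta> \<gamma> \<delta> l1 l0 (c *\<^sub>R b)"
    using eq unfolding equiv_coeffs_def by blast
  have nz: "\<not> (\<gamma> = 0 \<and> \<delta> = 0)" using det by auto
  have disc: "discr a = c\<^sup>2 * discr b"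
    using equiv_coeffs_invariants(1)[OF eq] by (simp add: b' power2_eq_square algebra_simps)
  then have sgn: "sgn (discr a) = sgn (discr b)" using \<open>c \<noteq> 0\<close> by (simp add: sgn_if mult_less_0_iff zero_less_mult_iff)
  have cub: "cubic a = c ^ 3 * cubic b"
    using equiv_coeffs_invariants(2)[OF eq] by (simp add: b' eval_nat_numeral algebra_simps)
  from assms(1) consider (PG) "a = (1, 0, 0, 1, 0, 0)" | (Px) "a = (0, 0, 0, 0, 1, 0)" | (I) "a = (0, 0, 0, 0, 0, 1)"
    | (P) d where "a = (1, 0, 0, 0, 0, d)" "d \<in> {-1, 0, 1}" | (D) m where "a = (0, 1, 0, 0, 0, m)" "m \<ge> 0"
    | (K) n where "a = (1, 0, 1, 0, 0, n)" by (auto simp: normal_forms_def)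
  note a_cases = this
  from assms(2) consider (PG) "b = (1, 0, 0, 1, 0, 0)" | (Px) "b = (0, 0, 0, 0, 1, 0)" | (I) "b = (0, 0, 0, 0, 0, 1)"
    | (P) d where "b = (1, 0, 0, 0, 0, d)" "d \<in> {-1, 0, 1}" | (D) m where "b = (0, 1, 0, 0, 0, m)" "m \<ge> 0"
    | (K) n where "b = (1, 0, 1, 0, 0, n)" by (auto simp: normal_forms_def)
  note b_cases = this
  show ?thesis
  proof (cases rule: a_cases)
    case PG
    show ?thesis
      by (cases rule: b_cases) (use PG disc cub \<open>c \<noteq> 0\<close> in auto)
  next
    case Px
    show ?thesis
      by (cases rule: b_cases) (use Px disc cub pull nz \<open>c \<noteq> 0\<close> in \<open>auto simp: Let_def\<close>)
  next
    case I
    show ?thesis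
      by (cases rule: b_cases) (use I disc cub pull nz \<open>c \<noteq> 0\<close> in \<open>auto simp: Let_def\<close>)
  next
    case (P d)
    note a = this
    show ?thesis
    proof (cases rule: b_cases)
      case (P d')
      \<comment> \<open>The first coefficient is scaled by \<open>c\<close> times a square, so
        \<open>c\<close> is positive and cannot change the sign of \<open>d\<close>.\<close>
      have "c * \<delta>\<^sup>2 = 1" "\<gamma> = 0" "l1 = 0" "d = c * d'"
        using pull a(1) P(1) \<open>c \<noteq> 0\<close> nz by (auto simp: Let_def)
      moreover from this have "c > 0" using zero_less_mult_iff[of c "\<delta>\<^sup>2"] by simp
      ultimately show ?thesis using a P by auto
    qed (use a disc cub pull nz \<open>c \<noteq> 0\<close> in \<open>auto simp: Let_def\<close>)
  next
    case (D m)
    note a = this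
    show ?thesis
    proof (cases rule: b_cases)
      case (D m')
      \<comment> \<open>\<open>c = -1\<close> is not excluded here and would give
        \<open>m = - m'\<close>; as both are nonnegative, they agree anyway.\<close>
      have "c\<^sup>2 = 1" "m = c ^ 3 * m'" using disc cub a D by auto
      then have "m = m' \<or> m = - m'" by (auto simp: power2_eq_1_iff)
      then show ?thesis using a D by auto
    qed (use a sgn in simp_all)
  next
    case (K n)
    note a = this
    show ?thesis
    proof (cases rule: b_cases)
      case (K n')
      have "c\<^sup>2 = 1" "n = c ^ 3 * n'" using disc cub a K by auto
      \<comment> \<open>The first coefficient is \<open>c\<close> times a sum of squares, which
        excludes \<open>c = -1\<close>.\<close>
      moreover have "c * \<delta>\<^sup>2 + c * \<beta>\<^sup>2 = 1" using pull a K by (simp add: Let_def)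
      then have "c > 0"
        using zero_less_mult_iff[of c "\<delta>\<^sup>2 + \<beta>\<^sup>2"] sum_power2_ge_zero[of \<delta> \<beta>]
        by (auto simp: distrib_left)
      ultimately have "c = 1" by (simp add: power2_eq_1_iff)
      then show ?thesis using a K \<open>n = _\<close> by simp
    qed (use a sgn in simp_all)
  qed
qed

lemma pull_coeffs_zero: "pull_coeffs \<alpha> \<beta> \<gamma> \<delta> l1 l0 0 = 0"
  by (simp add: zero_prod_def Let_def)

lemma equiv_coeffs_zero_iff:
  assumes "equiv_coeffs a b"
  shows "a = 0 \<longleftrightarrow> b = 0"
proof
  obtain \<alpha> \<beta> \<gamma> \<delta> l1 l0 where det: "\<alpha> * \<delta> - \<beta> * \<gamma> = 1" and a: "a = pull_coeffs \<alpha> \<beta> \<gamma> \<delta> l1 l0 b"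
    using assms unfolding equiv_coeffs_def by blast
  then show "a = 0" if "b = 0" using that by (simp add: pull_coeffs_zero)
  have det': "\<delta> * \<alpha> - (- \<beta>) * (- \<gamma>) = 1" "\<alpha> * \<delta> = 1 + \<beta> * \<gamma>" "\<delta> * \<alpha> = 1 + \<beta> * \<gamma>"
    using det by (simp_all add: algebra_simps)
  \<comment> \<open>The inverse matrix, with the shift that cancels \<open>(l1, l0)\<close> in the
    composition law.\<close>
  have "pull_coeffs \<delta> (- \<beta>) (- \<gamma>) \<alpha> (l0 * \<gamma> - l1 * \<delta>) (l1 * \<beta> - l0 * \<alpha>) a = pull_coeffs 1 0 0 1 0 0 b"
    unfolding a pull_coeffs_pull_coeffs[OF det'(1)] by (simp add: det' algebra_simps)
  also have "\<dots> = b" by (cases b) (simp add: Let_def)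
  finally show "b = 0" if "a = 0" using that by (simp add: pull_coeffs_zero)
qed

section \<open>Vector fields and their pushforwards\<close>

fun alg_field :: "coeffs \<Rightarrow> (real \<times> real \<Rightarrow> real) \<Rightarrow> vfield" where
  "alg_field (a1, a2, a3, a4, a5, a6) f = (\<lambda>p. a1 *\<^sub>R vP_t p + a2 *\<^sub>R vD p + a3 *\<^sub>R vK p
     + a4 *\<^sub>R vG_x p + a5 *\<^sub>R vP_x p + a6 *\<^sub>R vI p + vZ f p)"

lemma alg_field_apply: "alg_field a f (t, x, u) = (tau a t, xi a t x, eta a t x * u + f (t, x))"
  by (cases a) (simp add: vP_t_def vD_def vK_def vG_x_def vP_x_def vI_def vZ_def xi_def field_simps power2_eq_square)

lemma coefficient_scale:
  "tau (c *\<^sub>R a) t = c * tau a t" "xi (c *\<^sub>R a) t x = c * xi a t x" "eta (c *\<^sub>R a) t x = c * eta a t x"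
  by (cases a; simp add: xi_def field_simps)+

lemma alg_field_scale: "c *\<^sub>R alg_field a f p = alg_field (c *\<^sub>R a) (\<lambda>p. c * f p) p"
  by (cases p) (simp add: alg_field_apply coefficient_scale algebra_simps)

lemma heat_algebra_eq: "heat_algebra \<Omega> = {restr \<Omega> (alg_field a f) | a f. heat_solution \<Omega> f}"
  unfolding heat_algebra_def by (auto simp: split_paired_Ex)

lemma mem_cyl: "(t, x, u) \<in> cyl \<Omega> \<longleftrightarrow> (t, x) \<in> \<Omega>"
  by (simp add: cyl_def)

lemma open_cyl: "open \<Omega> \<Longrightarrow> open (cyl \<Omega>)"
proof -
  assume "open \<Omega>"
  moreover have "cyl \<Omega> = (\<lambda>p. (fst p, fst (snd p))) -` \<Omega>" by (auto simp: cyl_def)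
  ultimately show ?thesis by (auto intro!: open_vimage continuous_intros)
qed

lemma has_derivative_base_compose:
  fixes q :: "real \<times> real \<Rightarrow> real"
  assumes "(q has_derivative q') (at (t, x))"
  shows "((\<lambda>p. q (fst p, fst (snd p))) has_derivative (\<lambda>(dt, dx, du). q' (dt, dx))) (at (t, x, u :: real))"
proof -
  have "((\<lambda>p :: real \<times> real \<times> real. (fst p, fst (snd p))) has_derivative (\<lambda>p. (fst p, fst (snd p)))) (at (t, x, u))"
    by (auto intro!: derivative_eq_intros)
  from diff_chain_at[OF this, of q q'] assms show ?thesis
    by (simp add: o_def case_prod_unfold)
qed

lemma alg_field_differentiable:
  assumes f: "smooth_on \<Omega> f" and "(t, x) \<in> \<Omega>"
  shows "alg_field a f differentiable (at (t, x, u))"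
proof -
  have d: "(\<lambda>p :: real \<times> real \<times> real. q (fst p, fst (snd p))) differentiable (at (t, x, u))"
    if "smooth_on S q" "(t, x) \<in> S" for q :: "real \<times> real \<Rightarrow> real" and S
    using has_derivative_base_compose[OF smooth_on_imp_has_derivative[OF that]] by (auto simp: differentiable_def)
  note s = smooth_on_coefficients[OF open_UNIV, of a]
  have "(\<lambda>p. (tau a (fst p), xi a (fst p) (fst (snd p)), eta a (fst p) (fst (snd p)) * snd (snd p) + f (fst p, fst (snd p))))
      differentiable (at (t, x, u))"
    using d[OF s(1)] d[OF s(4)] d[OF s(5)] d[OF assms]
    by (intro differentiable_Pair differentiable_add differentiable_mult) (auto simp: differentiable_def intro!: derivative_eq_intros exI)
  moreover have "alg_field a f = (\<lambda>p. (tau a (fst p), xi a (fst p) (fst (snd p)),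
      eta a (fst p) (fst (snd p)) * snd (snd p) + f (fst p, fst (snd p))))"
    by (auto simp: alg_field_apply)
  ultimately show ?thesis by simp
qed

lemma restr_apply: "p \<in> cyl \<Omega> \<Longrightarrow> restr \<Omega> X p = X p" "p \<notin> cyl \<Omega> \<Longrightarrow> restr \<Omega> X p = 0"
  by (simp_all add: restr_def)

lemma restr_restr: "U \<subseteq> \<Omega> \<Longrightarrow> restr U (restr \<Omega> X) = restr U X"
  by (auto simp: restr_def cyl_def fun_eq_iff)

section \<open>Lines of vector fields\<close>

lemma line_restr: "line \<Omega> (restr \<Omega> X) = line \<Omega> X"
proof -
  have "restr \<Omega> (\<lambda>p. c *\<^sub>R restr \<Omega> X p) = restr \<Omega> (\<lambda>p. c *\<^sub>R X p)" for c by (auto simp: restr_def)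
  then show ?thesis by (simp add: line_def)
qed

lemma restr_image_line: "U \<subseteq> \<Omega> \<Longrightarrow> restr U ` line \<Omega> X = line U X"
  unfolding line_def using restr_restr by (auto simp: image_iff) (metis restr_restr)

text \<open>Together with \<open>nonzero_if_inj_on_restr_line\<close>, this turns the nondegeneracy
  demanded in \<open>G_equivalent\<close> into the existence of a point over \<open>U\<close> where
  the generator is nonzero.\<close>

lemma inj_on_restr_line:
  assumes "p \<in> cyl U" "U \<subseteq> \<Omega>" "X p \<noteq> 0"
  shows "inj_on (restr U) (line \<Omega> X)"
proof (rule inj_onI)
  fix A B assume "A \<in> line \<Omega> X" "B \<in> line \<Omega> X" and eq: "restr U A = restr U B"
  then obtain c d where AB: "A = restr \<Omega> (\<lambda>p. c *\<^sub>R X p)" "B = restr \<Omega> (\<lambda>p. d *\<^sub>R X p)"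
    by (auto simp: line_def)
  from fun_cong[OF eq, of p] have "c *\<^sub>R X p = d *\<^sub>R X p"
    unfolding AB restr_restr[OF assms(2)] by (simp add: restr_apply assms(1))
  with assms(3) AB show "A = B" by simp
qed

lemma nonzero_if_inj_on_restr_line:
  assumes "inj_on (restr U) (line \<Omega> X)" "U \<subseteq> \<Omega>" "line \<Omega> X \<noteq> {\<lambda>p. 0}"
  obtains p where "p \<in> cyl U" "X p \<noteq> 0"
proof (rule ccontr)
  assume n: "\<not> thesis"
  note T = that
  have *: "X p = 0" if "p \<in> cyl U" for p using T[OF that] n by blast
  have "restr U A = (\<lambda>p. 0)" if A: "A \<in> line \<Omega> X" for A
  proof -
    obtain c where "A = restr \<Omega> (\<lambda>p. c *\<^sub>R X p)" using A by (auto simp: line_def)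
    then have "restr U A = restr U (\<lambda>p. c *\<^sub>R X p)" using restr_restr[OF assms(2)] by simp
    also have "\<dots> = (\<lambda>p. 0)" using * by (auto simp: restr_def fun_eq_iff)
    finally show ?thesis .
  qed
  moreover have 0: "(\<lambda>p. 0) \<in> line \<Omega> X"
    unfolding line_def by (auto simp: restr_def intro!: exI[of _ 0])
  ultimately have "line \<Omega> X \<subseteq> {\<lambda>p. 0}" using inj_onD[OF assms(1)] by (metis singletonI subsetI)
  with 0 assms(3) show False by blast
qed

lemma line_one_dim_subalgebra:
  assumes f: "heat_solution \<Omega> f" and p: "p \<in> cyl \<Omega>" "alg_field a f p \<noteq> 0"
  shows "(\<Omega>, line \<Omega> (alg_field a f)) \<in> one_dim_subalgebras"
proof -
  define X where "X = alg_field a f"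
  define R where "R = (\<lambda>c. restr \<Omega> (\<lambda>p. c *\<^sub>R X p))"
  have line: "line \<Omega> X = range R" by (auto simp: line_def R_def)
  have \<Omega>: "open \<Omega>" using f by (simp add: heat_solution_def)
  have D: "X differentiable (at q)" if "q \<in> cyl \<Omega>" for q
    using alg_field_differentiable[of \<Omega> f] f that
    by (cases q) (auto simp: X_def heat_solution_def mem_cyl)
  have fd: "frechet_derivative (R c) (at q) = (\<lambda>v. c *\<^sub>R frechet_derivative X (at q) v)" if "q \<in> cyl \<Omega>" for q c
  proof -
    have "((\<lambda>p. c *\<^sub>R X p) has_derivative (\<lambda>v. c *\<^sub>R frechet_derivative X (at q) v)) (at q)"
      using D[OF that] by (intro has_derivative_scaleR_right) (simp add: frechet_derivative_works)
    then have "(R c has_derivative (\<lambda>v. c *\<^sub>R frechet_derivative X (at q) v)) (at q)"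
      by (rule has_derivative_transform_within_open[OF _ open_cyl[OF \<Omega>] that]) (simp add: R_def restr_def)
    then show ?thesis using frechet_derivative_at by metis
  qed
  have R: "(\<lambda>p. 0) = R 0" "(\<lambda>p. R c p + R d p) = R (c + d)" "(\<lambda>p. d *\<^sub>R R c p) = R (d * c)" for c d
    by (auto simp: R_def restr_def scaleR_left_distrib)
  have bracket: "restr \<Omega> (lie_bracket (R c) (R d)) = R 0" for c d
  proof
    fix q
    show "restr \<Omega> (lie_bracket (R c) (R d)) q = R 0 q"
    proof (cases "q \<in> cyl \<Omega>")
      case True
      interpret linear "frechet_derivative X (at q)"
        using D[OF True] frechet_derivative_works has_derivative_linear by blast
      show ?thesis
        using True by (simp add: restr_apply lie_bracket_def fd) (simp add: R_def restr_apply scale mult.commute)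
    qed (simp add: restr_apply R_def)
  qed
  have "R c \<in> heat_algebra \<Omega>" for c
    unfolding heat_algebra_eq R_def X_def alg_field_scale using heat_solution_scale[OF f] by blast
  then have "lie_subalgebra \<Omega> (range R)"
    unfolding lie_subalgebra_def using R(1) bracket by (auto simp: R(2,3))
  moreover have "R 1 \<noteq> (\<lambda>p. 0)"
    using p by (auto simp: R_def restr_def X_def dest!: fun_cong[of _ _ p])
  moreover have "range R = line \<Omega> (R 1)"
    using line_restr[of \<Omega> X] line by (simp add: R_def)
  moreover have "\<Omega> \<noteq> {}" using p(1) by (auto simp: cyl_def)
  ultimately show ?thesis
    unfolding one_dim_subalgebras_def X_def[symmetric] line using \<Omega> by blast
qed

lemma one_dim_subalgebra_cases:
  assumes "(\<Omega>, S) \<in> one_dim_subalgebras"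
  obtains a f p where "heat_solution \<Omega> f" "S = line \<Omega> (alg_field a f)" "p \<in> cyl \<Omega>" "alg_field a f p \<noteq> 0"
proof -
  obtain X where X: "X \<in> S" "X \<noteq> (\<lambda>p. 0)" "S = line \<Omega> X" "S \<subseteq> heat_algebra \<Omega>"
    using assms by (auto simp: one_dim_subalgebras_def lie_subalgebra_def)
  then obtain a f where af: "heat_solution \<Omega> f" "X = restr \<Omega> (alg_field a f)"
    unfolding heat_algebra_eq by blast
  then obtain p where "restr \<Omega> (alg_field a f) p \<noteq> 0" using X(2) by fastforce
  then have "p \<in> cyl \<Omega>" "alg_field a f p \<noteq> 0" by (auto simp: restr_def split: if_splits)
  then show ?thesis using that[OF af(1)] X(3) af(2) line_restr by metis
qed

lemma coeffs_eq_zeroI: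
  assumes "open U" "U \<noteq> {}" "\<And>t x. (t, x) \<in> U \<Longrightarrow> tau a t = 0 \<and> xi a t x = 0 \<and> eta a t x = 0"
  shows "a = 0"
proof (rule ccontr)
  assume "a \<noteq> 0"
  \<comment> \<open>otherwise the equation \<open>0 = - 1\<close> would have a solution\<close>
  have "heat_solution U (\<lambda>p. 1)"
    by (rule heat_solutionI[where A = "\<lambda>p. 0" and m = "\<lambda>p. 0"]) (auto intro: assms(1) smooth_on_const)
  then obtain V h where "V \<noteq> {}" "V \<subseteq> U" and
    eq: "\<And>t x. (t, x) \<in> V \<Longrightarrow> tau a t * d_t h (t, x) + xi a t x * d_x h (t, x) - eta a t x * h (t, x) = - 1"
    using determining_equation_solvable[OF _ assms(2) \<open>a \<noteq> 0\<close>, of "\<lambda>p. 1"] by metis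
  then obtain t x where "(t, x) \<in> V" "(t, x) \<in> U" by fast
  with eq[of t x] assms(3)[of t x] show False by simp
qed

lemma alg_field_nonzero:
  assumes "open U" "U \<noteq> {}" "a \<noteq> 0"
  obtains p where "p \<in> cyl U" "alg_field a f p \<noteq> 0"
proof (rule ccontr)
  assume "\<not> thesis"
  then have *: "alg_field a f (t, x, u) = 0" if "(t, x) \<in> U" for t x u
    using that mem_cyl \<open>\<And>p. p \<in> cyl U \<Longrightarrow> alg_field a f p \<noteq> 0 \<Longrightarrow> thesis\<close> by blast
  \<comment> \<open>The values 0 and 1 of \<open>u\<close> separate \<open>eta\<close> from
    \<open>f\<close>.\<close>
  have "tau a t = 0 \<and> xi a t x = 0 \<and> eta a t x = 0" if "(t, x) \<in> U" for t x
    using *[OF that, of 0] *[OF that, of 1] by (simp add: alg_field_apply zero_prod_def)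
  from coeffs_eq_zeroI[OF assms(1,2) this] assms(3) show False by blast
qed

section \<open>The transformations and their action on fields\<close>

locale heat_map =
  fixes \<alpha> \<beta> \<gamma> \<delta> l1 l0 \<sigma> :: real
  assumes det: "\<alpha> * \<delta> - \<beta> * \<gamma> = 1" and \<sigma>: "\<sigma> \<noteq> 0"
begin

definition "denom t = \<gamma> * t + \<delta>"
definition "numer t = \<alpha> * t + \<beta>"
definition "shift t x = x + l1 * t + l0"
definition "regular = {(t :: real, x :: real). \<gamma> * t + \<delta> \<noteq> 0}"
definition "base p = (numer (fst p) / denom (fst p), shift (fst p) (snd p) / denom (fst p))"
definition "factor p = \<sigma> * sqrt \<bar>denom (fst p)\<bar> * exp (\<gamma> * (shift (fst p) (snd p))\<^sup>2 / (4 * denom (fst p))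
  - l1 / 2 * snd p - l1\<^sup>2 / 4 * fst p)"

abbreviation "\<Phi> h \<equiv> heat_trans \<alpha> \<beta> \<gamma> \<delta> l1 l0 \<sigma> h"

lemma mem_regular: "(t, x) \<in> regular \<longleftrightarrow> denom t \<noteq> 0"
  by (simp add: regular_def denom_def)

lemma \<Phi>_apply: "\<Phi> h (t, x, u) = (fst (base (t, x)), snd (base (t, x)), factor (t, x) * (u + h (t, x)))"
  by (simp add: heat_trans_def base_def factor_def denom_def numer_def shift_def)

lemma factor_nonzero: "p \<in> regular \<Longrightarrow> factor p \<noteq> 0"
  by (cases p) (simp add: factor_def mem_regular \<sigma>)

lemma open_regular: "open regular"
  unfolding regular_def case_prod_unfold by (intro open_Collect_neq continuous_intros)

text \<open>The affine function \<open>denom\<close> cannot vanish both at \<open>t\<close> and at a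
  nearby \<open>t + e\<close>, since then \<gamma> = \<delta> = 0, against the determinant.\<close>

lemma regular_inter_nonempty:
  assumes "open U" "U \<noteq> {}"
  shows "U \<inter> regular \<noteq> {}"
proof -
  obtain t x where "(t, x) \<in> U" using assms(2) by fast
  then obtain e where e: "e > 0" "{t - e..t + e} \<times> {x - e..x + e} \<subseteq> U"
    by (rule open_contains_rectangle[OF assms(1)])
  have "denom t \<noteq> 0 \<or> denom (t + e) \<noteq> 0"
  proof (rule ccontr)
    assume "\<not> ?thesis"
    moreover have "\<gamma> * e = denom (t + e) - denom t" by (simp add: denom_def algebra_simps)
    ultimately have "\<gamma> = 0" "\<delta> = 0" using e by (auto simp: denom_def)
    with det show False by simp
  qed
  moreover have "(t, x) \<in> U" "(t + e, x) \<in> U" using e by (auto simp: subset_iff)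
  ultimately show ?thesis using mem_regular by blast
qed

lemma inj_on_base: "inj_on base regular"
proof (rule inj_onI, clarify)
  fix t x s y assume r: "(t, x) \<in> regular" "(s, y) \<in> regular" and eq: "base (t, x) = base (s, y)"
  then have "numer t * denom s = numer s * denom t"
    by (simp add: base_def mem_regular frac_eq_eq)
  moreover have "numer t * denom s - numer s * denom t = (\<alpha> * \<delta> - \<beta> * \<gamma>) * (t - s)"
    by (simp add: numer_def denom_def algebra_simps)
  ultimately have "t = s" by (simp add: det)
  with eq r show "t = s \<and> x = y" by (simp add: base_def mem_regular shift_def)
qed

text \<open>Continuity and injectivity suffice by invariance of domain, so the inverse
  transformation is never written down.\<close>

lemma open_base_image:
  assumes "open U" "U \<subseteq> regular"
  shows "open (base ` U)"
proof (rule invariance_of_domain)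
  show "continuous_on U base"
    unfolding base_def numer_def denom_def shift_def using assms(2)
    by (intro continuous_intros) (auto simp: regular_def)
  show "inj_on base U" using inj_on_base assms(2) by (rule inj_on_subset)
qed fact

lemma inj_on_\<Phi>: "inj_on (\<Phi> h) (cyl regular)"
proof (rule inj_onI)
  fix p q assume r: "p \<in> cyl regular" "q \<in> cyl regular" and eq: "\<Phi> h p = \<Phi> h q"
  obtain t x u s y v where pq: "p = (t, x, u)" "q = (s, y, v)" by (cases p, cases q)
  have "base (t, x) = base (s, y)" using eq by (simp add: pq \<Phi>_apply prod_eq_iff)
  from inj_onD[OF inj_on_base this] r have "t = s" "x = y" by (simp_all add: pq mem_cyl)
  with eq r factor_nonzero[of "(s, y)"] show "p = q" by (simp add: pq \<Phi>_apply mem_cyl)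
qed

lemma \<Phi>_image_cyl:
  assumes "U \<subseteq> regular"
  shows "\<Phi> h ` cyl U = cyl (base ` U)"
proof (intro equalityI subsetI)
  fix q assume "q \<in> \<Phi> h ` cyl U"
  then obtain t x u where "(t, x) \<in> U" "q = \<Phi> h (t, x, u)" by (auto simp: cyl_def)
  then show "q \<in> cyl (base ` U)" by (simp add: \<Phi>_apply mem_cyl)
next
  fix q assume *: "q \<in> cyl (base ` U)"
  obtain a b v where q: "q = (a, b, v)" by (cases q)
  then have "(a, b) \<in> base ` U" using * by (simp add: mem_cyl)
  then obtain t x where tx: "(t, x) \<in> U" "base (t, x) = (a, b)" by fastforce
  then have "q = \<Phi> h (t, x, v / factor (t, x) - h (t, x))"
    using factor_nonzero[of "(t, x)"] assms by (auto simp: \<Phi>_apply q)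
  with tx(1) show "q \<in> \<Phi> h ` cyl U" by (auto simp: mem_cyl)
qed

text \<open>Written with \<open>n\<close> in the denominator, the derivative has the right sign on
  both half-lines, so the two components of the regular set can be treated together.\<close>

lemma DERIV_sqrt_abs: "n \<noteq> 0 \<Longrightarrow> ((\<lambda>n. sqrt \<bar>n\<bar>) has_real_derivative sqrt \<bar>n\<bar> / (2 * n)) (at n)"
proof (cases "n > 0")
  case True
  have "(sqrt has_real_derivative sqrt \<bar>n\<bar> / (2 * n)) (at n)"
    using True real_sqrt_mult_self[of n] by (auto intro!: derivative_eq_intros simp: field_simps)
  then show ?thesis
    by (rule has_field_derivative_transform_within_open[of _ _ _ "{0<..}"]) (use True in auto)
next
  case False
  moreover assume "n \<noteq> 0"
  ultimately have n: "n < 0" by simp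
  have "((\<lambda>n. sqrt (- n)) has_real_derivative sqrt \<bar>n\<bar> / (2 * n)) (at n)"
    using n real_sqrt_mult_self[of "- n"] by (auto intro!: derivative_eq_intros simp: field_simps)
  then show ?thesis
    by (rule has_field_derivative_transform_within_open[of _ _ _ "{..<0}"]) (use n in auto)
qed

text \<open>\<open>log_t\<close> and \<open>log_x\<close> are the logarithmic derivatives of
  \<open>factor\<close>. The term \<open>\<gamma> / (2 * denom t)\<close> comes from the square
  root, all others from the exponent.\<close>

definition "log_t t x = \<gamma> / (2 * denom t) + \<gamma> * l1 * shift t x / (2 * denom t)
  - \<gamma>\<^sup>2 * (shift t x)\<^sup>2 / (4 * (denom t)\<^sup>2) - l1\<^sup>2 / 4"
definition "log_x t x = \<gamma> * shift t x / (2 * denom t) - l1 / 2"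

lemma factor_has_derivative:
  assumes "denom t \<noteq> 0"
  shows "(factor has_derivative (\<lambda>(dt, dx). factor (t, x) * (dt * log_t t x + dx * log_x t x))) (at (t, x))"
proof -
  have d: "((\<lambda>p::real \<times> real. denom (fst p)) has_derivative (\<lambda>p. \<gamma> * fst p)) (at (t, x))"
    unfolding denom_def by (auto intro!: derivative_eq_intros)
  have s: "((\<lambda>p. shift (fst p) (snd p)) has_derivative (\<lambda>p. snd p + l1 * fst p)) (at (t, x))"
    unfolding shift_def by (auto intro!: derivative_eq_intros)
  from DERIV_compose_FDERIV[OF DERIV_sqrt_abs d] assms
  have 1: "((\<lambda>p::real \<times> real. sqrt \<bar>denom (fst p)\<bar>) has_derivative
      (\<lambda>p. sqrt \<bar>denom t\<bar> * (\<gamma> * fst p / (2 * denom t)))) (at (t, x))"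
    by (simp add: mult_ac)
  define Q where "Q = (\<lambda>p. \<gamma> * (shift (fst p) (snd p))\<^sup>2 / (4 * denom (fst p)) - l1 / 2 * snd p - l1\<^sup>2 / 4 * fst p)"
  have Q: "(Q has_derivative (\<lambda>p. fst p * (log_t t x - \<gamma> / (2 * denom t)) + snd p * log_x t x)) (at (t, x))"
  proof (rule has_derivative_eq_rhs)
    show "(Q has_derivative (\<lambda>p. (\<gamma> * (2 * shift t x * (snd p + l1 * fst p)) * (4 * denom t)
        - \<gamma> * (shift t x)\<^sup>2 * (4 * (\<gamma> * fst p))) / (4 * denom t * (4 * denom t)) - l1 / 2 * snd p - l1\<^sup>2 / 4 * fst p)) (at (t, x))"
      unfolding Q_def using assms
      by (auto intro!: derivative_eq_intros d s simp: power2_eq_square fun_eq_iff algebra_simps)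
    show "(\<lambda>p. (\<gamma> * (2 * shift t x * (snd p + l1 * fst p)) * (4 * denom t)
        - \<gamma> * (shift t x)\<^sup>2 * (4 * (\<gamma> * fst p))) / (4 * denom t * (4 * denom t)) - l1 / 2 * snd p - l1\<^sup>2 / 4 * fst p)
        = (\<lambda>p. fst p * (log_t t x - \<gamma> / (2 * denom t)) + snd p * log_x t x)"
      unfolding log_t_def log_x_def using assms by (auto simp: field_simps power2_eq_square)
  qed
  have F: "factor = (\<lambda>p. \<sigma> * sqrt \<bar>denom (fst p)\<bar> * exp (Q p))" by (simp add: factor_def Q_def fun_eq_iff)
  show ?thesis
  proof (rule has_derivative_eq_rhs)
    show "(factor has_derivative (\<lambda>p. \<sigma> * sqrt \<bar>denom t\<bar> *
        ((fst p * (log_t t x - \<gamma> / (2 * denom t)) + snd p * log_x t x) * exp (Q (t, x)))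
        + \<sigma> * (sqrt \<bar>denom t\<bar> * (\<gamma> * fst p / (2 * denom t))) * exp (Q (t, x)))) (at (t, x))"
      using has_derivative_mult[OF has_derivative_mult[OF has_derivative_const 1] has_derivative_exp[OF Q], of \<sigma>]
      by (simp add: F)
    show "(\<lambda>p. \<sigma> * sqrt \<bar>denom t\<bar> *
        ((fst p * (log_t t x - \<gamma> / (2 * denom t)) + snd p * log_x t x) * exp (Q (t, x)))
        + \<sigma> * (sqrt \<bar>denom t\<bar> * (\<gamma> * fst p / (2 * denom t))) * exp (Q (t, x)))
        = (\<lambda>(dt, dx). factor (t, x) * (dt * log_t t x + dx * log_x t x))"
      by (auto simp: F algebra_simps)
  qed
qed

lemma \<Phi>_has_derivative:
  assumes r: "(t, x) \<in> regular" and h: "heat_solution \<Omega> h" "(t, x) \<in> \<Omega>"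
  shows "(\<Phi> h has_derivative (\<lambda>(dt, dx, du). (dt / (denom t)\<^sup>2,
      dx / denom t + dt * (l1 / denom t - \<gamma> * shift t x / (denom t)\<^sup>2),
      factor (t, x) * (du + dt * d_t h (t, x) + dx * d_x h (t, x)
        + (u + h (t, x)) * (dt * log_t t x + dx * log_x t x))))) (at (t, x, u))"
proof -
  have D: "denom t \<noteq> 0" using r by (simp add: mem_regular)
  have sh: "smooth_on \<Omega> h" using h by (simp add: heat_solution_def)
  have 1: "((\<lambda>p :: real \<times> real \<times> real. numer (fst p) / denom (fst p)) has_derivative
      (\<lambda>p. fst p / (denom t)\<^sup>2)) (at (t, x, u))"
  proof (rule has_derivative_eq_rhs)
    show "((\<lambda>p :: real \<times> real \<times> real. numer (fst p) / denom (fst p)) has_derivative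
        (\<lambda>p. (\<alpha> * fst p * denom t - numer t * (\<gamma> * fst p)) / (denom t * denom t))) (at (t, x, u))"
      using D unfolding numer_def denom_def by (auto intro!: derivative_eq_intros)
    have "\<alpha> * s * denom t - numer t * (\<gamma> * s) = (\<alpha> * \<delta> - \<beta> * \<gamma>) * s" for s
      by (simp add: numer_def denom_def algebra_simps)
    then show "(\<lambda>p. (\<alpha> * fst p * denom t - numer t * (\<gamma> * fst p)) / (denom t * denom t)) =
        (\<lambda>p. fst p / (denom t)\<^sup>2)"
      by (simp add: det power2_eq_square)
  qed
  have 2: "((\<lambda>p :: real \<times> real \<times> real. shift (fst p) (fst (snd p)) / denom (fst p)) has_derivative
      (\<lambda>p. fst (snd p) / denom t + fst p * (l1 / denom t - \<gamma> * shift t x / (denom t)\<^sup>2))) (at (t, x, u))"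
  proof (rule has_derivative_eq_rhs)
    show "((\<lambda>p :: real \<times> real \<times> real. shift (fst p) (fst (snd p)) / denom (fst p)) has_derivative
        (\<lambda>p. ((fst (snd p) + l1 * fst p) * denom t - shift t x * (\<gamma> * fst p)) / (denom t * denom t))) (at (t, x, u))"
      using D unfolding shift_def denom_def by (auto intro!: derivative_eq_intros)
    show "(\<lambda>p. ((fst (snd p) + l1 * fst p) * denom t - shift t x * (\<gamma> * fst p)) / (denom t * denom t)) =
        (\<lambda>p. fst (snd p) / denom t + fst p * (l1 / denom t - \<gamma> * shift t x / (denom t)\<^sup>2))"
      using D by (auto simp: field_simps power2_eq_square)
  qed
  have 3: "((\<lambda>p :: real \<times> real \<times> real. factor (fst p, fst (snd p))) has_derivative
      (\<lambda>p. factor (t, x) * (fst p * log_t t x + fst (snd p) * log_x t x))) (at (t, x, u))"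
    using has_derivative_base_compose[OF factor_has_derivative[OF D]] by (simp add: case_prod_unfold)
  have 4: "((\<lambda>p :: real \<times> real \<times> real. h (fst p, fst (snd p))) has_derivative
      (\<lambda>p. fst p * d_t h (t, x) + fst (snd p) * d_x h (t, x))) (at (t, x, u))"
    using has_derivative_base_compose[OF smooth_on_has_derivative_partials[OF sh h(2)]]
    by (simp add: case_prod_unfold)
  have 5: "((\<lambda>p :: real \<times> real \<times> real. snd (snd p)) has_derivative (\<lambda>p. snd (snd p))) (at (t, x, u))"
    by (auto intro!: derivative_eq_intros)
  have \<Phi>: "\<Phi> h = (\<lambda>p. (numer (fst p) / denom (fst p), shift (fst p) (fst (snd p)) / denom (fst p),
      factor (fst p, fst (snd p)) * (snd (snd p) + h (fst p, fst (snd p)))))"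
    by (auto simp: \<Phi>_apply base_def)
  have "(\<Phi> h has_derivative (\<lambda>p. (fst p / (denom t)\<^sup>2,
      fst (snd p) / denom t + fst p * (l1 / denom t - \<gamma> * shift t x / (denom t)\<^sup>2),
      factor (t, x) * (snd (snd p) + (fst p * d_t h (t, x) + fst (snd p) * d_x h (t, x)))
      + factor (t, x) * (fst p * log_t t x + fst (snd p) * log_x t x) * (u + h (t, x))))) (at (t, x, u))"
    unfolding \<Phi> using has_derivative_Pair[OF 1 has_derivative_Pair[OF 2 has_derivative_mult[OF 3 has_derivative_add[OF 5 4]]]]
    by simp
  then show ?thesis by (rule has_derivative_eq_rhs) (auto simp: algebra_simps)
qed

text \<open>The essential part is carried to the essential field with coefficients \<open>b\<close>,
  and the remainder is vertical. It vanishes exactly when \<open>h\<close> solves the determining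
  equation, which is where that equation comes from.\<close>

lemma frechet_\<Phi>_alg_field:
  assumes r: "(t, x) \<in> regular" and h: "heat_solution \<Omega> h" "(t, x) \<in> \<Omega>"
    and a: "a = pull_coeffs \<alpha> \<beta> \<gamma> \<delta> l1 l0 b"
  shows "frechet_derivative (\<Phi> h) (at (t, x, u)) (alg_field a f (t, x, u)) = alg_field b (\<lambda>q. 0) (\<Phi> h (t, x, u))
    + (0, 0, factor (t, x) * (f (t, x) + tau a t * d_t h (t, x) + xi a t x * d_x h (t, x) - eta a t x * h (t, x)))"
proof -
  have D: "denom t \<noteq> 0" using r by (simp add: mem_regular)
  note N = denom_def[of t, symmetric] numer_def[of t, symmetric] shift_def[of t x, symmetric]
  have 1: "tau a t / (denom t)\<^sup>2 = tau b (numer t / denom t)"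
    using pull_coeffs_tau[where \<alpha> = \<alpha> and \<beta> = \<beta> and \<gamma> = \<gamma> and \<delta> = \<delta> and t = t and ?l1.0 = l1 and ?l0.0 = l0 and b = b] D by (simp add: a N)
  have 2: "xi a t x / denom t + tau a t * (l1 / denom t - \<gamma> * shift t x / (denom t)\<^sup>2)
      = xi b (numer t / denom t) (shift t x / denom t)"
    using pull_coeffs_xi[OF _ det, where t = t and x = x and ?l1.0 = l1 and ?l0.0 = l0 and b = b] D by (simp add: a N)
  have 3: "eta a t x + tau a t * log_t t x + xi a t x * log_x t x = eta b (numer t / denom t) (shift t x / denom t)"
    using pull_coeffs_eta[OF _ det, where t = t and x = x and ?l1.0 = l1 and ?l0.0 = l0 and b = b] D by (simp add: a N log_t_def log_x_def)
  show ?thesis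
    unfolding frechet_derivative_at[OF \<Phi>_has_derivative[OF r h, of u], symmetric] alg_field_apply \<Phi>_apply base_def
    by (simp add: 1 2 flip: 3) (simp add: algebra_simps)
qed

lemma pushforward_apply:
  assumes "U \<subseteq> regular" "p \<in> cyl U"
  shows "pushforward (cyl U) (\<Phi> h) X (\<Phi> h p) = frechet_derivative (\<Phi> h) (at p) (X p)"
proof -
  have "inj_on (\<Phi> h) (cyl U)"
    using inj_on_\<Phi> by (rule inj_on_subset) (use assms(1) in \<open>auto simp: cyl_def\<close>)
  with assms(2) show ?thesis by (simp add: pushforward_def inv_into_f_f)
qed

lemma frechet_\<Phi>_scale:
  assumes "heat_solution \<Omega> h" "U \<subseteq> \<Omega> \<inter> regular" "p \<in> cyl U"
  shows "frechet_derivative (\<Phi> h) (at p) (k *\<^sub>R v) = k *\<^sub>R frechet_derivative (\<Phi> h) (at p) v"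
proof -
  obtain t x u where p: "p = (t, x, u)" "(t, x) \<in> U" using assms(3) by (cases p) (auto simp: mem_cyl)
  have "\<Phi> h differentiable (at p)"
    using \<Phi>_has_derivative[OF _ assms(1), of t x u] p assms(2) unfolding differentiable_def by blast
  then show ?thesis using linear_frechet_derivative linear_scale by blast
qed

lemma pushforward_line:
  assumes h: "heat_solution \<Omega> h" and U: "U \<subseteq> \<Omega> \<inter> regular" and "c \<noteq> 0"
    and eq: "\<And>p. p \<in> cyl U \<Longrightarrow> frechet_derivative (\<Phi> h) (at p) (X p) = c *\<^sub>R B (\<Phi> h p)"
  shows "pushforward (cyl U) (\<Phi> h) ` line U X = line (base ` U) B"
proof -
  have 1: "pushforward (cyl U) (\<Phi> h) (restr U (\<lambda>p. k *\<^sub>R X p)) = restr (base ` U) (\<lambda>p. (k * c) *\<^sub>R B p)" for k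
  proof
    fix q
    show "pushforward (cyl U) (\<Phi> h) (restr U (\<lambda>p. k *\<^sub>R X p)) q = restr (base ` U) (\<lambda>p. (k * c) *\<^sub>R B p) q"
    proof (cases "q \<in> \<Phi> h ` cyl U")
      case True
      then obtain p where p: "p \<in> cyl U" "q = \<Phi> h p" by blast
      then have "q \<in> cyl (base ` U)" using \<Phi>_image_cyl U by blast
      with p U show ?thesis
        by (simp add: pushforward_apply restr_apply frechet_\<Phi>_scale[OF h U] eq)
    next
      case False
      then have "q \<notin> cyl (base ` U)" using \<Phi>_image_cyl[of U h] U by blast
      with False show ?thesis by (simp add: pushforward_def restr_apply)
    qed
  qed
  have "line (base ` U) B = range (\<lambda>k. restr (base ` U) (\<lambda>p. (k * c) *\<^sub>R B p))"
  proof -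
    have "restr (base ` U) (\<lambda>p. k *\<^sub>R B p) = restr (base ` U) (\<lambda>p. (k / c * c) *\<^sub>R B p)" for k
      using \<open>c \<noteq> 0\<close> by simp
    then show ?thesis unfolding line_def by blast
  qed
  moreover have "line U X = range (\<lambda>k. restr U (\<lambda>p. k *\<^sub>R X p))" by (auto simp: line_def)
  ultimately show ?thesis by (simp add: image_image 1)
qed

text \<open>Reduces equivalence of two lines to a pointwise identity between generators, up to a
  constant factor; the image of \<open>U\<close> serves as \<open>V\<close>.\<close>

lemma G_equivalent_linesI:
  assumes h: "heat_solution \<Omega> h" and U: "U \<subseteq> \<Omega> \<inter> regular" "open U" "U \<subseteq> \<Omega>1" "base ` U \<subseteq> \<Omega>2" and "c \<noteq> 0"
    and eq: "\<And>p. p \<in> cyl U \<Longrightarrow> frechet_derivative (\<Phi> h) (at p) (X p) = c *\<^sub>R B (\<Phi> h p)"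
    and nz: "p \<in> cyl U" "X p \<noteq> 0" "q \<in> cyl (base ` U)" "B q \<noteq> 0"
  shows "G_equivalent (\<Omega>1, line \<Omega>1 X) (\<Omega>2, line \<Omega>2 B)"
proof -
  have "(cyl (\<Omega> \<inter> regular), \<Phi> h) \<in> heat_pseudogroup"
    unfolding heat_pseudogroup_def regular_def using det \<sigma> h by blast
  moreover have "open (base ` U)" using open_base_image U by blast
  moreover have "U \<noteq> {}" using nz(1) by (auto simp: cyl_def)
  moreover have "inj_on (restr U) (line \<Omega>1 X)" "inj_on (restr (base ` U)) (line \<Omega>2 B)"
    using inj_on_restr_line nz U by blast+
  moreover have "cyl U \<subseteq> cyl (\<Omega> \<inter> regular)" using U by (auto simp: cyl_def)
  moreover have "\<Phi> h ` cyl U = cyl (base ` U)" using \<Phi>_image_cyl U by blast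
  moreover have "pushforward (cyl U) (\<Phi> h) ` restr U ` line \<Omega>1 X = restr (base ` U) ` line \<Omega>2 B"
    unfolding restr_image_line[OF U(3)] restr_image_line[OF U(4)] by (rule pushforward_line[OF h U(1) \<open>c \<noteq> 0\<close> eq])
  ultimately show ?thesis
    unfolding G_equivalent_def prod.case using U
    by (intro bexI[of _ "(cyl (\<Omega> \<inter> regular), \<Phi> h)"]) (unfold prod.case, intro exI[of _ U] exI[of _ "base ` U"], auto)
qed

end

section \<open>Classification\<close>

lemma coefficient_diff:
  "tau (a - b) t = tau a t - tau b t" "xi (a - b) t x = xi a t x - xi b t x"
  "eta (a - b) t x = eta a t x - eta b t x"
  by (cases a; cases b; simp add: xi_def field_simps)+

lemma heat_solution_zero: "open \<Omega> \<Longrightarrow> heat_solution \<Omega> (\<lambda>p. 0)"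
  by (rule heat_solutionI[where A = "\<lambda>p. 0" and m = "\<lambda>p. 0"]) (auto intro: smooth_on_const)

lemma normal_forms_nonzero: "b \<in> normal_forms \<Longrightarrow> b \<noteq> 0"
  by (auto simp: normal_forms_def zero_prod_def)

lemma G_equivalent_normal_form:
  assumes f: "heat_solution \<Omega> f" and "\<Omega> \<noteq> {}" "a \<noteq> 0"
  obtains b where "b \<in> normal_forms"
    "G_equivalent (\<Omega>, line \<Omega> (alg_field a f)) (UNIV, line UNIV (alg_field b (\<lambda>q. 0)))"
proof -
  obtain c b where c: "c \<noteq> 0" and b: "b \<in> normal_forms" and "equiv_coeffs a (c *\<^sub>R b)"
    using normal_form_exists[OF \<open>a \<noteq> 0\<close>] .
  then obtain \<alpha> \<beta> \<gamma> \<delta> l1 l0 where det: "\<alpha> * \<delta> - \<beta> * \<gamma> = 1"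
    and a: "a = pull_coeffs \<alpha> \<beta> \<gamma> \<delta> l1 l0 (c *\<^sub>R b)"
    unfolding equiv_coeffs_def by blast
  \<comment> \<open>\<sigma> = 1 will do, since rescaling \<open>u\<close> does not change the
    essential coefficients.\<close>
  interpret heat_map \<alpha> \<beta> \<gamma> \<delta> l1 l0 1 by unfold_locales (simp_all add: det)
  have "open \<Omega>" using f by (simp add: heat_solution_def)
  \<comment> \<open>The coefficients dictate the matrix, which may be singular on a part of
    \<Omega>; hence the equation for \<open>h\<close> is solved inside the regular set.\<close>
  then have "heat_solution (\<Omega> \<inter> regular) f"
    using heat_solution_subset[OF f] open_regular by auto
  then obtain U h where U: "open U" "U \<noteq> {}" "U \<subseteq> \<Omega> \<inter> regular" and h: "heat_solution U h" and
    eq: "\<And>t x. (t, x) \<in> U \<Longrightarrow>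
      tau a t * d_t h (t, x) + xi a t x * d_x h (t, x) - eta a t x * h (t, x) = - f (t, x)"
    using determining_equation_solvable[OF _ regular_inter_nonempty[OF \<open>open \<Omega>\<close> \<open>\<Omega> \<noteq> {}\<close>] \<open>a \<noteq> 0\<close>, of f] by metis
  obtain p where p: "p \<in> cyl U" "alg_field a f p \<noteq> 0"
    using alg_field_nonzero[OF U(1,2) \<open>a \<noteq> 0\<close>] .
  have "open (base ` U)" "base ` U \<noteq> {}" using open_base_image U by auto
  then obtain q where q: "q \<in> cyl (base ` U)" "alg_field b (\<lambda>q. 0) q \<noteq> 0"
    using alg_field_nonzero[OF _ _ normal_forms_nonzero[OF b]] by metis
  have "G_equivalent (\<Omega>, line \<Omega> (alg_field a f)) (UNIV, line UNIV (alg_field b (\<lambda>q. 0)))"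
  proof (rule G_equivalent_linesI[where X = "alg_field a f" and B = "alg_field b (\<lambda>q. 0)", OF h _ U(1) _ _ c _ p q])
    fix p assume "p \<in> cyl U"
    then obtain t x u where p: "p = (t, x, u)" "(t, x) \<in> U" "(t, x) \<in> regular"
      using U(3) by (cases p) (auto simp: mem_cyl)
    have "f (t, x) + tau a t * d_t h (t, x) + xi a t x * d_x h (t, x) - eta a t x * h (t, x) = 0"
      using eq[OF p(2)] by simp
    then show "frechet_derivative (\<Phi> h) (at p) (alg_field a f p) = c *\<^sub>R alg_field b (\<lambda>q. 0) (\<Phi> h p)"
      unfolding p(1) frechet_\<Phi>_alg_field[OF p(3) h p(2) a] alg_field_scale
      by (simp only: mult_zero_right) (simp add: zero_prod_def[symmetric])
  qed (use U in auto)
  with b that show ?thesis by blast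
qed

lemma one_dim_subalgebra_line_nonzero:
  assumes "(\<Omega>, line \<Omega> X) \<in> one_dim_subalgebras"
  shows "line \<Omega> X \<noteq> {\<lambda>p. 0}"
  using assms by (auto simp: one_dim_subalgebras_def)

text \<open>The converse of \<open>G_equivalent_linesI\<close>. \<open>B\<close> over
  \<open>V\<close> is the image of some \<open>k *\<^sub>R X\<close>, and \<open>k\<close> is
  nonzero because the nondegeneracy condition keeps \<open>B\<close> from vanishing over all of
  \<open>V\<close>.\<close>

lemma G_equivalent_linesE:
  assumes "G_equivalent (\<Omega>1, line \<Omega>1 X) (\<Omega>2, line \<Omega>2 B)" "line \<Omega>2 B \<noteq> {\<lambda>p. 0}"
  obtains \<alpha> \<beta> \<gamma> \<delta> l1 l0 \<sigma> \<Omega> h U c q where "heat_map \<alpha> \<beta> \<gamma> \<delta> \<sigma>" "heat_solution \<Omega> h" "open U" "U \<noteq> {}"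
    "U \<subseteq> \<Omega> \<inter> heat_map.regular \<gamma> \<delta>" "U \<subseteq> \<Omega>1" "heat_map.base \<alpha> \<beta> \<gamma> \<delta> l1 l0 ` U \<subseteq> \<Omega>2" "c \<noteq> 0"
    "\<And>p. p \<in> cyl U \<Longrightarrow> frechet_derivative (heat_trans \<alpha> \<beta> \<gamma> \<delta> l1 l0 \<sigma> h) (at p) (X p)
      = c *\<^sub>R B (heat_trans \<alpha> \<beta> \<gamma> \<delta> l1 l0 \<sigma> h p)"
    "q \<in> cyl (heat_map.base \<alpha> \<beta> \<gamma> \<delta> l1 l0 ` U)" "B q \<noteq> 0"
proof -
  obtain W \<Phi> U V where W: "(W, \<Phi>) \<in> heat_pseudogroup" and U: "open U" "U \<noteq> {}" "U \<subseteq> \<Omega>1" "cyl U \<subseteq> W"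
    and V: "V \<subseteq> \<Omega>2" "\<Phi> ` cyl U = cyl V" and inj: "inj_on (restr V) (line \<Omega>2 B)"
    and push: "pushforward (cyl U) \<Phi> ` restr U ` line \<Omega>1 X = restr V ` line \<Omega>2 B"
    using assms(1) unfolding G_equivalent_def by auto
  obtain \<alpha> \<beta> \<gamma> \<delta> l1 l0 \<sigma> \<Omega> h where g: "\<alpha> * \<delta> - \<beta> * \<gamma> = 1" "\<sigma> \<noteq> 0" and h: "heat_solution \<Omega> h"
    and W': "W = cyl (\<Omega> \<inter> {(t, x). \<gamma> * t + \<delta> \<noteq> 0})" and \<Phi>: "\<Phi> = heat_trans \<alpha> \<beta> \<gamma> \<delta> l1 l0 \<sigma> h"
    using W unfolding heat_pseudogroup_def by blast
  interpret heat_map \<alpha> \<beta> \<gamma> \<delta> l1 l0 \<sigma> by unfold_locales fact+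
  have UO: "U \<subseteq> \<Omega> \<inter> regular"
  proof
    fix p assume "p \<in> U"
    then have "(fst p, snd p, 0) \<in> W" using U(4) by (auto simp: mem_cyl)
    then show "p \<in> \<Omega> \<inter> regular" by (simp add: W' mem_cyl regular_def case_prod_unfold)
  qed
  then have UR: "U \<subseteq> regular" by blast
  have "cyl V = cyl (base ` U)" using V(2) \<Phi>_image_cyl[OF UR] by (simp add: \<Phi>)
  then have VU: "V = base ` U" by (force simp: cyl_def set_eq_iff)
  obtain q where q: "q \<in> cyl V" "B q \<noteq> 0"
    using nonzero_if_inj_on_restr_line[OF inj V(1) assms(2)] .
  have "restr V B \<in> restr V ` line \<Omega>2 B"
    unfolding restr_image_line[OF V(1)] by (auto simp: line_def intro!: exI[of _ 1])
  then obtain k where k: "restr V B = pushforward (cyl U) \<Phi> (restr U (\<lambda>p. k *\<^sub>R X p))"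
    unfolding push[symmetric] restr_image_line[OF U(3)] by (auto simp: line_def)
  have eq: "B (\<Phi> p) = k *\<^sub>R frechet_derivative \<Phi> (at p) (X p)" if p: "p \<in> cyl U" for p
  proof -
    have "\<Phi> p \<in> cyl V" using p V(2) by blast
    then have "B (\<Phi> p) = restr V B (\<Phi> p)" by (simp add: restr_apply)
    also have "\<dots> = frechet_derivative \<Phi> (at p) (k *\<^sub>R X p)"
      unfolding k \<Phi> using p UR by (simp add: pushforward_apply restr_apply)
    finally show ?thesis unfolding \<Phi> using frechet_\<Phi>_scale[OF h UO p] by simp
  qed
  have "k \<noteq> 0"
  proof
    assume "k = 0"
    obtain p where "p \<in> cyl U" "q = \<Phi> p" using q(1) V(2) by blast
    with eq q(2) \<open>k = 0\<close> show False by simp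
  qed
  show ?thesis
  proof (rule that[of \<alpha> \<beta> \<gamma> \<delta> \<sigma> \<Omega> h U l1 l0 "1 / k" q])
    show "frechet_derivative (heat_trans \<alpha> \<beta> \<gamma> \<delta> l1 l0 \<sigma> h) (at p) (X p)
      = (1 / k) *\<^sub>R B (heat_trans \<alpha> \<beta> \<gamma> \<delta> l1 l0 \<sigma> h p)" if "p \<in> cyl U" for p
      using eq[OF that] \<open>k \<noteq> 0\<close> unfolding \<Phi> by simp
  qed (use h U UO V VU q \<open>k \<noteq> 0\<close> heat_map_axioms in auto)
qed

text \<open>The field with the pulled back coefficients \<open>a'\<close> is mapped to that of
  \<open>c *\<^sub>R b\<close> up to a vertical term depending on \<open>(t, x)\<close> only.
  Subtracting it from the given field leaves a field with such a vertical image, which forces its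
  \<open>tau\<close>, \<open>xi\<close> and \<open>eta\<close> to vanish.\<close>

lemma G_equivalent_imp_equiv_coeffs:
  assumes "G_equivalent (\<Omega>1, line \<Omega>1 (alg_field a f)) (\<Omega>2, line \<Omega>2 (alg_field b g))"
    "line \<Omega>2 (alg_field b g) \<noteq> {\<lambda>p. 0}"
  obtains c where "c \<noteq> 0" "equiv_coeffs a (c *\<^sub>R b)"
proof -
  obtain \<alpha> \<beta> \<gamma> \<delta> l1 l0 \<sigma> \<Omega> h U c q where m: "heat_map \<alpha> \<beta> \<gamma> \<delta> \<sigma>" and h: "heat_solution \<Omega> h" and
    U: "open U" "U \<noteq> {}" "U \<subseteq> \<Omega> \<inter> heat_map.regular \<gamma> \<delta>" and c: "c \<noteq> 0" and
    eq: "\<And>p. p \<in> cyl U \<Longrightarrow> frechet_derivative (heat_trans \<alpha> \<beta> \<gamma> \<delta> l1 l0 \<sigma> h) (at p) (alg_field a f p)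
      = c *\<^sub>R alg_field b g (heat_trans \<alpha> \<beta> \<gamma> \<delta> l1 l0 \<sigma> h p)"
    using G_equivalent_linesE[OF assms] by metis
  interpret heat_map \<alpha> \<beta> \<gamma> \<delta> l1 l0 \<sigma> by fact
  define a' where "a' = pull_coeffs \<alpha> \<beta> \<gamma> \<delta> l1 l0 (c *\<^sub>R b)"
  have "a - a' = 0"
  proof (rule coeffs_eq_zeroI[OF U(1,2)])
    fix t x assume tx: "(t, x) \<in> U"
    then have r: "(t, x) \<in> regular" "(t, x) \<in> \<Omega>" "denom t \<noteq> 0" using U(3) by (auto simp: mem_regular)
    define e where "e = c * g (base (t, x)) - factor (t, x) *
      (tau a' t * d_t h (t, x) + xi a' t x * d_x h (t, x) - eta a' t x * h (t, x))"
    have *: "frechet_derivative (\<Phi> h) (at (t, x, u)) (alg_field (a - a') f (t, x, u)) = (0, 0, e)" for u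
    proof -
      have "\<Phi> h differentiable (at (t, x, u))"
        using \<Phi>_has_derivative[OF r(1) h r(2)] unfolding differentiable_def by blast
      then have lin: "linear (frechet_derivative (\<Phi> h) (at (t, x, u)))" by (rule linear_frechet_derivative)
      have diff: "alg_field (a - a') f (t, x, u) = alg_field a f (t, x, u) - alg_field a' (\<lambda>q. 0) (t, x, u)"
        by (simp add: alg_field_apply coefficient_diff algebra_simps)
      have "(t, x, u) \<in> cyl U" using tx by (simp add: mem_cyl)
      from eq[OF this] show ?thesis
        unfolding diff linear_diff[OF lin] frechet_\<Phi>_alg_field[OF r(1) h r(2) a'_def]
        by (simp add: alg_field_apply \<Phi>_apply coefficient_scale e_def algebra_simps)
    qed
    have **: "tau (a - a') t = 0 \<and> xi (a - a') t x = 0 \<and> factor (t, x) * (eta (a - a') t x * u + f (t, x)) = e" for u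
      using *[of u] r(3)
      unfolding frechet_derivative_at[OF \<Phi>_has_derivative[OF r(1) h r(2), of u], symmetric]
      by (auto simp: alg_field_apply)
    \<comment> \<open>The right-hand side \<open>e\<close> is the same for all
      \<open>u\<close>.\<close>
    have "factor (t, x) * eta (a - a') t x = 0" using **[of 0] **[of 1] by (simp add: algebra_simps)
    then show "tau (a - a') t = 0 \<and> xi (a - a') t x = 0 \<and> eta (a - a') t x = 0"
      using **[of 0] factor_nonzero[OF r(1)] by simp
  qed
  then have "a = a'" by simp
  from that[OF c equiv_coeffsI[OF det this[unfolded a'_def]]] show ?thesis .
qed

text \<open>On a vertical field that does not depend on \<open>u\<close>, the differential merely
  multiplies by \<open>factor\<close>. So \<open>h\<close> drops out, and the map without
  \<open>h\<close> applies the same factor to graphs.\<close>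

lemma G_equivalent_vZ_imp_G_ess_equivalent:
  assumes "G_equivalent (\<Omega>1, line \<Omega>1 (vZ f)) (\<Omega>2, line \<Omega>2 (vZ g))" "line \<Omega>2 (vZ g) \<noteq> {\<lambda>p. 0}"
  shows "G_ess_equivalent (\<Omega>1, f) (\<Omega>2, g)"
proof -
  obtain \<alpha> \<beta> \<gamma> \<delta> l1 l0 \<sigma> \<Omega> h U c q where m: "heat_map \<alpha> \<beta> \<gamma> \<delta> \<sigma>" and h: "heat_solution \<Omega> h" and
    U: "open U" "U \<noteq> {}" "U \<subseteq> \<Omega> \<inter> heat_map.regular \<gamma> \<delta>" "U \<subseteq> \<Omega>1"
      "heat_map.base \<alpha> \<beta> \<gamma> \<delta> l1 l0 ` U \<subseteq> \<Omega>2" and c: "c \<noteq> 0" and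
    eq: "\<And>p. p \<in> cyl U \<Longrightarrow> frechet_derivative (heat_trans \<alpha> \<beta> \<gamma> \<delta> l1 l0 \<sigma> h) (at p) (vZ f p)
      = c *\<^sub>R vZ g (heat_trans \<alpha> \<beta> \<gamma> \<delta> l1 l0 \<sigma> h p)" and
    q: "q \<in> cyl (heat_map.base \<alpha> \<beta> \<gamma> \<delta> l1 l0 ` U)" "vZ g q \<noteq> 0"
    using G_equivalent_linesE[OF assms] by metis
  interpret heat_map \<alpha> \<beta> \<gamma> \<delta> l1 l0 \<sigma> by fact
  \<comment> \<open>A line determines \<open>g\<close> only up to the constant \<open>c\<close>,
    whereas graphs have to match exactly; \<open>\<sigma> / c\<close> absorbs it.\<close>
  interpret scaled: heat_map \<alpha> \<beta> \<gamma> \<delta> l1 l0 "\<sigma> / c"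
    by unfold_locales (use det \<sigma> c in simp_all)
  have scaled: "scaled.factor p = factor p / c" for p
    by (simp add: scaled.factor_def factor_def denom_def shift_def scaled.denom_def scaled.shift_def)
  have fg: "factor (t, x) * f (t, x) = c * g (base (t, x))" if tx: "(t, x) \<in> U" for t x
  proof -
    have r: "(t, x) \<in> regular" "(t, x) \<in> \<Omega>" "(t, x, 0) \<in> cyl U" using U(3) tx by (auto simp: mem_cyl)
    show ?thesis
      using eq[OF r(3)]
      unfolding frechet_derivative_at[OF \<Phi>_has_derivative[OF r(1) h r(2), of 0], symmetric]
      by (simp add: vZ_def \<Phi>_apply)
  qed
  have UR: "U \<subseteq> regular" using U(3) by blast
  have pt: "scaled.\<Phi> (\<lambda>p. 0) (t, x, f (t, x)) = (fst (base (t, x)), snd (base (t, x)), g (base (t, x)))"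
    if "(t, x) \<in> U" for t x
    using fg[OF that] c
    by (simp add: scaled.\<Phi>_apply scaled scaled.base_def base_def numer_def denom_def shift_def
        scaled.numer_def scaled.denom_def scaled.shift_def)
  have "scaled.\<Phi> (\<lambda>p. 0) ` graph_on U f = graph_on (base ` U) g"
  proof (intro equalityI subsetI)
    fix y assume "y \<in> scaled.\<Phi> (\<lambda>p. 0) ` graph_on U f"
    then obtain t x where "(t, x) \<in> U" "y = scaled.\<Phi> (\<lambda>p. 0) (t, x, f (t, x))" by (auto simp: graph_on_def)
    then show "y \<in> graph_on (base ` U) g" using pt by (simp add: graph_on_def)
  next
    fix y assume "y \<in> graph_on (base ` U) g"
    then obtain p where "p \<in> base ` U" "y = (fst p, snd p, g p)" by (auto simp: graph_on_def)
    then obtain t x where "(t, x) \<in> U" "y = (fst (base (t, x)), snd (base (t, x)), g (base (t, x)))" by auto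
    then show "y \<in> scaled.\<Phi> (\<lambda>p. 0) ` graph_on U f" using pt[of t x] by (force simp: graph_on_def)
  qed
  moreover have "graph_on U f \<subseteq> cyl regular" using UR by (auto simp: graph_on_def mem_cyl)
  moreover have "(cyl regular, scaled.\<Phi> (\<lambda>p. 0)) \<in> heat_pseudogroup_ess"
    unfolding heat_pseudogroup_ess_def regular_def using scaled.det scaled.\<sigma> by blast
  moreover have g: "\<exists>p\<in>base ` U. g p \<noteq> 0"
    using q by (cases q) (auto simp: vZ_def mem_cyl zero_prod_def)
  moreover obtain t x where tx: "(t, x) \<in> U" "g (base (t, x)) \<noteq> 0" using g by auto
  then have "f (t, x) \<noteq> 0" using fg[OF tx(1)] c by auto
  then have "\<exists>p\<in>U. f p \<noteq> 0" using tx(1) by blast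
  ultimately show ?thesis
    unfolding G_ess_equivalent_def prod.case using U open_base_image[OF U(1) UR]
    by (intro bexI[of _ "(cyl regular, scaled.\<Phi> (\<lambda>p. 0))"]) (unfold prod.case, intro exI[of _ U] exI[of _ "base ` U"], auto)
qed

lemma G_ess_equivalent_imp_G_equivalent_vZ:
  assumes "G_ess_equivalent (\<Omega>1, f) (\<Omega>2, g)"
  shows "G_equivalent (\<Omega>1, line \<Omega>1 (vZ f)) (\<Omega>2, line \<Omega>2 (vZ g))"
proof -
  obtain W \<Phi> U V p q where W: "(W, \<Phi>) \<in> heat_pseudogroup_ess" and U: "open U" "U \<subseteq> \<Omega>1" and V: "V \<subseteq> \<Omega>2"
    and p: "p \<in> U" "f p \<noteq> 0" and q: "q \<in> V" "g q \<noteq> 0"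
    and graph: "graph_on U f \<subseteq> W" "\<Phi> ` graph_on U f = graph_on V g"
    using assms unfolding G_ess_equivalent_def by auto
  obtain \<alpha> \<beta> \<gamma> \<delta> l1 l0 \<sigma> where g: "\<alpha> * \<delta> - \<beta> * \<gamma> = 1" "\<sigma> \<noteq> 0"
    and W': "W = cyl {(t, x). \<gamma> * t + \<delta> \<noteq> 0}" and \<Phi>: "\<Phi> = heat_trans \<alpha> \<beta> \<gamma> \<delta> l1 l0 \<sigma> (\<lambda>p. 0)"
    using W unfolding heat_pseudogroup_ess_def by blast
  interpret heat_map \<alpha> \<beta> \<gamma> \<delta> l1 l0 \<sigma> by unfold_locales fact+
  have UR: "U \<subseteq> regular"
  proof
    fix p assume "p \<in> U"
    then have "(fst p, snd p, f p) \<in> W" using graph(1) by (auto simp: graph_on_def)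
    then show "p \<in> regular" by (simp add: W' mem_cyl regular_def case_prod_unfold)
  qed
  have fg: "base (t, x) \<in> V \<and> factor (t, x) * f (t, x) = g (base (t, x))" if "(t, x) \<in> U" for t x
  proof -
    have "(t, x, f (t, x)) \<in> graph_on U f" using that by (auto simp: graph_on_def)
    then have "\<Phi> (t, x, f (t, x)) \<in> graph_on V g" unfolding graph(2)[symmetric] by (rule imageI)
    then show ?thesis by (auto simp: \<Phi> \<Phi>_apply graph_on_def)
  qed
  then have VU: "base ` U \<subseteq> V" by auto
  have "V \<subseteq> base ` U"
  proof
    fix y assume "y \<in> V"
    then have "(fst y, snd y, g y) \<in> \<Phi> ` graph_on U f" unfolding graph(2) by (auto simp: graph_on_def)
    then obtain t x where "(t, x) \<in> U" "(fst y, snd y, g y) = \<Phi> (t, x, f (t, x))" by (auto simp: graph_on_def)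
    then show "y \<in> base ` U" by (auto simp: \<Phi> \<Phi>_apply prod_eq_iff intro!: image_eqI[of _ _ "(t, x)"])
  qed
  with VU have V': "V = base ` U" by blast
  have h: "heat_solution UNIV (\<lambda>p. 0)" by (simp add: heat_solution_zero)
  show ?thesis
  proof (rule G_equivalent_linesI[OF h _ U(1) U(2), where c = 1])
    show "(fst p, snd p, 0) \<in> cyl U" "vZ f (fst p, snd p, 0) \<noteq> 0"
      "(fst q, snd q, 0) \<in> cyl (base ` U)" "vZ g (fst q, snd q, 0) \<noteq> 0"
      using p q by (simp_all add: mem_cyl vZ_def zero_prod_def flip: V')
    fix y assume "y \<in> cyl U"
    then obtain t x u where y: "y = (t, x, u)" "(t, x) \<in> U" "(t, x) \<in> regular"
      using UR by (cases y) (auto simp: mem_cyl)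
    show "frechet_derivative (heat_trans \<alpha> \<beta> \<gamma> \<delta> l1 l0 \<sigma> (\<lambda>p. 0)) (at y) (vZ f y)
        = 1 *\<^sub>R vZ g (heat_trans \<alpha> \<beta> \<gamma> \<delta> l1 l0 \<sigma> (\<lambda>p. 0) y)"
      unfolding y(1) frechet_derivative_at[OF \<Phi>_has_derivative[OF y(3) h UNIV_I], symmetric]
      using fg[OF y(2)] by (simp add: vZ_def \<Phi>_apply)
  qed (use UR V V' in auto)
qed

section \<open>The list and the classification\<close>

lemma vZ_eq: "vZ f = alg_field 0 f"
  by (auto simp: zero_prod_def)

definition normal_lines :: "((real \<times> real) set \<times> vfield set) set" where
  "normal_lines = {(UNIV, line UNIV (alg_field b (\<lambda>q. 0))) | b. b \<in> normal_forms}"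

lemma normal_lines_eq:
  "normal_lines = {(UNIV, line UNIV (\<lambda>p. vP_t p + vG_x p))}
     \<union> {(UNIV, line UNIV (\<lambda>p. vP_t p + \<delta> *\<^sub>R vI p)) | \<delta>. \<delta> \<in> {-1, 0, 1::real}}
     \<union> {(UNIV, line UNIV (\<lambda>p. vD p + \<mu> *\<^sub>R vI p)) | \<mu>. (\<mu>::real) \<ge> 0}
     \<union> {(UNIV, line UNIV (\<lambda>p. vP_t p + vK p + \<nu> *\<^sub>R vI p)) | \<nu>::real. True}
     \<union> {(UNIV, line UNIV vP_x)} \<union> {(UNIV, line UNIV vI)}"
proof -
  have vZ: "vZ (\<lambda>q. 0) = (\<lambda>p. 0)" by (auto simp: vZ_def zero_prod_def)
  have nf: "normal_forms = {(1, 0, 0, 1, 0, 0)} \<union> {(1, 0, 0, 0, 0, \<delta>) | \<delta>. \<delta> \<in> {-1, 0, 1}}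
     \<union> {(0, 1, 0, 0, 0, \<mu>) | \<mu>. \<mu> \<ge> 0} \<union> {(1, 0, 1, 0, 0, \<nu>) | \<nu>. True}
     \<union> {(0, 0, 0, 0, 1, 0)} \<union> {(0, 0, 0, 0, 0, 1)}"
    unfolding normal_forms_def by blast
  have 1: "(\<lambda>p. vP_t p + vG_x p) = alg_field (1, 0, 0, 1, 0, 0) (\<lambda>q. 0)"
    "vP_x = alg_field (0, 0, 0, 0, 1, 0) (\<lambda>q. 0)" "vI = alg_field (0, 0, 0, 0, 0, 1) (\<lambda>q. 0)"
    by (simp_all add: vZ)
  have 2: "(\<lambda>p. vP_t p + \<delta> *\<^sub>R vI p) = alg_field (1, 0, 0, 0, 0, \<delta>) (\<lambda>q. 0)"
    "(\<lambda>p. vD p + \<delta> *\<^sub>R vI p) = alg_field (0, 1, 0, 0, 0, \<delta>) (\<lambda>q. 0)"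
    "(\<lambda>p. vP_t p + vK p + \<delta> *\<^sub>R vI p) = alg_field (1, 0, 1, 0, 0, \<delta>) (\<lambda>q. 0)" for \<delta>
    by (simp_all add: vZ)
  show ?thesis
    unfolding normal_lines_def nf 2 unfolding 1 by blast
qed

theorem lemma8:
  fixes F :: "((real \<times> real) set \<times> (real \<times> real \<Rightarrow> real)) set"
  assumes "complete_inequivalent_list G_ess_equivalent nonzero_heat_solutions F"
  shows "complete_inequivalent_list G_equivalent one_dim_subalgebras
    ({(UNIV, line UNIV (\<lambda>p. vP_t p + vG_x p))}
     \<union> {(UNIV, line UNIV (\<lambda>p. vP_t p + \<delta> *\<^sub>R vI p)) | \<delta>. \<delta> \<in> {-1, 0, 1::real}}
     \<union> {(UNIV, line UNIV (\<lambda>p. vD p + \<mu> *\<^sub>R vI p)) | \<mu>. (\<mu>::real) \<ge> 0}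
     \<union> {(UNIV, line UNIV (\<lambda>p. vP_t p + vK p + \<nu> *\<^sub>R vI p)) | \<nu>::real. True}
     \<union> {(UNIV, line UNIV vP_x)}
     \<union> {(UNIV, line UNIV vI)}
     \<union> {(\<Omega>, line \<Omega> (vZ f)) | \<Omega> f. (\<Omega>, f) \<in> F})"
proof -
  have F: "F \<subseteq> nonzero_heat_solutions"
    and F_complete: "\<And>s. s \<in> nonzero_heat_solutions \<Longrightarrow> \<exists>r\<in>F. G_ess_equivalent s r"
    and F_ineq: "\<And>s r. s \<in> F \<Longrightarrow> r \<in> F \<Longrightarrow> s \<noteq> r \<Longrightarrow> \<not> G_ess_equivalent s r"
    using assms by (auto simp: complete_inequivalent_list_def)
  define L where "L = {(\<Omega>, line \<Omega> (vZ f)) | \<Omega> f. (\<Omega>, f) \<in> F}"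
  have N: "normal_lines \<subseteq> one_dim_subalgebras"
  proof
    fix s assume "s \<in> normal_lines"
    then obtain b where b: "b \<in> normal_forms" "s = (UNIV, line UNIV (alg_field b (\<lambda>q. 0)))"
      by (auto simp: normal_lines_def)
    obtain p where "p \<in> cyl UNIV" "alg_field b (\<lambda>q. 0) p \<noteq> 0"
      using alg_field_nonzero[OF open_UNIV UNIV_not_empty normal_forms_nonzero[OF b(1)]] .
    then show "s \<in> one_dim_subalgebras"
      unfolding b(2) by (rule line_one_dim_subalgebra[OF heat_solution_zero[OF open_UNIV]])
  qed
  have L: "L \<subseteq> one_dim_subalgebras"
  proof
    fix s assume "s \<in> L"
    then obtain \<Omega> f where f: "(\<Omega>, f) \<in> F" "s = (\<Omega>, line \<Omega> (vZ f))" by (auto simp: L_def)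
    then obtain t x where "heat_solution \<Omega> f" "(t, x) \<in> \<Omega>" "f (t, x) \<noteq> 0"
      using F by (auto simp: nonzero_heat_solutions_def)
    then show "s \<in> one_dim_subalgebras"
      using line_one_dim_subalgebra[of \<Omega> f "(t, x, 0)" 0] unfolding f(2) vZ_eq[symmetric]
      by (simp add: mem_cyl vZ_def zero_prod_def)
  qed
  have complete: "\<exists>r \<in> normal_lines \<union> L. G_equivalent s r" if s: "s \<in> one_dim_subalgebras" for s
  proof -
    obtain \<Omega> S where s': "s = (\<Omega>, S)" by (cases s)
    obtain a f p where f: "heat_solution \<Omega> f" "S = line \<Omega> (alg_field a f)" and p: "p \<in> cyl \<Omega>" "alg_field a f p \<noteq> 0"
      using one_dim_subalgebra_cases[OF s[unfolded s']] .
    obtain t x u where p': "p = (t, x, u)" "(t, x) \<in> \<Omega>" using p(1) by (cases p) (auto simp: mem_cyl)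
    show ?thesis
    proof (cases "a = 0")
      case True
      then have "f (t, x) \<noteq> 0" using p(2) p'(1) by (simp add: flip: vZ_eq) (simp add: vZ_def zero_prod_def)
      then have "(\<Omega>, f) \<in> nonzero_heat_solutions" using f(1) p'(2) by (auto simp: nonzero_heat_solutions_def)
      then obtain \<Omega>' f' where "(\<Omega>', f') \<in> F" "G_ess_equivalent (\<Omega>, f) (\<Omega>', f')" using F_complete by fast
      then show ?thesis
        using G_ess_equivalent_imp_G_equivalent_vZ unfolding s' f(2) L_def True vZ_eq[symmetric] by blast
    next
      case False
      obtain b where "b \<in> normal_forms" "G_equivalent (\<Omega>, line \<Omega> (alg_field a f)) (UNIV, line UNIV (alg_field b (\<lambda>q. 0)))"
        using G_equivalent_normal_form[OF f(1) _ False] p'(2) by blast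
      then show ?thesis unfolding s' f(2) normal_lines_def by blast
    qed
  qed
  \<comment> \<open>The contrapositive is shown: equivalent members coincide. Each member is the
    line of some \<open>alg_field a f\<close>, either with \<open>a\<close> a normal form and
    \<open>f\<close> zero, or with \<open>a = 0\<close> and \<open>f\<close> from
    \<open>F\<close>.\<close>
  have inequivalent: "s = r" if s: "s \<in> normal_lines \<union> L" and r: "r \<in> normal_lines \<union> L" and G: "G_equivalent s r" for s r
  proof -
    have repr: "\<exists>a \<Omega> f. s = (\<Omega>, line \<Omega> (alg_field a f)) \<and>
        (a \<in> normal_forms \<and> \<Omega> = UNIV \<and> f = (\<lambda>q. 0) \<or> a = 0 \<and> (\<Omega>, f) \<in> F)" if "s \<in> normal_lines \<union> L" for s
      using that unfolding normal_lines_def L_def vZ_eq by blast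
    obtain a \<Omega> f where s': "s = (\<Omega>, line \<Omega> (alg_field a f))"
      and a: "a \<in> normal_forms \<and> \<Omega> = UNIV \<and> f = (\<lambda>q. 0) \<or> a = 0 \<and> (\<Omega>, f) \<in> F"
      using repr[OF s] by blast
    obtain b \<Omega>' g where r': "r = (\<Omega>', line \<Omega>' (alg_field b g))"
      and b: "b \<in> normal_forms \<and> \<Omega>' = UNIV \<and> g = (\<lambda>q. 0) \<or> b = 0 \<and> (\<Omega>', g) \<in> F"
      using repr[OF r] by blast
    have "r \<in> one_dim_subalgebras" using r N L by blast
    then have nz: "line \<Omega>' (alg_field b g) \<noteq> {\<lambda>p. 0}" unfolding r' by (rule one_dim_subalgebra_line_nonzero)
    obtain c where c: "c \<noteq> 0" "equiv_coeffs a (c *\<^sub>R b)"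
      using G_equivalent_imp_equiv_coeffs[OF G[unfolded s' r'] nz] .
    \<comment> \<open>So a member of one of these two kinds is never equivalent to one of the other
      kind.\<close>
    have ab: "a = 0 \<longleftrightarrow> b = 0" using equiv_coeffs_zero_iff[OF c(2)] c(1) by simp
    show ?thesis
    proof (cases "a = 0")
      case True
      then have F': "(\<Omega>, f) \<in> F" "(\<Omega>', g) \<in> F" using a b ab normal_forms_nonzero by blast+
      have "G_ess_equivalent (\<Omega>, f) (\<Omega>', g)"
        using G_equivalent_vZ_imp_G_ess_equivalent[of \<Omega> f \<Omega>' g] G nz True ab unfolding s' r' vZ_eq by simp
      then have "(\<Omega>, f) = (\<Omega>', g)" using F_ineq[OF F'] by blast
      then show ?thesis using True ab by (simp add: s' r')
    next
      case False
      then have ab': "a \<in> normal_forms" "b \<in> normal_forms" "\<Omega> = UNIV" "\<Omega>' = UNIV" "f = (\<lambda>q. 0)" "g = (\<lambda>q. 0)"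
        using a b ab by blast+
      have "a = b" using normal_forms_inequivalent[OF ab'(1,2) c] .
      then show ?thesis by (simp add: s' r' ab')
    qed
  qed
  show ?thesis
    unfolding normal_lines_eq[symmetric] L_def[symmetric] complete_inequivalent_list_def
    using N L complete inequivalent by blast
qed

end
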